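(* Let $\mathcal{H}_1\to\mathcal{H}_2$ be an isogeny of affine Hecke algebras with $|X_2/X_1|=n$, and let $V$ be a finite-dimensional $\mathcal{H}_1$-module with a $*$-invariant hermitian form of signature $(a,b)$. Then $\mathrm{Ind}_{\mathcal{H}_1}^{\mathcal{H}_2}V$ admits a $*$-invariant hermitian form with signature $(na,nb)$. In particular $\mathrm{Ind}_{\mathcal{H}_1}^{\mathcal{H}_2}$ preserves unitarity.
   Context: Affine Hecke algebras. Let $\mathcal{R} = (X,R,Y,R^\vee,\Delta)$ be a reduced based root datum ($X,Y$ free abelian of finite rank in perfect duality $\langle\cdot,\cdot\rangle$, $\Delta\subset R$ a base of simple roots), with finite Weyl group $W$, longest element $w_0\in W$ and simple reflections $s_\alpha$, $\alpha\in\Delta$. Fix $q\in\mathbb{R}_{>1}$ and parameter functions $\lambda,\lambda^*: R\to\mathbb{R}\setminus\{0\}$, constant on orbits of $W\ltimes X$ (acting on $R$ through $W$), with $\lambda(\alpha)=\lambda^*(\alpha)$ if $\alpha^\vee\notin 2Y$ and $\lambda(\alpha)+\lambda^*(\alpha)\neq 0$ if $\alpha^\vee\in 2Y$. The affine Hecke algebra $\mathcal{H}=\mathcal{H}(\mathcal{R})$ is the $\mathbb{C}$-algebra with linear basis $\theta_xT_w$ ($x\in X$, $w\in W$) and relations: $T_wT_{w'}=T_{ww'}$ if $\ell(ww')=\ell(w)+\ell(w')$; $(T_{s_\alpha}+1)(T_{s_\alpha}-q^{\lambda(\alpha)})=0$ for $\alpha\in\Delta$; $\theta_x\theta_y=\theta_{x+y}$;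 and, for $s=s_\alpha$, $\alpha\in\Delta$, $T_s\theta_x=\theta_{s(x)}T_s+(q^{\lambda(\alpha)}-1)\frac{\theta_x-\theta_{s(x)}}{1-\theta_{-\alpha}}$ if $\alpha^\vee\notin 2Y$, and $T_s\theta_x=\theta_{s(x)}T_s+\big((q^{\lambda(\alpha)}-1)+\theta_{-\alpha}(q^{(\lambda(\alpha)+\lambda^*(\alpha))/2}-q^{(\lambda(\alpha)-\lambda^*(\alpha))/2})\big)\frac{\theta_x-\theta_{s(x)}}{1-\theta_{-2\alpha}}$ if $\alpha^\vee\in 2Y$. Star operation. $*:\mathcal{H}\to\mathcal{H}$ is the conjugate-linear anti-automorphism with $T_w^*=T_{w^{-1}}$ ($w\in W$) and $\theta_x^*=T_{w_0}\theta_{-w_0(x)}T_{w_0}^{-1}$ ($x\in X$). A hermitian form on an $\mathcal{H}$-module $V$ is $*$-invariant if $\langle hv,v'\rangle=\langle v,h^*v'\rangle$ for all $h\in\mathcal{H}$, $v,v'\in V$; $V$ is unitary if it admits a positive definite $*$-invariant hermitian form. Isogenies. An isogeny of based root data $(X_1,R_1,Y_1,R_1^\vee,\Delta_1)\to(X_2,R_2,Y_2,R_2^\vee,\Delta_2)$ is an injective group homomorphism $f:X_1\to X_2$ with finite cokernel that restricts to an isomorphism of based root systems $(\mathbb{R}R_1,R_1,\mathbb{R}R_1^\vee,R_1^\vee,\Delta_1)\to(\mathbb{R}R_2,R_2,\mathbb{R}R_2^\vee,R_2^\vee,\Delta_2)$, where the transpose $f^\vee:Y_2\to Y_1$ sends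 $f(\alpha)^\vee$ to $\alpha^\vee$ for all $\alpha\in R_1$ (so Weyl groups are identified and $f$ is $W$-equivariant). If the parameters are compatible (same $q$, $\lambda_2\circ f=\lambda_1$, $\lambda_2^*\circ f=\lambda_1^*$ on $R_1$), it induces an injective algebra homomorphism $\mathcal{H}_1=\mathcal{H}(\mathcal{R}_1)\to\mathcal{H}_2=\mathcal{H}(\mathcal{R}_2)$, $\theta_xT_w\mapsto\theta_{f(x)}T_w$, called an isogeny of affine Hecke algebras. $X_2/X_1$ denotes $X_2/f(X_1)$, and $\mathrm{Ind}_{\mathcal{H}_1}^{\mathcal{H}_2}V=\mathcal{H}_2\otimes_{\mathcal{H}_1}V$. *)

theory Defs
  imports Complex_Main "HOL-Library.Poly_Mapping"
begin

section \<open>Abelian groups as \<open>\<int>\<close>-modules\<close>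

definition zscale :: "int \<Rightarrow> 'a::ab_group_add \<Rightarrow> 'a" where
  "zscale k x = (if 0 \<le> k then (\<Sum>_<nat k. x) else - (\<Sum>_<nat (- k). x))"

lemma zscale_of_nat: "zscale (int n) x = (\<Sum>_<n. x)"
  by (simp add: zscale_def)

lemma zscale_one: "zscale 1 x = x"
  using zscale_of_nat[of 1 x] by simp

lemma zscale_minus: "zscale (- k) x = - zscale k x"
  by (auto simp: zscale_def)

lemma zscale_succ: "zscale (k + 1) x = zscale k x + x"
proof (cases "0 \<le> k")
  case True
  then have "nat (k + 1) = Suc (nat k)" by simp
  then show ?thesis using True by (simp add: zscale_def)
next
  case False
  then have "nat (- k) = Suc (nat (- (k + 1)))" by simp
  then show ?thesis using False by (auto simp: zscale_def)
qed

lemma zscale_pred: "zscale (k - 1) x = zscale k x - x"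
  using zscale_succ[of "k - 1" x] by simp

lemma zscale_add_left: "zscale (j + k) x = zscale j x + zscale k x"
proof (induction k rule: int_induct[where k = 0])
  case base
  then show ?case by (simp add: zscale_def)
next
  case (step1 i)
  then show ?case using zscale_succ[of "j + i" x] zscale_succ[of i x] by (simp add: add.assoc)
next
  case (step2 i)
  then show ?case using zscale_pred[of "j + i" x] zscale_pred[of i x]
    by (simp add: add_diff_eq)
qed

lemma zscale_add_right: "zscale k (x + y) = zscale k x + zscale k y"
  by (auto simp: zscale_def sum.distrib)

lemma zscale_zscale: "zscale j (zscale k x) = zscale (j * k) x"
proof (induction j rule: int_induct[where k = 0])
  case base
  then show ?case by (simp add: zscale_def)
next
  case (step1 i)
  then show ?case by (simp add: zscale_succ distrib_right zscale_add_left zscale_one)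
next
  case (step2 i)
  have "zscale ((i - 1) * k) x = zscale (i * k) x + zscale (- k) x"
    using zscale_add_left[of "i * k" "- k" x] by (simp add: algebra_simps)
  with step2 show ?case by (simp add: zscale_pred zscale_minus)
qed

interpretation zmod: module zscale
  by standard (simp_all add: zscale_add_left zscale_add_right zscale_zscale zscale_one)

definition free_of_finite_rank :: "'a::ab_group_add itself \<Rightarrow> bool" where
  "free_of_finite_rank _ \<longleftrightarrow>
     (\<exists>B :: 'a set. finite B \<and> zmod.independent B \<and> zmod.span B = UNIV)"

definition perfect_pairing :: "('x::ab_group_add \<Rightarrow> 'y::ab_group_add \<Rightarrow> int) \<Rightarrow> bool" where
  "perfect_pairing p \<longleftrightarrow>
     (\<forall>x. additive (p x)) \<and> (\<forall>y. additive (\<lambda>x. p x y)) \<and>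
     (\<forall>g. additive g \<longrightarrow> (\<exists>!x. p x = g)) \<and>
     (\<forall>g. additive g \<longrightarrow> (\<exists>!y. (\<lambda>x. p x y) = g))"


section \<open>Based root data\<close>

text \<open>
  The lattices \<open>X\<close> and \<open>Y\<close> are the whole types \<open>'x\<close> and \<open>'y\<close>.  The coroot system is the image
  of \<open>roots\<close> under \<open>coroot\<close>, whose values outside \<open>roots\<close> are irrelevant.
\<close>

record ('x, 'y) root_datum =
  pairing :: "'x \<Rightarrow> 'y \<Rightarrow> int"
  roots :: "'x set"
  coroot :: "'x \<Rightarrow> 'y"
  simple_roots :: "'x set"

definition reflection ::
    "('x::ab_group_add, 'y::ab_group_add) root_datum \<Rightarrow> 'x \<Rightarrow> 'x \<Rightarrow> 'x" where
  "reflection D \<alpha> x = x - zscale (pairing D x (coroot D \<alpha>)) \<alpha>"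

definition coreflection ::
    "('x::ab_group_add, 'y::ab_group_add) root_datum \<Rightarrow> 'x \<Rightarrow> 'y \<Rightarrow> 'y" where
  "coreflection D \<alpha> y = y - zscale (pairing D \<alpha> y) (coroot D \<alpha>)"

text \<open>
  The Weyl group, realised as a group of automorphisms of \<open>X\<close>; closure under inverses is automatic
  because reflections are involutions.
\<close>

inductive_set weyl ::
    "('x::ab_group_add, 'y::ab_group_add) root_datum \<Rightarrow> ('x \<Rightarrow> 'x) set"
  for D :: "('x, 'y) root_datum" where
  id: "id \<in> weyl D"
| reflection: "\<alpha> \<in> roots D \<Longrightarrow> w \<in> weyl D \<Longrightarrow> reflection D \<alpha> \<circ> w \<in> weyl D"

definition weyl_length ::
    "('x::ab_group_add, 'y::ab_group_add) root_datum \<Rightarrow> ('x \<Rightarrow> 'x) \<Rightarrow> nat" where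
  "weyl_length D w =
     (LEAST n. \<exists>as. set as \<subseteq> simple_roots D \<and> length as = n \<and>
        w = foldr (\<lambda>\<alpha> v. reflection D \<alpha> \<circ> v) as id)"

definition longest_element ::
    "('x::ab_group_add, 'y::ab_group_add) root_datum \<Rightarrow> 'x \<Rightarrow> 'x" where
  "longest_element D = (ARG_MAX (weyl_length D) w. w \<in> weyl D)"

definition coroot_even :: "('x, 'y::ab_group_add) root_datum \<Rightarrow> 'x \<Rightarrow> bool" where
  "coroot_even D \<alpha> \<longleftrightarrow> coroot D \<alpha> \<in> range (\<lambda>y. y + y)"

text \<open>
  In \<open>reduced\<close> the equation says that \<open>\<beta>\<close> is the rational multiple \<open>(m / n) \<alpha>\<close> of \<open>\<alpha>\<close>.  In
  \<open>simple_basis\<close> linear independence over \<open>\<int>\<close> is the same as over \<open>\<real>\<close>, since \<open>X\<close> is free.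
\<close>

locale based_root_datum =
  fixes D :: "('x::ab_group_add, 'y::ab_group_add) root_datum"
  assumes free_X: "free_of_finite_rank TYPE('x)"
    and free_Y: "free_of_finite_rank TYPE('y)"
    and perfect: "perfect_pairing (pairing D)"
    and finite_roots: "finite (roots D)"
    and coroot_inj: "inj_on (coroot D) (roots D)"
    and pairing_root_coroot: "\<alpha> \<in> roots D \<Longrightarrow> pairing D \<alpha> (coroot D \<alpha>) = 2"
    and reflection_roots: "\<alpha> \<in> roots D \<Longrightarrow> reflection D \<alpha> ` roots D \<subseteq> roots D"
    and coreflection_coroots:
      "\<alpha> \<in> roots D \<Longrightarrow> coreflection D \<alpha> ` coroot D ` roots D \<subseteq> coroot D ` roots D"
    and reduced:
      "\<lbrakk>\<alpha> \<in> roots D; \<beta> \<in> roots D; n \<noteq> 0; zscale m \<alpha> = zscale n \<beta>\<rbrakk> \<Longrightarrow> \<beta> = \<alpha> \<or> \<beta> = - \<alpha>"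
    and simple_subset: "simple_roots D \<subseteq> roots D"
    and simple_basis: "zmod.independent (simple_roots D)"
    and simple_positive:
      "\<beta> \<in> roots D \<Longrightarrow>
         \<exists>c. (\<forall>\<alpha>. 0 \<le> c \<alpha>) \<and>
             (\<beta> = (\<Sum>\<alpha>\<in>simple_roots D. zscale (c \<alpha>) \<alpha>) \<or>
              \<beta> = - (\<Sum>\<alpha>\<in>simple_roots D. zscale (c \<alpha>) \<alpha>))"


section \<open>Affine Hecke algebras\<close>

locale complex_algebra = vector_space scale
  for scale :: "complex \<Rightarrow> 'h::ring_1 \<Rightarrow> 'h" +
  assumes scale_mult_left: "scale c (a * b) = scale c a * b"
    and scale_mult_right: "scale c (a * b) = a * scale c b"

locale complex_algebra_hom =
  A: complex_algebra scaleA + B: complex_algebra scaleB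
  for scaleA :: "complex \<Rightarrow> 'a::ring_1 \<Rightarrow> 'a"
    and scaleB :: "complex \<Rightarrow> 'b::ring_1 \<Rightarrow> 'b" +
  fixes \<phi> :: "'a \<Rightarrow> 'b"
  assumes hom_add: "\<phi> (a + b) = \<phi> a + \<phi> b"
    and hom_scale: "\<phi> (scaleA c a) = scaleB c (\<phi> a)"
    and hom_mult: "\<phi> (a * b) = \<phi> a * \<phi> b"
    and hom_one: "\<phi> 1 = 1"

text \<open>
  \<open>W \<ltimes> X\<close> acts on the roots through \<open>W\<close>, so its orbits there are the \<open>W\<close>-orbits.
\<close>

locale hecke_parameters = based_root_datum D
  for D :: "('x::ab_group_add, 'y::ab_group_add) root_datum" +
  fixes q :: real and lam lams :: "'x \<Rightarrow> real"
  assumes q_gt_1: "1 < q"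
    and lam_nonzero: "\<alpha> \<in> roots D \<Longrightarrow> lam \<alpha> \<noteq> 0"
    and lams_nonzero: "\<alpha> \<in> roots D \<Longrightarrow> lams \<alpha> \<noteq> 0"
    and lam_weyl: "\<lbrakk>w \<in> weyl D; \<alpha> \<in> roots D\<rbrakk> \<Longrightarrow> lam (w \<alpha>) = lam \<alpha>"
    and lams_weyl: "\<lbrakk>w \<in> weyl D; \<alpha> \<in> roots D\<rbrakk> \<Longrightarrow> lams (w \<alpha>) = lams \<alpha>"
    and lam_eq_lams: "\<lbrakk>\<alpha> \<in> roots D; \<not> coroot_even D \<alpha>\<rbrakk> \<Longrightarrow> lams \<alpha> = lam \<alpha>"
    and lam_plus_lams: "\<lbrakk>\<alpha> \<in> roots D; coroot_even D \<alpha>\<rbrakk> \<Longrightarrow> lam \<alpha> + lams \<alpha> \<noteq> 0"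

text \<open>
  The algebra is specified, up to unique isomorphism, by its basis \<open>\<theta>\<^sub>x T\<^sub>w\<close> and its
  multiplication rules.  In the two cross relations \<open>f\<close> is the fraction
  \<open>(\<theta>\<^sub>x - \<theta>\<^bsub>s(x)\<^esub>) / (1 - \<theta>\<^bsub>-\<alpha>\<^esub>)\<close>, respectively
  \<open>(\<theta>\<^sub>x - \<theta>\<^bsub>s(x)\<^esub>) / (1 - \<theta>\<^bsub>-2\<alpha>\<^esub>)\<close>.  It is taken in the linear span of the \<open>\<theta>\<^sub>x\<close>, the group algebra of
  \<open>X\<close>, which is an integral domain; so \<open>f\<close> is unique.
\<close>

locale affine_hecke_algebra =
  hecke_parameters D q lam lams + complex_algebra scale
  for D :: "('x::ab_group_add, 'y::ab_group_add) root_datum"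
    and q :: real and lam lams :: "'x \<Rightarrow> real"
    and scale :: "complex \<Rightarrow> 'h::ring_1 \<Rightarrow> 'h" +
  fixes \<theta> :: "'x \<Rightarrow> 'h" and T :: "('x \<Rightarrow> 'x) \<Rightarrow> 'h"
  assumes basis_inj: "inj_on (\<lambda>(x, w). \<theta> x * T w) (UNIV \<times> weyl D)"
    and basis_independent: "independent ((\<lambda>(x, w). \<theta> x * T w) ` (UNIV \<times> weyl D))"
    and basis_span: "span ((\<lambda>(x, w). \<theta> x * T w) ` (UNIV \<times> weyl D)) = UNIV"
    and T_mult:
      "\<lbrakk>w \<in> weyl D; w' \<in> weyl D; weyl_length D (w \<circ> w') = weyl_length D w + weyl_length D w'\<rbrakk>
       \<Longrightarrow> T w * T w' = T (w \<circ> w')"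
    and T_quadratic:
      "\<alpha> \<in> simple_roots D \<Longrightarrow>
       (T (reflection D \<alpha>) + 1) * (T (reflection D \<alpha>) - scale (of_real (q powr lam \<alpha>)) 1) = 0"
    and \<theta>_mult: "\<theta> x * \<theta> y = \<theta> (x + y)"
    and cross_relation:
      "\<lbrakk>\<alpha> \<in> simple_roots D; \<not> coroot_even D \<alpha>; s = reflection D \<alpha>\<rbrakk> \<Longrightarrow>
       \<exists>f \<in> span (range \<theta>).
         f * (1 - \<theta> (- \<alpha>)) = \<theta> x - \<theta> (s x) \<and>
         T s * \<theta> x = \<theta> (s x) * T s + scale (of_real (q powr lam \<alpha> - 1)) f"
    and cross_relation_even:
      "\<lbrakk>\<alpha> \<in> simple_roots D; coroot_even D \<alpha>; s = reflection D \<alpha>\<rbrakk> \<Longrightarrow>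
       \<exists>f \<in> span (range \<theta>).
         f * (1 - \<theta> (- (\<alpha> + \<alpha>))) = \<theta> x - \<theta> (s x) \<and>
         T s * \<theta> x = \<theta> (s x) * T s +
           (scale (of_real (q powr lam \<alpha> - 1)) 1 +
            scale (of_real (q powr ((lam \<alpha> + lams \<alpha>) / 2) - q powr ((lam \<alpha> - lams \<alpha>) / 2)))
              (\<theta> (- \<alpha>))) * f"

definition ring_inv :: "'a::ring_1 \<Rightarrow> 'a" where
  "ring_inv a = (THE b. a * b = 1 \<and> b * a = 1)"

locale affine_hecke_star = affine_hecke_algebra D q lam lams scale \<theta> T
  for D :: "('x::ab_group_add, 'y::ab_group_add) root_datum"
    and q :: real and lam lams :: "'x \<Rightarrow> real"
    and scale :: "complex \<Rightarrow> 'h::ring_1 \<Rightarrow> 'h"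
    and \<theta> :: "'x \<Rightarrow> 'h" and T :: "('x \<Rightarrow> 'x) \<Rightarrow> 'h" +
  fixes star :: "'h \<Rightarrow> 'h"
  assumes star_bij: "bij star"
    and star_add: "star (a + b) = star a + star b"
    and star_scale: "star (scale c a) = scale (cnj c) (star a)"
    and star_mult: "star (a * b) = star b * star a"
    and star_T: "w \<in> weyl D \<Longrightarrow> star (T w) = T (inv w)"
    and star_\<theta>:
      "star (\<theta> x) =
         T (longest_element D) * \<theta> (- longest_element D x) * ring_inv (T (longest_element D))"


section \<open>Isogenies\<close>

definition cokernel :: "('a::ab_group_add \<Rightarrow> 'b::ab_group_add) \<Rightarrow> 'b set set" where
  "cokernel f = UNIV // {(x, y). x - y \<in> range f}"

definition dual_map ::
    "('x1::ab_group_add, 'y1::ab_group_add) root_datum \<Rightarrow>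
     ('x2::ab_group_add, 'y2::ab_group_add) root_datum \<Rightarrow> ('x1 \<Rightarrow> 'x2) \<Rightarrow> 'y2 \<Rightarrow> 'y1" where
  "dual_map D1 D2 f y2 = (THE y1. \<forall>x. pairing D1 x y1 = pairing D2 (f x) y2)"

lemma pairing_dual_map:
  assumes "perfect_pairing (pairing D1)" "perfect_pairing (pairing D2)" "additive f"
  shows "pairing D1 x (dual_map D1 D2 f y) = pairing D2 (f x) y"
proof -
  have "additive (\<lambda>x. pairing D2 (f x) y)"
    using assms(2,3) by (simp add: perfect_pairing_def additive_def)
  with assms(1) have "\<exists>!y1. (\<lambda>x. pairing D1 x y1) = (\<lambda>x. pairing D2 (f x) y)"
    by (simp add: perfect_pairing_def)
  then have "\<exists>!y1. \<forall>x. pairing D1 x y1 = pairing D2 (f x) y"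
    by (simp add: fun_eq_iff)
  from theI'[OF this] show ?thesis
    unfolding dual_map_def by blast
qed

locale root_datum_isogeny =
  D1: based_root_datum D1 + D2: based_root_datum D2
  for D1 :: "('x1::ab_group_add, 'y1::ab_group_add) root_datum"
    and D2 :: "('x2::ab_group_add, 'y2::ab_group_add) root_datum" +
  fixes f :: "'x1 \<Rightarrow> 'x2"
  assumes isogeny_additive: "additive f"
    and isogeny_inj: "inj f"
    and finite_cokernel: "finite (cokernel f)"
    and isogeny_roots: "f ` roots D1 = roots D2"
    and isogeny_simple: "f ` simple_roots D1 = simple_roots D2"
    and isogeny_coroot: "\<alpha> \<in> roots D1 \<Longrightarrow> dual_map D1 D2 f (coroot D2 (f \<alpha>)) = coroot D1 \<alpha>"

text \<open>
  The Weyl groups act on different lattices; \<open>w \<in> W\<^sub>1\<close> and \<open>w' \<in> W\<^sub>2\<close> are identified when \<open>f\<close>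
  intertwines them.  Each \<open>w\<close> has exactly one such partner, as \<open>s\<^bsub>f(\<alpha>)\<^esub> \<circ> f = f \<circ> s\<^sub>\<alpha>\<close> and \<open>f\<close> has
  finite cokernel.
\<close>

locale affine_hecke_isogeny =
  H1: affine_hecke_algebra D1 q lam1 lams1 scale1 \<theta>1 T1 +
  H2: affine_hecke_algebra D2 q lam2 lams2 scale2 \<theta>2 T2 +
  root_datum_isogeny D1 D2 f +
  complex_algebra_hom scale1 scale2 \<phi>
  for D1 :: "('x1::ab_group_add, 'y1::ab_group_add) root_datum"
    and D2 :: "('x2::ab_group_add, 'y2::ab_group_add) root_datum"
    and q :: real and lam1 lams1 :: "'x1 \<Rightarrow> real" and lam2 lams2 :: "'x2 \<Rightarrow> real"
    and scale1 :: "complex \<Rightarrow> 'h1::ring_1 \<Rightarrow> 'h1"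
    and scale2 :: "complex \<Rightarrow> 'h2::ring_1 \<Rightarrow> 'h2"
    and \<theta>1 :: "'x1 \<Rightarrow> 'h1" and T1 :: "('x1 \<Rightarrow> 'x1) \<Rightarrow> 'h1"
    and \<theta>2 :: "'x2 \<Rightarrow> 'h2" and T2 :: "('x2 \<Rightarrow> 'x2) \<Rightarrow> 'h2"
    and f :: "'x1 \<Rightarrow> 'x2" and \<phi> :: "'h1 \<Rightarrow> 'h2" +
  assumes lam_compatible: "\<alpha> \<in> roots D1 \<Longrightarrow> lam2 (f \<alpha>) = lam1 \<alpha>"
    and lams_compatible: "\<alpha> \<in> roots D1 \<Longrightarrow> lams2 (f \<alpha>) = lams1 \<alpha>"
    and \<phi>_basis:
      "\<lbrakk>w \<in> weyl D1; w' \<in> weyl D2; w' \<circ> f = f \<circ> w\<rbrakk> \<Longrightarrow> \<phi> (\<theta>1 x * T1 w) = \<theta>2 (f x) * T2 w'"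


section \<open>Modules and induction\<close>

locale complex_algebra_module =
  A: complex_algebra scaleA + V: vector_space scaleV
  for scaleA :: "complex \<Rightarrow> 'a::ring_1 \<Rightarrow> 'a"
    and scaleV :: "complex \<Rightarrow> 'v::ab_group_add \<Rightarrow> 'v" +
  fixes act :: "'a \<Rightarrow> 'v \<Rightarrow> 'v"
  assumes act_add_left: "act (a + b) v = act a v + act b v"
    and act_add_right: "act a (u + v) = act a u + act a v"
    and act_scale_left: "act (scaleA c a) v = scaleV c (act a v)"
    and act_scale_right: "act a (scaleV c v) = scaleV c (act a v)"
    and act_mult: "act (a * b) v = act a (act b v)"
    and act_one: "act 1 v = v"

definition tensor_relators ::
    "('a::ring_1 \<Rightarrow> 'b::ring_1) \<Rightarrow> ('a \<Rightarrow> 'v::ab_group_add \<Rightarrow> 'v) \<Rightarrow> ('b \<times> 'v \<Rightarrow>\<^sub>0 int) set" where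
  "tensor_relators \<phi> act =
     {frag_of (b + b', v) - frag_of (b, v) - frag_of (b', v) | b b' v. True} \<union>
     {frag_of (b, v + v') - frag_of (b, v) - frag_of (b, v') | b v v'. True} \<union>
     {frag_of (b * \<phi> a, v) - frag_of (b, act a v) | a b v. True}"

definition tensor_eval :: "('b \<Rightarrow> 'v \<Rightarrow> 'm::ab_group_add) \<Rightarrow> ('b \<times> 'v \<Rightarrow>\<^sub>0 int) \<Rightarrow> 'm" where
  "tensor_eval \<tau> F =
     (\<Sum>p\<in>Poly_Mapping.keys F. zscale (Poly_Mapping.lookup F p) (\<tau> (fst p) (snd p)))"

text \<open>
  \<open>M\<close> together with \<open>\<tau> b v = b \<otimes> v\<close> is the module \<open>B \<otimes>\<^sub>A V\<close>: \<open>tensor_surj\<close> and \<open>tensor_kernel\<close> say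
  that \<open>\<tau>\<close> induces an isomorphism onto \<open>M\<close> from the free abelian group on \<open>B \<times> V\<close> modulo the
  relations defining the tensor product.
\<close>

locale induced_module =
  complex_algebra_hom scaleA scaleB \<phi> +
  V: complex_algebra_module scaleA scaleV actV +
  M: complex_algebra_module scaleB scaleM actM
  for scaleA :: "complex \<Rightarrow> 'a::ring_1 \<Rightarrow> 'a"
    and scaleB :: "complex \<Rightarrow> 'b::ring_1 \<Rightarrow> 'b"
    and \<phi> :: "'a \<Rightarrow> 'b"
    and scaleV :: "complex \<Rightarrow> 'v::ab_group_add \<Rightarrow> 'v" and actV :: "'a \<Rightarrow> 'v \<Rightarrow> 'v"
    and scaleM :: "complex \<Rightarrow> 'm::ab_group_add \<Rightarrow> 'm" and actM :: "'b \<Rightarrow> 'm \<Rightarrow> 'm" +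
  fixes \<tau> :: "'b \<Rightarrow> 'v \<Rightarrow> 'm"
  assumes tensor_surj: "surj (tensor_eval \<tau>)"
    and tensor_kernel: "tensor_eval \<tau> F = 0 \<longleftrightarrow> F \<in> zmod.span (tensor_relators \<phi> actV)"
    and tensor_act: "actM b (\<tau> b' v) = \<tau> (b * b') v"


section \<open>Invariant hermitian forms\<close>

definition hermitian_form ::
    "(complex \<Rightarrow> 'v::ab_group_add \<Rightarrow> 'v) \<Rightarrow> ('v \<Rightarrow> 'v \<Rightarrow> complex) \<Rightarrow> bool" where
  "hermitian_form scale B \<longleftrightarrow>
     (\<forall>u v w. B (u + v) w = B u w + B v w) \<and>
     (\<forall>c v w. B (scale c v) w = c * B v w) \<and>
     (\<forall>v w. B w v = cnj (B v w))"

definition star_invariant ::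
    "('h \<Rightarrow> 'h) \<Rightarrow> ('h \<Rightarrow> 'v \<Rightarrow> 'v) \<Rightarrow> ('v \<Rightarrow> 'v \<Rightarrow> complex) \<Rightarrow> bool" where
  "star_invariant star act B \<longleftrightarrow> (\<forall>h v w. B (act h v) w = B v (act (star h) w))"

text \<open>
  Signature in the sense of Sylvester's law of inertia.  Degenerate forms are allowed: the radical
  has dimension \<open>dim V - a - b\<close>.  The values \<open>B v v\<close> of a hermitian form are real.
\<close>

definition has_signature ::
    "(complex \<Rightarrow> 'v::ab_group_add \<Rightarrow> 'v) \<Rightarrow> ('v \<Rightarrow> 'v \<Rightarrow> complex) \<Rightarrow> nat \<Rightarrow> nat \<Rightarrow> bool" where
  "has_signature scale B a b \<longleftrightarrow>
     (\<exists>E. finite_dimensional_vector_space scale E \<and>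
          (\<forall>u\<in>E. \<forall>v\<in>E. u \<noteq> v \<longrightarrow> B u v = 0) \<and>
          card {v \<in> E. 0 < Re (B v v)} = a \<and>
          card {v \<in> E. Re (B v v) < 0} = b)"

definition unitary_module ::
    "('h \<Rightarrow> 'h) \<Rightarrow> (complex \<Rightarrow> 'v::ab_group_add \<Rightarrow> 'v) \<Rightarrow> ('h \<Rightarrow> 'v \<Rightarrow> 'v) \<Rightarrow> bool" where
  "unitary_module star scale act \<longleftrightarrow>
     (\<exists>B. hermitian_form scale B \<and> star_invariant star act B \<and> (\<forall>v. v \<noteq> 0 \<longrightarrow> 0 < Re (B v v)))"

end

(*
  Write x' for the star of x.  The algebra H2 is graded by X2/X1 with degree-zero part H1, the star
  negates degrees, and the projection E : H2 -> H1 onto degree zero commutes with it.  So E(x' y)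
  is an H1-valued inner product on H2.  Every degree contains a unitary u (u' u = u u' = 1): a
  coset of the root lattice contains a dominant x pairing with all coroots in {-1, 0, 1}, namely a
  vector of minimal norm made dominant; peeling off a reduced word of w0 in
  theta_x' theta_x = T_w0 theta_(-w0 x) T_w0^-1 theta_x gives c A A' with c > 0 and A a product of
  generators T_s, so u = c^(-1/2) theta_x (A')^-1 is unitary.  These n unitaries form an
  orthonormal basis of H2 over H1, which identifies Ind V with an orthogonal sum of n copies of V.
*)

theory Submission
  imports Defs
begin

section \<open>Root systems\<close>

text \<open>\<open>\<theta> x\<close> itself is not unitary: its star is a conjugate of
  \<open>\<theta> (- w0 x)\<close>, not its inverse. On the summand spanned by
  \<open>\<theta> x\<close> tensor \<open>v\<close> the form becomes \<open>B v (h w)\<close> with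
  \<open>h = star (\<theta> x) * \<theta> x\<close>, and nothing makes \<open>h\<close> positive a
  priori: each \<open>T s\<close> is self-adjoint, but its quadratic relation has the roots -1 and a
  positive power of \<open>q\<close>. What preserves the signature is the shape
  \<open>c A A'\<close> with \<open>A\<close> invertible and \<open>c > 0\<close>, a congruence. For
  a general \<open>x\<close> the cross relation produces a fraction with many terms. For pairing 1
  the fraction is the single term \<open>\<theta> x\<close>, and it cancels against the constant
  term of the inverse of \<open>T s\<close>. Hence the restriction to pairings -1, 0, 1. It costs
  nothing: the roots lie in the image of \<open>X1\<close>, so \<open>x\<close> may move within its
  coset of the root lattice without changing degree, and \<open>A\<close>, a product of generators
  \<open>T s\<close>, has degree zero. The longest elements, which are chosen by
  \<open>ARG_MAX\<close>, and the fractions in the cross relations, which are given only by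
  existence, are pinned down by uniqueness lemmas.\<close>

lemma additive_zscale:
  assumes "additive g"
  shows "g (zscale k x) = zscale k (g x)"
  using assms by (auto simp: zscale_def additive.sum additive.minus)

lemma zscale_int: "zscale k (m :: int) = k * m"
  by (auto simp: zscale_def)

context based_root_datum
begin

section \<open>The pairing and an invariant bilinear form\<close>

lemma pairing_additive: "additive (pairing D x)" "additive (\<lambda>x. pairing D x y)"
  using perfect by (auto simp: perfect_pairing_def)

lemma pairing_simps:
  "pairing D (x + x') y = pairing D x y + pairing D x' y"
  "pairing D x (y + y') = pairing D x y + pairing D x y'"
  "pairing D (x - x') y = pairing D x y - pairing D x' y"
  "pairing D x (y - y') = pairing D x y - pairing D x y'"
  "pairing D (- x) y = - pairing D x y"
  "pairing D x (- y) = - pairing D x y"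
  "pairing D 0 y = 0" "pairing D x 0 = 0"
  using pairing_additive
  by (auto simp: additive.add additive.diff additive.minus additive.zero
      additive.add[where f = "\<lambda>x. pairing D x _"]
      additive.diff[where f = "\<lambda>x. pairing D x _"]
      additive.minus[where f = "\<lambda>x. pairing D x _"]
      additive.zero[where f = "\<lambda>x. pairing D x _"])

lemma pairing_zscale:
  "pairing D (zscale k x) y = k * pairing D x y"
  "pairing D x (zscale k y) = k * pairing D x y"
  using additive_zscale[OF pairing_additive(1)] additive_zscale[OF pairing_additive(2)]
  by (simp_all add: zscale_int)

lemma root_nonzero: "\<beta> \<in> roots D \<Longrightarrow> \<beta> \<noteq> 0"
  using pairing_root_coroot[of \<beta>] by (auto simp: pairing_simps)

text \<open>The standard invariant form obtained by summing over all coroots, which the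
  coreflections permute. It may be degenerate, but it is positive on roots, and its integer values
  allow minimal-norm arguments without real scalars.\<close>

definition inner :: "'x \<Rightarrow> 'x \<Rightarrow> int" where
  "inner x z = (\<Sum>y\<in>coroot D ` roots D. pairing D x y * pairing D z y)"

lemma inner_commute: "inner x z = inner z x"
  by (simp add: inner_def mult.commute)

lemma inner_additive: "additive (inner x)" "additive (\<lambda>x. inner x z)"
  by (auto simp: additive_def inner_def pairing_simps algebra_simps sum.distrib)

lemma inner_simps:
  "inner (x + x') z = inner x z + inner x' z"
  "inner x (z + z') = inner x z + inner x z'"
  "inner (x - x') z = inner x z - inner x' z"
  "inner x (z - z') = inner x z - inner x z'"
  "inner (- x) z = - inner x z"
  "inner x (- z) = - inner x z"
  "inner (zscale k x) z = k * inner x z"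
  "inner x (zscale k z) = k * inner x z"
  by (simp_all add: inner_def pairing_simps pairing_zscale algebra_simps sum.distrib
      sum_subtractf sum_negf sum_distrib_left)

lemma inner_sum: "inner x (\<Sum>i\<in>I. g i) = (\<Sum>i\<in>I. inner x (g i))"
  using additive.sum[OF inner_additive(1)] by (simp add: o_def)

lemma inner_nonneg: "0 \<le> inner x x"
  by (simp add: inner_def sum_nonneg)

lemma inner_root_pos:
  assumes "\<beta> \<in> roots D"
  shows "0 < inner \<beta> \<beta>"
proof -
  have "pairing D \<beta> (coroot D \<beta>) * pairing D \<beta> (coroot D \<beta>) \<le> inner \<beta> \<beta>"
    unfolding inner_def using assms finite_roots by (intro member_le_sum) auto
  then show ?thesis using pairing_root_coroot[OF assms] by simp
qed

lemma pairing_reflection: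
  "pairing D (reflection D \<alpha> x) y = pairing D x (coreflection D \<alpha> y)"
  by (simp add: reflection_def coreflection_def pairing_simps pairing_zscale algebra_simps)

lemma coreflection_involution:
  assumes "\<alpha> \<in> roots D"
  shows "coreflection D \<alpha> (coreflection D \<alpha> y) = y"
  using pairing_root_coroot[OF assms]
  by (simp add: coreflection_def pairing_simps pairing_zscale zmod.scale_left_diff_distrib
      zmod.scale_right_diff_distrib flip: zmod.scale_minus_left)

lemma reflection_involution:
  assumes "\<alpha> \<in> roots D"
  shows "reflection D \<alpha> (reflection D \<alpha> x) = x"
proof -
  have "pairing D x (coroot D \<alpha>) - pairing D x (coroot D \<alpha>) * 2 = - pairing D x (coroot D \<alpha>)"
    by simp
  then show ?thesis
    using pairing_root_coroot[OF assms]
    by (simp add: reflection_def pairing_simps pairing_zscale zscale_minus)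
qed

lemma reflection_self: "\<alpha> \<in> roots D \<Longrightarrow> reflection D \<alpha> \<alpha> = - \<alpha>"
  using pairing_root_coroot[of \<alpha>] zscale_add_left[of 1 1 \<alpha>]
  by (simp add: reflection_def zscale_one)

lemma uminus_root: "\<alpha> \<in> roots D \<Longrightarrow> - \<alpha> \<in> roots D"
  using reflection_roots[of \<alpha>] reflection_self[of \<alpha>] by auto

text \<open>The reflections are moved onto the coroots, where the adjoint
  \<open>coreflection\<close> only permutes the summands.\<close>

lemma inner_reflection:
  assumes "\<alpha> \<in> roots D"
  shows "inner (reflection D \<alpha> x) (reflection D \<alpha> z) = inner x z"
proof -
  have "inner (reflection D \<alpha> x) (reflection D \<alpha> z) =
    (\<Sum>y\<in>coroot D ` roots D. pairing D x (coreflection D \<alpha> y) * pairing D z (coreflection D \<alpha> y))"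
    by (simp add: inner_def pairing_reflection)
  also have "\<dots> = inner x z"
    unfolding inner_def
    using coreflection_coroots[OF assms] coreflection_involution[OF assms]
    by (intro sum.reindex_bij_witness[where i = "coreflection D \<alpha>" and j = "coreflection D \<alpha>"])
       (auto simp: image_subset_iff)
  finally show ?thesis .
qed

text \<open>Coroots are determined by the invariant form, hence are \<open>W\<close>-equivariant.\<close>

lemma pairing_coroot:
  assumes "\<beta> \<in> roots D"
  shows "pairing D x (coroot D \<beta>) * inner \<beta> \<beta> = 2 * inner x \<beta>"
proof -
  have "inner (reflection D \<beta> x) (- \<beta>) = inner x \<beta>"
    using inner_reflection[OF assms, of x \<beta>] reflection_self[OF assms] by simp
  then show ?thesis by (simp add: reflection_def inner_simps)
qed

section \<open>The Weyl group and its action on roots and cosets\<close>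

lemma additive_reflection: "additive (reflection D \<alpha>)"
  by (auto simp: additive_def reflection_def pairing_simps zscale_add_left)

lemma weyl_additive: "w \<in> weyl D \<Longrightarrow> additive w"
  by (induction rule: weyl.induct) (use additive_reflection in \<open>auto simp: additive_def\<close>)

lemma weyl_roots: "w \<in> weyl D \<Longrightarrow> \<beta> \<in> roots D \<Longrightarrow> w \<beta> \<in> roots D"
  by (induction rule: weyl.induct) (use reflection_roots in auto)

lemma weyl_inner: "w \<in> weyl D \<Longrightarrow> inner (w x) (w z) = inner x z"
  by (induction rule: weyl.induct) (auto simp: inner_reflection)

lemma weyl_pairing:
  assumes "w \<in> weyl D" "\<beta> \<in> roots D"
  shows "pairing D (w x) (coroot D (w \<beta>)) = pairing D x (coroot D \<beta>)"
proof -
  have "pairing D (w x) (coroot D (w \<beta>)) * inner \<beta> \<beta> = pairing D x (coroot D \<beta>) * inner \<beta> \<beta>"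
    using pairing_coroot[OF assms(2), of x] pairing_coroot[OF weyl_roots[OF assms], of "w x"]
    by (simp add: weyl_inner[OF assms(1)])
  then show ?thesis using inner_root_pos[OF assms(2)] by simp
qed

lemma weyl_reflection:
  assumes "w \<in> weyl D" "\<beta> \<in> roots D"
  shows "reflection D (w \<beta>) \<circ> w = w \<circ> reflection D \<beta>"
  using weyl_pairing[OF assms] additive.diff[OF weyl_additive[OF assms(1)]]
    additive_zscale[OF weyl_additive[OF assms(1)]]
  by (auto simp: reflection_def)

text \<open>Conjugating the reflection by itself: \<open>weyl_reflection\<close> applied to it and
  \<open>\<beta>\<close> produces the reflection in the image of \<open>\<beta>\<close>, which is
  \<open>- \<beta>\<close>.\<close>

lemma reflection_uminus: "\<beta> \<in> roots D \<Longrightarrow> reflection D (- \<beta>) = reflection D \<beta>"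
  using weyl_reflection[OF weyl.reflection[OF _ weyl.id], of \<beta> \<beta>]
  by (auto simp: reflection_self reflection_involution fun_eq_iff) (metis reflection_involution)

lemma weyl_reflection_mem: "\<alpha> \<in> roots D \<Longrightarrow> reflection D \<alpha> \<in> weyl D"
  using weyl.reflection[OF _ weyl.id] by simp

lemma weyl_comp: "v \<in> weyl D \<Longrightarrow> w \<in> weyl D \<Longrightarrow> v \<circ> w \<in> weyl D"
  by (induction rule: weyl.induct) (auto simp: comp_assoc intro: weyl.reflection)

lemma bij_reflection: "\<alpha> \<in> roots D \<Longrightarrow> bij (reflection D \<alpha>)"
  by (intro o_bij[where g = "reflection D \<alpha>"]) (auto simp: reflection_involution fun_eq_iff)

lemma inv_reflection: "\<alpha> \<in> roots D \<Longrightarrow> inv (reflection D \<alpha>) = reflection D \<alpha>"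
  by (intro inv_unique_comp) (auto simp: reflection_involution fun_eq_iff)

lemma weyl_bij: "w \<in> weyl D \<Longrightarrow> bij w"
  by (induction rule: weyl.induct) (blast intro: bij_id bij_comp bij_reflection)+

lemma weyl_inv: "w \<in> weyl D \<Longrightarrow> inv w \<in> weyl D"
proof (induction rule: weyl.induct)
  case id
  show ?case by (simp only: inv_id weyl.id)
next
  case (reflection \<alpha> w)
  then have "inv (reflection D \<alpha> \<circ> w) = inv w \<circ> reflection D \<alpha>"
    by (simp only: o_inv_distrib bij_reflection weyl_bij inv_reflection)
  with reflection show ?case by (simp only: weyl_comp weyl_reflection_mem)
qed

lemma weyl_inv_cancel:
  assumes "w \<in> weyl D"
  shows "w (inv w x) = x" "inv w (w x) = x" "w \<circ> inv w = id" "inv w \<circ> w = id"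
    "w \<circ> (inv w \<circ> g) = g" "inv w \<circ> (w \<circ> g) = g"
  using weyl_bij[OF assms]
  by (auto simp: bij_is_surj bij_is_inj surj_f_inv_f fun_eq_iff)

lemma weyl_minus: "w \<in> weyl D \<Longrightarrow> w (- x) = - w x"
  using weyl_additive additive.minus by blast

text \<open>Each reflection moves a vector by a multiple of a root. Hence making a vector dominant,
  or applying the longest element, never leaves the coset of the root lattice.\<close>

lemma weyl_diff_span:
  "w \<in> weyl D \<Longrightarrow> w x - x \<in> zmod.span (roots D)"
proof (induction rule: weyl.induct)
  case id
  show ?case by (simp add: zmod.span_zero)
next
  case (reflection \<alpha> w)
  have "reflection D \<alpha> (w x) - x = (w x - x) - zscale (pairing D (w x) (coroot D \<alpha>)) \<alpha>"
    by (simp add: reflection_def)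
  also have "\<dots> \<in> zmod.span (roots D)"
    by (intro zmod.span_diff zmod.span_scale zmod.span_base reflection)
  finally show ?case by simp
qed

subsection \<open>Positive roots\<close>

definition comb :: "('x \<Rightarrow> int) \<Rightarrow> 'x" where
  "comb k = (\<Sum>\<alpha>\<in>simple_roots D. zscale (k \<alpha>) \<alpha>)"

definition pos :: "'x \<Rightarrow> bool" where
  "pos \<beta> \<longleftrightarrow> \<beta> \<in> roots D \<and> (\<exists>k. (\<forall>\<alpha>. 0 \<le> k \<alpha>) \<and> \<beta> = comb k)"

lemma finite_simple: "finite (simple_roots D)"
  using finite_roots simple_subset finite_subset by blast

lemma comb_simps:
  "comb k + comb l = comb (\<lambda>\<alpha>. k \<alpha> + l \<alpha>)" "- comb k = comb (\<lambda>\<alpha>. - k \<alpha>)"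
  "comb k - comb l = comb (\<lambda>\<alpha>. k \<alpha> - l \<alpha>)" "zscale m (comb k) = comb (\<lambda>\<alpha>. m * k \<alpha>)"
  by (simp_all add: comb_def zmod.scale_left_distrib sum.distrib sum_negf sum_subtractf
      zmod.scale_left_diff_distrib zmod.scale_sum_right)

lemma comb_eq_0: "comb k = 0 \<Longrightarrow> \<alpha> \<in> simple_roots D \<Longrightarrow> k \<alpha> = 0"
  using zmod.independentD[OF simple_basis finite_simple subset_refl, of k \<alpha>]
  by (simp add: comb_def)

lemma comb_inj: "comb k = comb l \<Longrightarrow> \<alpha> \<in> simple_roots D \<Longrightarrow> k \<alpha> = l \<alpha>"
  using comb_eq_0[of "\<lambda>\<alpha>. k \<alpha> - l \<alpha>" \<alpha>] by (simp flip: comb_simps(3))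

lemma comb_single:
  "\<alpha> \<in> simple_roots D \<Longrightarrow> comb (\<lambda>\<gamma>. if \<gamma> = \<alpha> then m else 0) = zscale m \<alpha>"
  by (simp add: comb_def finite_simple if_distrib[of "\<lambda>m. zscale m _"] sum.delta
      cong: if_cong)

lemma pos_root: "pos \<beta> \<Longrightarrow> \<beta> \<in> roots D"
  by (simp add: pos_def)

lemma simple_root: "\<alpha> \<in> simple_roots D \<Longrightarrow> \<alpha> \<in> roots D"
  using simple_subset by blast

lemma pos_simple: "\<alpha> \<in> simple_roots D \<Longrightarrow> pos \<alpha>"
  using comb_single[of \<alpha> 1] unfolding pos_def
  by (auto simp: zscale_one simple_root intro!: exI[of _ "\<lambda>\<gamma>. if \<gamma> = \<alpha> then 1 else 0"])

lemma pos_or_neg: "\<beta> \<in> roots D \<Longrightarrow> pos \<beta> \<or> pos (- \<beta>)"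
  using simple_positive[of \<beta>] uminus_root[of \<beta>] unfolding pos_def comb_def[symmetric]
  by (metis add.inverse_inverse)

text \<open>The two nonnegative expansions add up to zero, so independence kills all coefficients
  and the root would be 0.\<close>

lemma not_pos_neg: "pos \<beta> \<Longrightarrow> \<not> pos (- \<beta>)"
proof
  assume "pos \<beta>" "pos (- \<beta>)"
  then obtain k l where *: "\<forall>\<alpha>. 0 \<le> k \<alpha>" "\<forall>\<alpha>. 0 \<le> l \<alpha>" "\<beta> = comb k" "- \<beta> = comb l"
    and "\<beta> \<in> roots D"
    by (auto simp: pos_def)
  from * have "comb (\<lambda>\<alpha>. k \<alpha> + l \<alpha>) = 0" by (metis add.right_inverse comb_simps(1))
  then have "k \<alpha> = 0" if "\<alpha> \<in> simple_roots D" for \<alpha>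
    using comb_eq_0[of _ \<alpha>] that * by (metis add_nonneg_eq_0_iff)
  then have "\<beta> = 0" using * by (simp add: comb_def)
  with \<open>\<beta> \<in> roots D\<close> root_nonzero show False by blast
qed

lemma neg_iff: "\<beta> \<in> roots D \<Longrightarrow> pos (- \<beta>) \<longleftrightarrow> \<not> pos \<beta>"
  using pos_or_neg not_pos_neg by blast

lemma reflection_comb:
  assumes "\<alpha> \<in> simple_roots D"
  shows "reflection D \<alpha> (comb k) =
    comb (\<lambda>\<gamma>. k \<gamma> - (if \<gamma> = \<alpha> then pairing D (comb k) (coroot D \<alpha>) else 0))"
  by (simp add: reflection_def comb_simps(3)[symmetric] comb_single[OF assms])

text \<open>The reflection changes only the coefficient at \<open>\<alpha>\<close>. If the image
  were negative, all other coefficients would vanish, \<open>\<beta>\<close> would be a multiple of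
  \<open>\<alpha>\<close>, and reducedness would leave only \<open>\<alpha>\<close> and
  \<open>- \<alpha>\<close>.\<close>

lemma reflection_pos:
  assumes "\<alpha> \<in> simple_roots D" "pos \<beta>" "\<beta> \<noteq> \<alpha>"
  shows "pos (reflection D \<alpha> \<beta>)"
proof (rule ccontr)
  assume "\<not> ?thesis"
  then have "pos (- reflection D \<alpha> \<beta>)"
    using neg_iff assms pos_root reflection_roots simple_root by (metis image_subset_iff)
  then obtain l where l: "\<forall>\<gamma>. 0 \<le> l \<gamma>" "- reflection D \<alpha> \<beta> = comb l" by (auto simp: pos_def)
  obtain k where k: "\<forall>\<gamma>. 0 \<le> k \<gamma>" "\<beta> = comb k" using assms by (auto simp: pos_def)
  let ?m = "pairing D (comb k) (coroot D \<alpha>)"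
  have "comb l = comb (\<lambda>\<gamma>. - (k \<gamma> - (if \<gamma> = \<alpha> then ?m else 0)))"
    using l k reflection_comb[OF assms(1), of k] by (simp only: comb_simps(2)[symmetric])
  from comb_inj[OF this] have "k \<gamma> = 0" if "\<gamma> \<in> simple_roots D" "\<gamma> \<noteq> \<alpha>" for \<gamma>
    using that k(1) l(1) by (smt (verit))
  then have "comb k = comb (\<lambda>\<gamma>. if \<gamma> = \<alpha> then k \<alpha> else 0)"
    unfolding comb_def by (intro sum.cong) auto
  then have "zscale (k \<alpha>) \<alpha> = zscale 1 \<beta>"
    using k comb_single[OF assms(1)] by (simp add: zscale_one)
  then have "\<beta> = - \<alpha>"
    using reduced[of \<alpha> \<beta> 1 "k \<alpha>"] assms pos_root simple_root by auto
  then show False using not_pos_neg[OF pos_simple[OF assms(1)]] assms(2) by simp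
qed

text \<open>Expanding the second argument of \<open>inner \<beta> \<beta> > 0\<close> in simple
  roots, some summand must be positive; its sign is that of the pairing.\<close>

lemma pos_pairing_simple:
  assumes "pos \<beta>"
  obtains \<alpha> where "\<alpha> \<in> simple_roots D" "0 < pairing D \<beta> (coroot D \<alpha>)"
proof -
  obtain k where k: "\<forall>\<gamma>. 0 \<le> k \<gamma>" "\<beta> = comb k" using assms by (auto simp: pos_def)
  have "0 < inner \<beta> (comb k)" using inner_root_pos[of \<beta>] assms pos_root k by simp
  then have "0 < (\<Sum>\<alpha>\<in>simple_roots D. k \<alpha> * inner \<beta> \<alpha>)"
    by (simp add: comb_def inner_sum inner_simps)
  then obtain \<alpha> where \<alpha>: "\<alpha> \<in> simple_roots D" "0 < k \<alpha> * inner \<beta> \<alpha>"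
    by (meson not_le sum_nonpos)
  then have "0 < inner \<beta> \<alpha>" using k(1) by (metis zero_less_mult_pos order_le_less mult_zero_left less_irrefl)
  then have "0 < pairing D \<beta> (coroot D \<alpha>) * inner \<alpha> \<alpha>"
    using pairing_coroot[OF simple_root[OF \<alpha>(1)], of \<beta>] by simp
  then have "0 < pairing D \<beta> (coroot D \<alpha>)"
    using inner_nonneg[of \<alpha>] by (metis zero_less_mult_pos2 order_le_less mult_zero_right less_irrefl)
  with \<alpha>(1) that show ?thesis by blast
qed

section \<open>Words in simple reflections\<close>

definition word :: "'x list \<Rightarrow> 'x \<Rightarrow> 'x" where
  "word as = foldr (\<lambda>\<alpha> v. reflection D \<alpha> \<circ> v) as id"

lemma word_simps [simp]: "word [] = id" "word (a # as) = reflection D a \<circ> word as"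
  by (simp_all add: word_def)

lemma word_append: "word (as @ bs) = word as \<circ> word bs"
  by (induction as) (auto simp: comp_assoc)

lemma word_weyl: "set as \<subseteq> simple_roots D \<Longrightarrow> word as \<in> weyl D"
  by (induction as) (auto intro: weyl.intros simple_root)

lemma inv_word: "set as \<subseteq> simple_roots D \<Longrightarrow> inv (word as) = word (rev as)"
  by (induction as)
    (auto simp: o_inv_distrib bij_reflection weyl_bij word_weyl inv_reflection simple_root word_append)

text \<open>Induction on the height. Reflecting in a simple root with positive pairing lowers the
  height by that pairing, and the result stays positive unless the root was that simple root
  already.\<close>

lemma pos_root_word:
  assumes "pos \<beta>"
  shows "\<exists>as \<alpha>. set as \<subseteq> simple_roots D \<and> \<alpha> \<in> simple_roots D \<and> \<beta> = word as \<alpha>"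
proof -
  have "\<exists>as \<alpha>. set as \<subseteq> simple_roots D \<and> \<alpha> \<in> simple_roots D \<and> comb k = word as \<alpha>"
    if "pos (comb k)" "\<forall>\<gamma>. 0 \<le> k \<gamma>" "nat (\<Sum>\<gamma>\<in>simple_roots D. k \<gamma>) = n" for k n
    using that
  proof (induction n arbitrary: k rule: less_induct)
    case (less n)
    obtain \<alpha> where \<alpha>: "\<alpha> \<in> simple_roots D" "0 < pairing D (comb k) (coroot D \<alpha>)"
      using pos_pairing_simple less.prems(1) by blast
    show ?case
    proof (cases "comb k = \<alpha>")
      case True
      then show ?thesis using \<alpha> by (intro exI[of _ "[]"]) auto
    next
      case False
      define m where "m = pairing D (comb k) (coroot D \<alpha>)"
      have eq: "reflection D \<alpha> (comb k) = comb (\<lambda>\<gamma>. k \<gamma> - (if \<gamma> = \<alpha> then m else 0))"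
        unfolding m_def by (rule reflection_comb[OF \<alpha>(1)])
      have p: "pos (reflection D \<alpha> (comb k))"
        using reflection_pos \<alpha> less.prems False by blast
      then obtain l where l: "\<forall>\<gamma>. 0 \<le> l \<gamma>" "reflection D \<alpha> (comb k) = comb l"
        by (auto simp: pos_def)
      have l_eq: "l \<gamma> = k \<gamma> - (if \<gamma> = \<alpha> then m else 0)" if "\<gamma> \<in> simple_roots D" for \<gamma>
        using comb_inj[of l "\<lambda>\<gamma>. k \<gamma> - (if \<gamma> = \<alpha> then m else 0)"] that l(2) eq by simp
      have "(\<Sum>\<gamma>\<in>simple_roots D. l \<gamma>) = (\<Sum>\<gamma>\<in>simple_roots D. k \<gamma>) - m"
        using \<alpha>(1) finite_simple by (simp add: l_eq sum_subtractf)
      moreover have "0 \<le> (\<Sum>\<gamma>\<in>simple_roots D. l \<gamma>)" using l(1) by (simp add: sum_nonneg)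
      ultimately have "nat (\<Sum>\<gamma>\<in>simple_roots D. l \<gamma>) < n"
        using less.prems(3) \<alpha>(2) unfolding m_def[symmetric] by linarith
      from less.IH[OF this, of l] p l obtain as \<beta> where
        *: "set as \<subseteq> simple_roots D" "\<beta> \<in> simple_roots D" "comb l = word as \<beta>" by auto
      have "comb k = word (\<alpha> # as) \<beta>"
        using *(3) l(2) reflection_involution[OF simple_root[OF \<alpha>(1)], of "comb k"] by simp
      then show ?thesis using * \<alpha> by (intro exI[of _ "\<alpha> # as"] exI[of _ \<beta>]) simp
    qed
  qed
  moreover obtain k where "\<forall>\<gamma>. 0 \<le> k \<gamma>" "\<beta> = comb k" using assms by (auto simp: pos_def)
  ultimately show ?thesis using assms by blast
qed

text \<open>A positive root has the form \<open>word as \<alpha>\<close> with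
  \<open>\<alpha>\<close> simple, so its reflection is a conjugate of a simple reflection by
  \<open>word as\<close>. A negative root has the same reflection as its negative.\<close>

lemma weyl_word:
  assumes "w \<in> weyl D"
  obtains as where "set as \<subseteq> simple_roots D" "w = word as"
proof -
  have refl: "\<exists>as. set as \<subseteq> simple_roots D \<and> reflection D \<beta> = word as" if "pos \<beta>" for \<beta>
  proof -
    obtain as \<alpha> where *: "set as \<subseteq> simple_roots D" "\<alpha> \<in> simple_roots D" "\<beta> = word as \<alpha>"
      using pos_root_word[OF \<open>pos \<beta>\<close>] by blast
    have "reflection D \<beta> = reflection D \<beta> \<circ> word as \<circ> inv (word as)"
      using weyl_inv_cancel[OF word_weyl[OF *(1)]] by (simp add: comp_assoc)
    also have "\<dots> = word as \<circ> reflection D \<alpha> \<circ> inv (word as)"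
      using weyl_reflection[OF word_weyl[OF *(1)] simple_root[OF *(2)]] * by simp
    also have "\<dots> = word (as @ [\<alpha>] @ rev as)"
      by (simp only: word_append inv_word[OF *(1)]) (simp add: comp_assoc)
    finally show ?thesis using * by (intro exI[of _ "as @ [\<alpha>] @ rev as"]) simp
  qed
  from assms have "\<exists>as. set as \<subseteq> simple_roots D \<and> w = word as"
  proof (induction rule: weyl.induct)
    case id
    show ?case by (intro exI[of _ "[]"]) simp
  next
    case (reflection \<beta> w)
    have "\<exists>as. set as \<subseteq> simple_roots D \<and> reflection D \<beta> = word as"
      using pos_or_neg[OF reflection(1)] refl reflection_uminus[OF reflection(1)] by metis
    with reflection.IH show ?case
      by (metis word_append set_append Un_least)
  qed
  with that show ?thesis by blast
qed

subsection \<open>Length\<close>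

lemma length_word_le: "set as \<subseteq> simple_roots D \<Longrightarrow> weyl_length D (word as) \<le> length as"
  unfolding weyl_length_def word_def by (intro Least_le) auto

lemma reduced_word:
  assumes "w \<in> weyl D"
  obtains as where "set as \<subseteq> simple_roots D" "length as = weyl_length D w" "w = word as"
proof -
  obtain as where "set as \<subseteq> simple_roots D" "w = word as" using weyl_word assms by blast
  then have "\<exists>n as. set as \<subseteq> simple_roots D \<and> length as = n \<and> w = word as" by blast
  from LeastI_ex[OF this] that show ?thesis
    unfolding weyl_length_def word_def by blast
qed

text \<open>Applying the letters from the right, there is a first moment at which the image of
  \<open>\<alpha>\<close> turns negative. Just before, it must be the simple root of the letter
  applied, so this letter equals a conjugate of the reflection in \<open>\<alpha>\<close> and
  cancels against it.\<close>

lemma exchange: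
  assumes "set as \<subseteq> simple_roots D" "\<alpha> \<in> simple_roots D" "\<not> pos (word as \<alpha>)"
  shows "\<exists>bs. set bs \<subseteq> simple_roots D \<and> Suc (length bs) = length as \<and>
    word as \<circ> reflection D \<alpha> = word bs"
  using assms
proof (induction as)
  case Nil
  then show ?case using pos_simple by simp
next
  case (Cons a as)
  show ?case
  proof (cases "pos (word as \<alpha>)")
    case True
    with Cons.prems have eq: "word as \<alpha> = a" using reflection_pos[of a] by auto
    have "reflection D a \<circ> word as \<circ> reflection D \<alpha> = word as \<circ> reflection D \<alpha> \<circ> reflection D \<alpha>"
      using weyl_reflection[OF word_weyl simple_root, of as \<alpha>] Cons.prems eq by auto
    also have "\<dots> = word as"
      using reflection_involution[OF simple_root] Cons.prems by (auto simp: fun_eq_iff)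
    finally have "word (a # as) \<circ> reflection D \<alpha> = word as" by simp
    then show ?thesis using Cons.prems by (intro exI[of _ as]) (simp del: word_simps)
  next
    case False
    have "\<exists>bs. set bs \<subseteq> simple_roots D \<and> Suc (length bs) = length as \<and>
      word as \<circ> reflection D \<alpha> = word bs"
      by (rule Cons.IH[OF _ Cons.prems(2) False]) (use Cons.prems(1) in simp)
    then obtain bs where "set bs \<subseteq> simple_roots D" "Suc (length bs) = length as"
      "word as \<circ> reflection D \<alpha> = word bs" by blast
    moreover from this have "word (a # as) \<circ> reflection D \<alpha> = word (a # bs)"
      by (simp only: word_simps comp_assoc)
    ultimately show ?thesis using Cons.prems by (intro exI[of _ "a # bs"]) (simp del: word_simps)
  qed
qed

lemma length_reflection_le:
  assumes "w \<in> weyl D" "\<alpha> \<in> simple_roots D"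
  shows "weyl_length D w \<le> Suc (weyl_length D (reflection D \<alpha> \<circ> w))"
proof -
  have "reflection D \<alpha> \<circ> w \<in> weyl D" using assms weyl.reflection simple_root by blast
  then obtain as where as: "set as \<subseteq> simple_roots D" "reflection D \<alpha> \<circ> w = word as"
      "length as = weyl_length D (reflection D \<alpha> \<circ> w)"
    using reduced_word by metis
  then have "w = word (\<alpha> # as)"
    using reflection_involution[OF simple_root[OF assms(2)]]
    by (auto simp: fun_eq_iff simp flip: as(2))
  with length_word_le[of "\<alpha> # as"] as assms show ?thesis by simp
qed

text \<open>\<open>exchange\<close> deletes a letter after multiplication on the right, whereas here
  the reflection acts on the left; hence the passage to \<open>inv w\<close> and to reversed
  words.\<close>

lemma length_reflection:
  assumes "w \<in> weyl D" "\<alpha> \<in> simple_roots D" "\<not> pos (inv w \<alpha>)"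
  shows "weyl_length D w = Suc (weyl_length D (reflection D \<alpha> \<circ> w))"
proof -
  obtain as where as: "set as \<subseteq> simple_roots D" "length as = weyl_length D w" "w = word as"
    using reduced_word assms(1) by blast
  with exchange[of "rev as" \<alpha>] assms(2,3) obtain bs where bs: "set bs \<subseteq> simple_roots D"
    "Suc (length bs) = length as" "word (rev as) \<circ> reflection D \<alpha> = word bs"
    by (auto simp: inv_word)
  have "reflection D \<alpha> \<circ> w = inv (inv w \<circ> reflection D \<alpha>)"
    using assms by (simp add: o_inv_distrib weyl_bij weyl_inv bij_reflection simple_root
        inv_inv_eq inv_reflection)
  also have "\<dots> = word (rev bs)" using bs as by (simp add: inv_word)
  finally have "weyl_length D (reflection D \<alpha> \<circ> w) \<le> length bs"
    using length_word_le[of "rev bs"] bs(1) by simp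
  then show ?thesis using length_reflection_le[OF assms(1,2)] bs(2) as(2) by simp
qed

lemma inv_reflection_comp:
  assumes "w \<in> weyl D" "\<alpha> \<in> roots D"
  shows "inv (reflection D \<alpha> \<circ> w) = inv w \<circ> reflection D \<alpha>"
  using assms by (simp add: o_inv_distrib weyl_bij bij_reflection inv_reflection)

text \<open>The first letter of a reduced word serves. Otherwise removing it would produce an
  element of length one more than that of \<open>w\<close>, although the remaining word is
  shorter.\<close>

lemma weyl_descent:
  assumes "w \<in> weyl D" "w \<noteq> id"
  obtains \<alpha> where "\<alpha> \<in> simple_roots D" "\<not> pos (inv w \<alpha>)"
proof -
  obtain as where as: "set as \<subseteq> simple_roots D" "length as = weyl_length D w" "w = word as"
    using reduced_word assms(1) by blast
  with assms(2) obtain a bs where abs: "as = a # bs" by (cases as) auto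
  have a: "a \<in> simple_roots D" "set bs \<subseteq> simple_roots D" using as abs by auto
  have v: "word bs = reflection D a \<circ> w"
    using as abs reflection_involution[OF simple_root[OF a(1)]] by (auto simp: fun_eq_iff)
  have "\<not> pos (inv w a)"
  proof
    assume "pos (inv w a)"
    then have "\<not> pos (inv (word bs) a)"
      using not_pos_neg assms(1) a
      by (simp add: v inv_reflection_comp simple_root reflection_self weyl_minus weyl_inv)
    from length_reflection[OF word_weyl[OF a(2)] a(1) this]
    have "weyl_length D (word bs) = Suc (weyl_length D w)"
      using as abs by simp
    then show False using length_word_le[OF a(2)] as(2) abs by simp
  qed
  with a that show ?thesis by blast
qed

lemma length_id: "weyl_length D id = 0"
  using length_word_le[of "[]"] by simp

lemma length_simple:
  assumes "\<alpha> \<in> simple_roots D"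
  shows "weyl_length D (reflection D \<alpha>) = 1"
proof -
  have "\<not> pos (inv (reflection D \<alpha>) \<alpha>)"
    using assms by (simp add: inv_reflection simple_root reflection_self not_pos_neg pos_simple)
  moreover have "reflection D \<alpha> \<circ> reflection D \<alpha> = id"
    using assms by (simp add: fun_eq_iff reflection_involution simple_root)
  ultimately show ?thesis
    using length_reflection[OF weyl_reflection_mem[OF simple_root] assms, OF assms]
    by (simp add: length_id)
qed

text \<open>The reflection maps the first set injectively into the second and misses
  \<open>\<alpha>\<close>. This is the common descent behind counting inversions and making a vector
  dominant.\<close>

lemma card_reflection_less:
  assumes \<alpha>: "\<alpha> \<in> simple_roots D" and "P \<alpha>" and "\<not> P' \<alpha>"
    and P: "\<And>\<beta>. pos \<beta> \<Longrightarrow> P' \<beta> \<Longrightarrow> P (reflection D \<alpha> \<beta>)"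
  shows "card {\<beta>. pos \<beta> \<and> P' \<beta>} < card {\<beta>. pos \<beta> \<and> P \<beta>}"
proof -
  have fin: "finite {\<beta>. pos \<beta> \<and> Q \<beta>}" for Q
    by (rule finite_subset[OF _ finite_roots]) (auto simp: pos_root)
  have inj: "inj_on (reflection D \<alpha>) A" for A
    using bij_reflection[OF simple_root[OF \<alpha>]] by (meson bij_is_inj inj_on_subset subset_UNIV)
  have "reflection D \<alpha> ` {\<beta>. pos \<beta> \<and> P' \<beta>} \<subseteq> {\<beta>. pos \<beta> \<and> P \<beta>} - {\<alpha>}"
  proof
    fix \<gamma> assume "\<gamma> \<in> reflection D \<alpha> ` {\<beta>. pos \<beta> \<and> P' \<beta>}"
    then obtain \<beta> where \<beta>: "\<gamma> = reflection D \<alpha> \<beta>" "pos \<beta>" "P' \<beta>" by blast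
    have "\<beta> \<noteq> - \<alpha>" using \<beta>(2) not_pos_neg[OF pos_simple[OF \<alpha>]] by blast
    then have "\<gamma> \<noteq> \<alpha>"
      using \<beta>(1) reflection_involution[OF simple_root[OF \<alpha>], of \<beta>]
        reflection_self[OF simple_root[OF \<alpha>]] by auto
    moreover have "\<beta> \<noteq> \<alpha>" using \<beta> assms(3) by blast
    ultimately show "\<gamma> \<in> {\<beta>. pos \<beta> \<and> P \<beta>} - {\<alpha>}"
      using \<beta> P reflection_pos[OF \<alpha>] by blast
  qed
  from card_mono[OF _ this] fin
  have "card {\<beta>. pos \<beta> \<and> P' \<beta>} \<le> card ({\<beta>. pos \<beta> \<and> P \<beta>} - {\<alpha>})"
    by (simp add: card_image[OF inj])
  also have "\<dots> < card {\<beta>. pos \<beta> \<and> P \<beta>}"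
    using \<alpha> assms(2) pos_simple fin by (intro card_Diff1_less) auto
  finally show ?thesis .
qed

text \<open>Peeling off a descent lowers the length by exactly one and the number of inversions by
  at least one. The resulting bound on lengths ensures that the \<open>ARG_MAX\<close> in
  \<open>longest_element\<close> is attained.\<close>

lemma length_le_card:
  "w \<in> weyl D \<Longrightarrow> weyl_length D w \<le> card {\<beta>. pos \<beta> \<and> \<not> pos (inv w \<beta>)}"
proof (induction "card {\<beta>. pos \<beta> \<and> \<not> pos (inv w \<beta>)}" arbitrary: w rule: less_induct)
  case less
  show ?case
  proof (cases "w = id")
    case True
    then show ?thesis by (simp add: length_id)
  next
    case False
    then obtain \<alpha> where \<alpha>: "\<alpha> \<in> simple_roots D" "\<not> pos (inv w \<alpha>)"
      using weyl_descent less.prems by blast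
    let ?v = "reflection D \<alpha> \<circ> w"
    have v: "?v \<in> weyl D" using less.prems \<alpha> weyl.reflection simple_root by blast
    have inv_v: "inv ?v \<beta> = inv w (reflection D \<alpha> \<beta>)" for \<beta>
      using less.prems \<alpha> by (simp add: inv_reflection_comp simple_root)
    have "card {\<beta>. pos \<beta> \<and> \<not> pos (inv ?v \<beta>)} < card {\<beta>. pos \<beta> \<and> \<not> pos (inv w \<beta>)}"
    proof (rule card_reflection_less[where P = "\<lambda>\<beta>. \<not> pos (inv w \<beta>)", OF \<alpha>])
      show "\<not> \<not> pos (inv ?v \<alpha>)"
        using \<alpha> less.prems neg_iff[of "inv w \<alpha>"]
        by (simp add: inv_v reflection_self simple_root weyl_minus weyl_inv weyl_roots)
    qed (simp add: inv_v)
    with less.hyps[OF this v] length_reflection[OF less.prems \<alpha>] show ?thesis by simp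
  qed
qed

lemma longest_element:
  shows longest_element_weyl: "longest_element D \<in> weyl D"
    and longest_element_max: "w \<in> weyl D \<Longrightarrow> weyl_length D w \<le> weyl_length D (longest_element D)"
proof -
  have bound: "weyl_length D w < Suc (card (roots D))" if "w \<in> weyl D" for w
  proof -
    have "card {\<beta>. pos \<beta> \<and> \<not> pos (inv w \<beta>)} \<le> card (roots D)"
      by (intro card_mono finite_roots) (auto simp: pos_root)
    with length_le_card[OF that] show ?thesis by simp
  qed
  show "longest_element D \<in> weyl D"
    unfolding longest_element_def
    by (rule arg_max_natI[where b = "Suc (card (roots D))" and k = id]) (use bound weyl.id in blast)+
  show "weyl_length D w \<le> weyl_length D (longest_element D)" if "w \<in> weyl D"
    unfolding longest_element_def
    using arg_max_nat_le[of "\<lambda>w. w \<in> weyl D", OF that] bound by blast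
qed

lemma neg_of_neg_simple:
  assumes "w \<in> weyl D" "\<And>\<alpha>. \<alpha> \<in> simple_roots D \<Longrightarrow> \<not> pos (w \<alpha>)" "pos \<beta>"
  shows "\<not> pos (w \<beta>)"
proof -
  have "\<exists>l. (\<forall>\<gamma>. 0 \<le> l \<gamma>) \<and> - w \<alpha> = comb l" if "\<alpha> \<in> simple_roots D" for \<alpha>
  proof -
    have "pos (- w \<alpha>)"
      using assms(2)[OF that] neg_iff[OF weyl_roots[OF assms(1) simple_root[OF that]]] by blast
    then show ?thesis unfolding pos_def by blast
  qed
  then have "\<forall>\<alpha>\<in>simple_roots D. \<exists>l. (\<forall>\<gamma>. 0 \<le> l \<gamma>) \<and> - w \<alpha> = comb l" by blast
  from bchoice[OF this] obtain l where l: "\<And>\<alpha> \<gamma>. \<alpha> \<in> simple_roots D \<Longrightarrow> 0 \<le> l \<alpha> \<gamma>"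
      "\<And>\<alpha>. \<alpha> \<in> simple_roots D \<Longrightarrow> - w \<alpha> = comb (l \<alpha>)" by blast
  obtain k where k: "\<forall>\<gamma>. 0 \<le> k \<gamma>" "\<beta> = comb k" using assms by (auto simp: pos_def)
  note add = weyl_additive[OF assms(1)]
  have "- w \<beta> = (\<Sum>\<alpha>\<in>simple_roots D. zscale (k \<alpha>) (- w \<alpha>))"
    unfolding k(2) comb_def additive.sum[OF add] additive_zscale[OF add]
    by (simp only: sum_negf zmod.scale_minus_right)
  also have "\<dots> = (\<Sum>\<alpha>\<in>simple_roots D. comb (\<lambda>\<gamma>. k \<alpha> * l \<alpha> \<gamma>))"
    by (intro sum.cong) (simp_all add: l comb_simps(4))
  also have "\<dots> = comb (\<lambda>\<gamma>. \<Sum>\<alpha>\<in>simple_roots D. k \<alpha> * l \<alpha> \<gamma>)"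
    unfolding comb_def zmod.scale_sum_left by (rule sum.swap)
  finally have "- w \<beta> = comb (\<lambda>\<gamma>. \<Sum>\<alpha>\<in>simple_roots D. k \<alpha> * l \<alpha> \<gamma>)" .
  moreover have "\<forall>\<gamma>. 0 \<le> (\<Sum>\<alpha>\<in>simple_roots D. k \<alpha> * l \<alpha> \<gamma>)"
    using k(1) l(1) by (auto intro!: sum_nonneg)
  moreover have "- w \<beta> \<in> roots D"
    by (rule uminus_root[OF weyl_roots[OF assms(1) pos_root[OF assms(3)]]])
  ultimately have "pos (- w \<beta>)" unfolding pos_def
    by (intro conjI exI[of _ "\<lambda>\<gamma>. \<Sum>\<alpha>\<in>simple_roots D. k \<alpha> * l \<alpha> \<gamma>"])
  then show ?thesis using not_pos_neg[of "w \<beta>"] by blast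
qed

text \<open>By \<open>neg_of_neg_simple\<close> it suffices to look at simple roots. One that stayed
  positive would be a letter that lengthens the longest element.\<close>

lemma longest_element_neg:
  assumes "pos \<beta>"
  shows "\<not> pos (inv (longest_element D) \<beta>)"
proof (rule neg_of_neg_simple[OF weyl_inv[OF longest_element_weyl] _ assms])
  let ?w = "longest_element D"
  fix \<alpha> assume \<alpha>: "\<alpha> \<in> simple_roots D"
  let ?v = "reflection D \<alpha> \<circ> ?w"
  show "\<not> pos (inv ?w \<alpha>)"
  proof
    assume "pos (inv ?w \<alpha>)"
    then have "\<not> pos (inv ?v \<alpha>)"
      using \<alpha> not_pos_neg longest_element_weyl
      by (simp add: inv_reflection_comp simple_root reflection_self weyl_minus weyl_inv)
    moreover have v: "?v \<in> weyl D" using \<alpha> longest_element_weyl weyl.reflection simple_root by blast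
    moreover have "reflection D \<alpha> \<circ> ?v = ?w"
      using \<alpha> by (simp add: fun_eq_iff reflection_involution simple_root)
    ultimately show False
      using length_reflection[OF v \<alpha>] longest_element_max[OF v] by simp
  qed
qed

text \<open>\<open>w \<circ> inv ?l\<close> has no descent: its inverse takes a simple root first to
  a negative root by \<open>inv w\<close> and then to a positive one by \<open>?l\<close>. So it is
  \<open>id\<close>. Since \<open>longest_element\<close> is a choice, this is how it is recognised,
  for its own inverse and across an isogeny.\<close>

lemma longest_element_unique:
  assumes "w \<in> weyl D" "\<And>\<alpha>. \<alpha> \<in> simple_roots D \<Longrightarrow> \<not> pos (inv w \<alpha>)"
  shows "w = longest_element D"
proof -
  let ?l = "longest_element D"
  note l = longest_element_weyl
  have pos: "pos (?l \<beta>)" if "\<beta> \<in> roots D" "\<not> pos \<beta>" for \<beta>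
  proof (rule ccontr)
    assume "\<not> pos (?l \<beta>)"
    then have "\<not> pos (inv ?l (- ?l \<beta>))"
      using longest_element_neg neg_iff[OF weyl_roots[OF l that(1)]] by blast
    with that show False
      using pos_or_neg[OF that(1)] by (simp add: weyl_minus[OF weyl_inv[OF l]] weyl_inv_cancel[OF l])
  qed
  have "w \<circ> inv ?l = id"
  proof (rule ccontr)
    assume "w \<circ> inv ?l \<noteq> id"
    then obtain \<alpha> where \<alpha>: "\<alpha> \<in> simple_roots D" "\<not> pos (inv (w \<circ> inv ?l) \<alpha>)"
      by (rule weyl_descent[OF weyl_comp[OF assms(1) weyl_inv[OF l]]])
    moreover have "inv (w \<circ> inv ?l) = ?l \<circ> inv w"
      using assms(1) l by (simp add: o_inv_distrib weyl_bij weyl_inv inv_inv_eq)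
    moreover have "pos (?l (inv w \<alpha>))"
      using \<alpha>(1) by (intro pos weyl_roots[OF weyl_inv[OF assms(1)]] simple_root assms(2))
    ultimately show False by simp
  qed
  then have "w \<circ> inv ?l \<circ> ?l = ?l" by simp
  then show ?thesis by (simp add: comp_assoc weyl_inv_cancel[OF l])
qed

lemma inv_longest_element: "inv (longest_element D) = longest_element D"
proof (rule longest_element_unique[OF weyl_inv[OF longest_element_weyl]])
  fix \<alpha> assume \<alpha>: "\<alpha> \<in> simple_roots D"
  show "\<not> pos (inv (inv (longest_element D)) \<alpha>)"
  proof
    assume "pos (inv (inv (longest_element D)) \<alpha>)"
    then have "pos (longest_element D \<alpha>)"
      by (simp add: inv_inv_eq weyl_bij longest_element_weyl)
    from longest_element_neg[OF this] show False
      using pos_simple[OF \<alpha>] by (simp add: weyl_inv_cancel[OF longest_element_weyl])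
  qed
qed

subsection \<open>Minuscule representatives\<close>

text \<open>Wider than the usual notion: neither dominance nor being nonzero is asked, so that 0 and
  all Weyl conjugates qualify.\<close>

definition minuscule :: "'x \<Rightarrow> bool" where
  "minuscule x \<longleftrightarrow> (\<forall>\<beta>\<in>roots D. \<bar>pairing D x (coroot D \<beta>)\<bar> \<le> 1)"

lemma minuscule_weyl:
  assumes "minuscule x" "w \<in> weyl D"
  shows "minuscule (w x)"
  unfolding minuscule_def
proof
  fix \<beta> assume \<beta>: "\<beta> \<in> roots D"
  have "pairing D (w x) (coroot D (w (inv w \<beta>))) = pairing D x (coroot D (inv w \<beta>))"
    by (rule weyl_pairing[OF assms(2) weyl_roots[OF weyl_inv[OF assms(2)] \<beta>]])
  then show "\<bar>pairing D (w x) (coroot D \<beta>)\<bar> \<le> 1"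
    using assms \<beta> weyl_roots[OF weyl_inv[OF assms(2)]]
    by (simp add: weyl_inv_cancel[OF assms(2)] minuscule_def)
qed

text \<open>The invariant form takes the place of an expansion in simple coroots: the pairing with
  the coroot of \<open>\<beta>\<close> has the sign of \<open>inner x \<beta>\<close>, and
  \<open>\<beta>\<close> is a nonnegative combination of simple roots.\<close>

lemma dominant_pairing_nonneg:
  assumes "\<And>\<alpha>. \<alpha> \<in> simple_roots D \<Longrightarrow> 0 \<le> pairing D x (coroot D \<alpha>)" "pos \<beta>"
  shows "0 \<le> pairing D x (coroot D \<beta>)"
proof -
  obtain k where k: "\<forall>\<gamma>. 0 \<le> k \<gamma>" "\<beta> = comb k" using assms by (auto simp: pos_def)
  have "0 \<le> inner x \<alpha>" if "\<alpha> \<in> simple_roots D" for \<alpha>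
    using assms(1)[OF that] pairing_coroot[OF simple_root[OF that], of x] inner_nonneg[of \<alpha>]
    by (metis mult_nonneg_nonneg zero_le_mult_iff not_numeral_le_zero zero_le_numeral)
  then have "0 \<le> inner x \<beta>"
    unfolding k(2) using k(1) by (simp add: comb_def inner_sum inner_simps sum_nonneg)
  then show ?thesis
    using pairing_coroot[OF pos_root[OF assms(2)], of x] inner_root_pos[OF pos_root[OF assms(2)]]
    by (smt (verit) mult_neg_pos)
qed

text \<open>Reflecting in a simple root with negative pairing strictly reduces the number of
  positive roots with negative pairing.\<close>

lemma dominant_conjugate:
  "\<exists>w\<in>weyl D. \<forall>\<alpha>\<in>simple_roots D. 0 \<le> pairing D (w x) (coroot D \<alpha>)"
proof (induction "card {\<beta>. pos \<beta> \<and> pairing D x (coroot D \<beta>) < 0}" arbitrary: x rule: less_induct)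
  case less
  show ?case
  proof (cases "\<forall>\<alpha>\<in>simple_roots D. 0 \<le> pairing D x (coroot D \<alpha>)")
    case True
    then show ?thesis by (intro bexI[of _ id]) (auto intro: weyl.id)
  next
    case False
    then obtain \<alpha> where \<alpha>: "\<alpha> \<in> simple_roots D" "pairing D x (coroot D \<alpha>) < 0" by auto
    let ?s = "reflection D \<alpha>"
    have s: "?s \<in> weyl D" using \<alpha> weyl_reflection_mem simple_root by blast
    have eq: "pairing D (?s x) (coroot D \<beta>) = pairing D x (coroot D (?s \<beta>))" if "\<beta> \<in> roots D" for \<beta>
      using weyl_pairing[OF s, of "?s \<beta>" x] that \<alpha> weyl_roots[OF s]
      by (simp add: reflection_involution simple_root)
    have "card {\<beta>. pos \<beta> \<and> pairing D (?s x) (coroot D \<beta>) < 0}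
        < card {\<beta>. pos \<beta> \<and> pairing D x (coroot D \<beta>) < 0}"
    proof (rule card_reflection_less[where P = "\<lambda>\<beta>. pairing D x (coroot D \<beta>) < 0", OF \<alpha>])
      show "\<not> pairing D (?s x) (coroot D \<alpha>) < 0"
        using \<alpha> pairing_root_coroot[OF simple_root[OF \<alpha>(1)]]
        by (simp add: reflection_def pairing_simps pairing_zscale)
    qed (simp add: eq pos_root)
    from less.hyps[OF this] obtain w where "w \<in> weyl D"
      "\<forall>\<alpha>\<in>simple_roots D. 0 \<le> pairing D (w (?s x)) (coroot D \<alpha>)" by blast
    then show ?thesis using weyl_comp[OF _ s] by (intro bexI[of _ "w \<circ> ?s"]) auto
  qed
qed

text \<open>A vector of minimal norm in a coset of the root lattice is minuscule: subtracting a root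
  \<open>\<beta>\<close> changes the norm by \<open>(1 - \<langle>z, \<beta>\<^sup>\<or>\<rangle>) (\<beta>, \<beta>)\<close>.\<close>

lemma minuscule_representative:
  obtains z where "z - x \<in> zmod.span (roots D)" "minuscule z"
    "\<And>\<alpha>. \<alpha> \<in> simple_roots D \<Longrightarrow> 0 \<le> pairing D z (coroot D \<alpha>)"
proof -
  obtain z where z: "z - x \<in> zmod.span (roots D)"
    "\<And>y. y - x \<in> zmod.span (roots D) \<Longrightarrow> nat (inner z z) \<le> nat (inner y y)"
    using ex_has_least_nat[of "\<lambda>z. z - x \<in> zmod.span (roots D)" x "\<lambda>z. nat (inner z z)"]
    by (auto simp: zmod.span_zero)
  have le: "pairing D z (coroot D \<beta>) \<le> 1" if \<beta>: "\<beta> \<in> roots D" for \<beta>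
  proof -
    have "(z - x) - \<beta> \<in> zmod.span (roots D)"
      by (intro zmod.span_diff[OF z(1)] zmod.span_base \<beta>)
    then have "nat (inner z z) \<le> nat (inner (z - \<beta>) (z - \<beta>))"
      using z(2)[of "z - \<beta>"] by (simp add: diff_right_commute)
    then have "inner z z \<le> inner (z - \<beta>) (z - \<beta>)" using inner_nonneg[of "z - \<beta>"] by linarith
    then have "pairing D z (coroot D \<beta>) * inner \<beta> \<beta> \<le> 1 * inner \<beta> \<beta>"
      using pairing_coroot[OF \<beta>, of z] by (simp add: inner_simps inner_commute[of \<beta> z])
    then show ?thesis using inner_root_pos[OF \<beta>] by simp
  qed
  \<comment> \<open>\<open>le\<close> bounds pairings from above only. The lower bound is
    \<open>le\<close> for \<open>- \<beta>\<close>, once the coroot of \<open>- \<beta>\<close> is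
    known to pair with the opposite sign.\<close>
  have neg: "pairing D z (coroot D (- \<beta>)) = - pairing D z (coroot D \<beta>)" if \<beta>: "\<beta> \<in> roots D" for \<beta>
    using weyl_pairing[OF weyl_reflection_mem[OF \<beta>] \<beta>, of "reflection D \<beta> z"] \<beta> pairing_root_coroot[OF \<beta>]
    by (simp add: reflection_self reflection_involution)
       (simp add: reflection_def pairing_simps pairing_zscale)
  have "minuscule z"
    unfolding minuscule_def using le neg uminus_root by (smt (verit))
  moreover obtain w where w: "w \<in> weyl D"
    "\<forall>\<alpha>\<in>simple_roots D. 0 \<le> pairing D (w z) (coroot D \<alpha>)"
    using dominant_conjugate by blast
  moreover have "w z - x \<in> zmod.span (roots D)"
    using zmod.span_add[OF weyl_diff_span[OF w(1), of z] z(1)] by simp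
  ultimately show ?thesis using that minuscule_weyl by blast
qed

end

section \<open>Affine Hecke algebras\<close>

lemma ring_inv_eq:
  fixes a b :: "'a::ring_1"
  assumes "a * b = 1" "b * a = 1"
  shows "ring_inv a = b"
  unfolding ring_inv_def
proof (rule the_equality)
  show "a * b = 1 \<and> b * a = 1" using assms by simp
  fix b' assume "a * b' = 1 \<and> b' * a = 1"
  then show "b' = b" using assms by (metis mult.assoc mult_1_left mult_1_right)
qed

context based_root_datum
begin

text \<open>One letter peeled off the left of a reduced word of \<open>u\<close>: the common step of
  the inductions along reduced words, which see the word only through inversions.\<close>

lemma descent:
  assumes "u \<in> weyl D" "\<alpha> \<in> simple_roots D" "\<not> pos (inv u \<alpha>)"
  defines "v \<equiv> reflection D \<alpha> \<circ> u"
  shows descent_weyl: "v \<in> weyl D"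
    and descent_inv: "inv v \<beta> = inv u (reflection D \<alpha> \<beta>)"
    and descent_pos: "pos (inv v \<alpha>)"
    and descent_length: "weyl_length D u = Suc (weyl_length D v)"
    and descent_comp: "reflection D \<alpha> \<circ> v = u"
proof -
  show "v \<in> weyl D" using assms weyl.reflection simple_root by blast
  show inv: "inv v \<beta> = inv u (reflection D \<alpha> \<beta>)" for \<beta>
    using assms by (simp add: inv_reflection_comp simple_root)
  have "pos (- inv u \<alpha>)"
    using neg_iff[OF weyl_roots[OF weyl_inv[OF assms(1)] simple_root[OF assms(2)]]] assms(3) by blast
  then show "pos (inv v \<alpha>)"
    using assms(1,2) by (simp add: inv reflection_self simple_root weyl_minus[OF weyl_inv])
  show "weyl_length D u = Suc (weyl_length D v)"
    unfolding v_def by (rule length_reflection[OF assms(1-3)])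
  show "reflection D \<alpha> \<circ> v = u"
    using assms(2) by (simp add: v_def fun_eq_iff reflection_involution simple_root)
qed

text \<open>\<open>\<beta>\<close> differs from \<open>\<alpha>\<close>, which is no inversion of
  the shorter element, so the reflection keeps it positive. A condition on all inversions of
  \<open>u\<close> thus passes to the shorter element once the vector is reflected as well.\<close>

lemma descent_inversion:
  assumes "u \<in> weyl D" "\<alpha> \<in> simple_roots D" "\<not> pos (inv u \<alpha>)"
    and "pos \<beta>" "\<not> pos (inv (reflection D \<alpha> \<circ> u) \<beta>)"
  shows "pos (reflection D \<alpha> \<beta>)" "\<not> pos (inv u (reflection D \<alpha> \<beta>))"
  using assms descent_inv[OF assms(1-3)] descent_pos[OF assms(1-3)]
  by (auto intro: reflection_pos)

lemma pairing_reflection_both: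
  assumes "\<alpha> \<in> roots D" "\<beta> \<in> roots D"
  shows "pairing D (reflection D \<alpha> x) (coroot D \<beta>) = pairing D x (coroot D (reflection D \<alpha> \<beta>))"
  using weyl_pairing[OF weyl_reflection_mem[OF assms(1)], of "reflection D \<alpha> \<beta>" x] assms
    weyl_roots[OF weyl_reflection_mem[OF assms(1)], of \<beta>]
  by (simp add: reflection_involution)

lemma zscale_root_nonzero: "\<alpha> \<in> roots D \<Longrightarrow> k \<noteq> 0 \<Longrightarrow> zscale k \<alpha> \<noteq> 0"
  using pairing_root_coroot[of \<alpha>] pairing_zscale(1)[of k \<alpha> "coroot D \<alpha>"]
  by (auto simp: pairing_simps)

lemma reflection_fixed: "pairing D x (coroot D \<alpha>) = 0 \<Longrightarrow> reflection D \<alpha> x = x"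
  by (simp add: reflection_def)

end

context complex_algebra
begin

lemma mult_scale: "scale c a * b = scale c (a * b)" "a * scale c b = scale c (a * b)"
  by (rule scale_mult_left[symmetric], rule scale_mult_right[symmetric])

lemma span_mult_left:
  assumes "a \<in> span S" "\<And>s. s \<in> S \<Longrightarrow> b * s \<in> span S'"
  shows "b * a \<in> span S'"
  using assms(1)
  by (induction rule: span_induct_alt)
    (simp_all add: span_zero distrib_left mult_scale assms(2) span_add span_scale)

lemma span_mult_right:
  assumes "a \<in> span S" "\<And>s. s \<in> S \<Longrightarrow> s * b \<in> span S'"
  shows "a * b \<in> span S'"
  using assms(1)
  by (induction rule: span_induct_alt)
    (simp_all add: span_zero distrib_right mult_scale assms(2) span_add span_scale)

end

context affine_hecke_algebra
begin

section \<open>The group algebra of \<open>X\<close> inside the Hecke algebra\<close>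

lemma hecke_induct [case_names zero add]:
  assumes "P 0" "\<And>c x w h. w \<in> weyl D \<Longrightarrow> P h \<Longrightarrow> P (scale c (\<theta> x * T w) + h)"
  shows "P h"
proof -
  have "h \<in> span ((\<lambda>(x, w). \<theta> x * T w) ` (UNIV \<times> weyl D))" by (simp add: basis_span)
  then show ?thesis by (induction rule: span_induct_alt) (use assms in auto)
qed

text \<open>The axioms do not name the unit in terms of the basis. As \<open>id\<close> has length
  0, \<open>T id\<close> is a right identity on all basis elements, hence on 1.\<close>

lemma T_id: "T id = 1"
proof -
  have "h * T id = h" for h
    by (induction h rule: hecke_induct)
      (simp_all only: mult_zero_left distrib_right mult_scale mult.assoc T_mult[OF _ weyl.id]
        length_id comp_id add_0_right)
  from this[of 1] show ?thesis by simp
qed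

lemma \<theta>_0: "\<theta> 0 = 1"
proof -
  have "\<theta> 0 * h = h" for h
    by (induction h rule: hecke_induct)
      (simp_all add: distrib_left mult_scale \<theta>_mult mult.assoc[symmetric])
  from this[of 1] show ?thesis by simp
qed

lemma inj_\<theta>: "inj \<theta>"
proof
  fix x y assume "\<theta> x = \<theta> y"
  then have "(\<lambda>(x, w). \<theta> x * T w) (x, id) = (\<lambda>(x, w). \<theta> x * T w) (y, id)" by simp
  from inj_onD[OF basis_inj this] show "x = y" by (simp add: weyl.id)
qed

lemma independent_\<theta>: "independent (range \<theta>)"
proof (rule independent_mono[OF basis_independent])
  show "range \<theta> \<subseteq> (\<lambda>(x, w). \<theta> x * T w) ` (UNIV \<times> weyl D)"
    by (auto intro!: image_eqI[of _ _ "(_, id)"] simp: T_id weyl.id)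
qed

lemma \<theta>_span_mult: "g \<in> span (range \<theta>) \<Longrightarrow> g * \<theta> y \<in> span (range \<theta>)"
  by (erule span_mult_right) (auto simp: \<theta>_mult intro: span_base)

lemma representation_\<theta>_shift:
  assumes "g \<in> span (range \<theta>)"
  shows "representation (range \<theta>) (g * \<theta> y) (\<theta> (x + y)) = representation (range \<theta>) g (\<theta> x)"
proof -
  let ?R = "representation (range \<theta>)"
  have "g \<in> span (range \<theta>) \<and> ?R (g * \<theta> y) (\<theta> (x + y)) = ?R g (\<theta> x)"
    using assms
  proof (induction rule: span_induct_alt)
    case base
    show ?case by (simp add: representation_zero span_zero)
  next
    case (step c b g)
    then obtain z where z: "b = \<theta> z" by auto
    have span: "\<theta> z \<in> span (range \<theta>)" "\<theta> (z + y) \<in> span (range \<theta>)"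
      "g \<in> span (range \<theta>)" "g * \<theta> y \<in> span (range \<theta>)"
      using step \<theta>_span_mult by (auto intro: span_base)
    have "(scale c b + g) * \<theta> y = scale c (\<theta> (z + y)) + g * \<theta> y"
      by (simp add: z distrib_right mult_scale \<theta>_mult)
    then show ?case
      using step span inj_\<theta>
      by (simp add: z representation_add[OF independent_\<theta>] representation_scale[OF independent_\<theta>]
          representation_basis[OF independent_\<theta>] span_scale span_add inj_eq)
  qed
  then show ?thesis ..
qed

text \<open>\<open>1 - \<theta>\<^sub>\<gamma>\<close> is not a zero divisor: a \<open>\<theta>\<^sub>\<gamma>\<close>-invariant element has shift-invariant
  coefficients, but finite support.\<close>

lemma \<theta>_invariant_zero:
  assumes g: "g \<in> span (range \<theta>)" "g * \<theta> \<gamma> = g"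
    and \<gamma>: "\<And>k. k \<noteq> 0 \<Longrightarrow> zscale k \<gamma> \<noteq> 0"
  shows "g = 0"
proof -
  have inv: "g * \<theta> (zscale (int k) \<gamma>) = g" for k
  proof (induction k)
    case 0
    show ?case by (simp add: \<theta>_0)
  next
    case (Suc k)
    have "zscale (int (Suc k)) \<gamma> = zscale (int k) \<gamma> + \<gamma>"
      using zscale_succ[of "int k" \<gamma>] by (simp add: add.commute)
    then show ?case using Suc g(2) by (simp flip: \<theta>_mult mult.assoc)
  qed
  have "representation (range \<theta>) g (\<theta> x) = 0" for x
  proof (rule ccontr)
    assume ne: "representation (range \<theta>) g (\<theta> x) \<noteq> 0"
    have "representation (range \<theta>) g (\<theta> (x + zscale (int k) \<gamma>)) \<noteq> 0" for k
      using representation_\<theta>_shift[OF g(1), of "zscale (int k) \<gamma>" x] ne by (simp add: inv)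
    then have "range (\<lambda>k. \<theta> (x + zscale (int k) \<gamma>)) \<subseteq> {b. representation (range \<theta>) g b \<noteq> 0}"
      by auto
    moreover have "inj (\<lambda>k. \<theta> (x + zscale (int k) \<gamma>))"
    proof
      fix j k assume "\<theta> (x + zscale (int j) \<gamma>) = \<theta> (x + zscale (int k) \<gamma>)"
      then have "zscale (int j - int k) \<gamma> = 0"
        using inj_\<theta> by (simp add: inj_eq zmod.scale_left_diff_distrib)
      then show "j = k" using \<gamma>[of "int j - int k"] by auto
    qed
    ultimately have "infinite {b. representation (range \<theta>) g b \<noteq> 0}"
      using finite_subset finite_imageD by blast
    then show False using finite_representation by blast
  qed
  then have "representation (range \<theta>) g b = 0" for b
    using representation_ne_zero[of "range \<theta>" g b] by auto
  then show ?thesis using sum_nonzero_representation_eq[OF independent_\<theta> g(1)] by simp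
qed

text \<open>The cross relations only assert that some quotient exists; uniqueness lets it be
  replaced by an explicit one.\<close>

lemma \<theta>_quotient_unique:
  assumes "g \<in> span (range \<theta>)" "g' \<in> span (range \<theta>)" "g * (1 - \<theta> \<gamma>) = g' * (1 - \<theta> \<gamma>)"
    and "\<And>k. k \<noteq> 0 \<Longrightarrow> zscale k \<gamma> \<noteq> 0"
  shows "g = g'"
proof -
  have "g - g' = 0"
    using assms by (intro \<theta>_invariant_zero[of "g - g'" \<gamma>] span_diff) (auto simp: algebra_simps)
  then show ?thesis by simp
qed

lemma zscale_uminus_root: "\<alpha> \<in> roots D \<Longrightarrow> k \<noteq> 0 \<Longrightarrow> zscale k (- \<alpha>) \<noteq> 0"
  using zscale_root_nonzero by simp

lemma zscale_uminus_double_root: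
  assumes "\<alpha> \<in> roots D" "k \<noteq> 0"
  shows "zscale k (- (\<alpha> + \<alpha>)) \<noteq> 0"
proof -
  have "zscale k (- (\<alpha> + \<alpha>)) = zscale (- 2 * k) \<alpha>"
    by (simp only: zmod.scale_right_distrib zmod.scale_minus_right mult_2 mult_minus_left
        zmod.scale_left_distrib zmod.scale_minus_left)
  then show ?thesis using zscale_root_nonzero[OF assms(1), of "- 2 * k"] assms(2) by simp
qed

text \<open>The numerator of the fraction is zero, so by uniqueness the correction term vanishes in
  both forms of the cross relation.\<close>

lemma cross_commute:
  assumes "\<alpha> \<in> simple_roots D" "pairing D x (coroot D \<alpha>) = 0"
  shows "T (reflection D \<alpha>) * \<theta> x = \<theta> x * T (reflection D \<alpha>)"
proof (cases "coroot_even D \<alpha>")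
  case False
  obtain g where g: "g \<in> span (range \<theta>)" "g * (1 - \<theta> (- \<alpha>)) = 0"
    "T (reflection D \<alpha>) * \<theta> x =
      \<theta> x * T (reflection D \<alpha>) + scale (of_real (q powr lam \<alpha> - 1)) g"
    using cross_relation[OF assms(1) False refl, of x] reflection_fixed[OF assms(2)] by auto
  have "g = 0"
    using g zscale_uminus_root[OF simple_root[OF assms(1)]]
    by (intro \<theta>_quotient_unique[of g 0 "- \<alpha>"]) (auto simp: span_zero)
  with g show ?thesis by simp
next
  case True
  obtain g c where g: "g \<in> span (range \<theta>)" "g * (1 - \<theta> (- (\<alpha> + \<alpha>))) = 0"
    "T (reflection D \<alpha>) * \<theta> x = \<theta> x * T (reflection D \<alpha>) + c * g"
    using cross_relation_even[OF assms(1) True refl, of x] reflection_fixed[OF assms(2)] by auto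
  have "g = 0"
    using g zscale_uminus_double_root[OF simple_root[OF assms(1)]]
    by (intro \<theta>_quotient_unique[of g 0 "- (\<alpha> + \<alpha>)"]) (auto simp: span_zero)
  with g show ?thesis by simp
qed

section \<open>Inverses of the generators and conjugation of \<open>\<theta>\<close>\<close>

lemma T_square:
  assumes "\<alpha> \<in> simple_roots D"
  shows "T (reflection D \<alpha>) * T (reflection D \<alpha>) =
    scale (of_real (q powr lam \<alpha> - 1)) (T (reflection D \<alpha>)) + scale (of_real (q powr lam \<alpha>)) 1"
  using T_quadratic[OF assms]
  by (simp add: algebra_simps mult_scale scale_left_diff_distrib add_eq_0_iff2)

text \<open>The quadratic relation solved for the inverse. The last coefficient is
  \<open>(q powr - lam \<alpha>) - 1\<close>; the subtraction lies outside the exponent. As a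
  combination of the generator and 1, the inverse visibly preserves degrees.\<close>

definition Tinv :: "'x \<Rightarrow> 'h" where
  "Tinv \<alpha> = scale (of_real (q powr - lam \<alpha>)) (T (reflection D \<alpha>)) +
     scale (of_real (q powr - lam \<alpha> - 1)) 1"

lemma Tinv:
  assumes "\<alpha> \<in> simple_roots D"
  shows "T (reflection D \<alpha>) * Tinv \<alpha> = 1" "Tinv \<alpha> * T (reflection D \<alpha>) = 1"
proof -
  have q: "q powr - lam \<alpha> * q powr lam \<alpha> = 1"
    using q_gt_1 by (simp flip: powr_add)
  have "scale (of_real (q powr - lam \<alpha>)) (scale (of_real (q powr lam \<alpha> - 1)) (T (reflection D \<alpha>))
      + scale (of_real (q powr lam \<alpha>)) 1)
      + scale (of_real (q powr - lam \<alpha> - 1)) (T (reflection D \<alpha>)) =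
    scale (of_real (q powr - lam \<alpha> * (q powr lam \<alpha> - 1) + (q powr - lam \<alpha> - 1))) (T (reflection D \<alpha>))
      + scale (of_real (q powr - lam \<alpha> * q powr lam \<alpha>)) 1"
    by (simp only: scale_right_distrib scale_scale of_real_mult of_real_add scale_left_distrib add_ac)
  also have "q powr - lam \<alpha> * (q powr lam \<alpha> - 1) + (q powr - lam \<alpha> - 1) = 0"
    using q by (simp add: right_diff_distrib)
  finally have *: "scale (of_real (q powr - lam \<alpha>)) (T (reflection D \<alpha>) * T (reflection D \<alpha>))
      + scale (of_real (q powr - lam \<alpha> - 1)) (T (reflection D \<alpha>)) = 1"
    by (simp add: T_square[OF assms] q)
  then show "T (reflection D \<alpha>) * Tinv \<alpha> = 1" "Tinv \<alpha> * T (reflection D \<alpha>) = 1"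
    by (simp_all add: Tinv_def distrib_left distrib_right mult_scale)
qed

lemma pairing_coroot_even: "coroot_even D \<alpha> \<Longrightarrow> even (pairing D x (coroot D \<alpha>))"
  by (auto simp: coroot_even_def pairing_simps)

text \<open>If \<open>\<langle>x, \<alpha>\<^sup>\<or>\<rangle> = 1\<close>, the fraction in the cross relation is \<open>\<theta>\<^sub>x\<close>.\<close>

lemma cross_minuscule:
  assumes \<alpha>: "\<alpha> \<in> simple_roots D" "pairing D x (coroot D \<alpha>) = 1"
  shows "Tinv \<alpha> * \<theta> x =
    scale (of_real (q powr - lam \<alpha>)) (\<theta> (reflection D \<alpha> x) * T (reflection D \<alpha>))"
proof -
  let ?s = "reflection D \<alpha>"
  have odd: "\<not> coroot_even D \<alpha>" using pairing_coroot_even[of \<alpha> x] \<alpha>(2) by auto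
  have sx: "?s x = x - \<alpha>" by (simp add: reflection_def \<alpha>(2) zscale_one)
  obtain g where g: "g \<in> span (range \<theta>)" "g * (1 - \<theta> (- \<alpha>)) = \<theta> x - \<theta> (?s x)"
    "T ?s * \<theta> x = \<theta> (?s x) * T ?s + scale (of_real (q powr lam \<alpha> - 1)) g"
    using cross_relation[OF \<alpha>(1) odd refl, of x] by auto
  have "g = \<theta> x"
    using g zscale_uminus_root[OF simple_root[OF \<alpha>(1)]]
    by (intro \<theta>_quotient_unique[of g "\<theta> x" "- \<alpha>"])
      (auto simp: span_base sx right_diff_distrib \<theta>_mult)
  have q: "q powr - lam \<alpha> * q powr lam \<alpha> = 1"
    using q_gt_1 by (simp flip: powr_add)
  have "Tinv \<alpha> * \<theta> x = scale (of_real (q powr - lam \<alpha>)) (T ?s * \<theta> x) +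
      scale (of_real (q powr - lam \<alpha> - 1)) (\<theta> x)"
    by (simp add: Tinv_def distrib_right mult_scale)
  also have "\<dots> = scale (of_real (q powr - lam \<alpha>)) (\<theta> (?s x) * T ?s) +
      scale (of_real (q powr - lam \<alpha> * (q powr lam \<alpha> - 1) + (q powr - lam \<alpha> - 1))) (\<theta> x)"
    unfolding g(3) \<open>g = \<theta> x\<close>
    by (simp only: scale_right_distrib scale_scale of_real_mult of_real_add scale_left_distrib add_ac)
  \<comment> \<open>The correction term of the cross relation cancels against the constant term of
    \<open>Tinv\<close>. This is why the inverse, and not the generator itself, yields a single
    term.\<close>
  also have "q powr - lam \<alpha> * (q powr lam \<alpha> - 1) + (q powr - lam \<alpha> - 1) = 0"
    using q by (simp add: right_diff_distrib)
  finally show ?thesis by simp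
qed

lemma T_descent:
  assumes "u \<in> weyl D" "\<alpha> \<in> simple_roots D" "\<not> pos (inv u \<alpha>)"
  shows "T u = T (reflection D \<alpha>) * T (reflection D \<alpha> \<circ> u)"
  using T_mult[OF weyl_reflection_mem[OF simple_root[OF assms(2)]] descent_weyl[OF assms]]
    descent_length[OF assms] length_simple[OF assms(2)]
  by (simp only: descent_comp[OF assms] plus_1_eq_Suc)

text \<open>The word need not be reduced, so in general this is not \<open>T\<close> of the
  corresponding Weyl group element. Such products are invertible, and \<open>star\<close> reverses
  their words.\<close>

definition Tprod :: "'x list \<Rightarrow> 'h" where
  "Tprod as = prod_list (map (\<lambda>\<alpha>. T (reflection D \<alpha>)) as)"

lemma Tprod_simps [simp]:
  "Tprod [] = 1" "Tprod (\<alpha> # as) = T (reflection D \<alpha>) * Tprod as"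
  "Tprod (as @ bs) = Tprod as * Tprod bs"
  by (simp_all add: Tprod_def)

lemma T_eq_Tprod:
  assumes "w \<in> weyl D"
  shows "\<exists>as. set as \<subseteq> simple_roots D \<and> T w = Tprod as"
  using assms
proof (induction "weyl_length D w" arbitrary: w rule: less_induct)
  case less
  show ?case
  proof (cases "w = id")
    case True
    then show ?thesis by (intro exI[of _ "[]"]) (simp add: T_id[unfolded id_def] T_id)
  next
    case False
    then obtain \<alpha> where \<alpha>: "\<alpha> \<in> simple_roots D" "\<not> pos (inv w \<alpha>)"
      using weyl_descent less.prems by blast
    obtain as where "set as \<subseteq> simple_roots D" "T (reflection D \<alpha> \<circ> w) = Tprod as"
      using less.hyps[OF _ descent_weyl[OF less.prems \<alpha>]] descent_length[OF less.prems \<alpha>] by auto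
    then show ?thesis
      using \<alpha>(1) T_descent[OF less.prems \<alpha>] by (intro exI[of _ "\<alpha> # as"]) simp
  qed
qed

lemma Tprod_inverse:
  assumes "set as \<subseteq> simple_roots D"
  shows "\<exists>bs. set bs \<subseteq> simple_roots D \<and>
    Tprod as * prod_list (map Tinv bs) = 1 \<and> prod_list (map Tinv bs) * Tprod as = 1"
  using assms
proof (induction as)
  case Nil
  show ?case by (intro exI[of _ "[]"]) simp
next
  case (Cons a as)
  then obtain bs where bs: "set bs \<subseteq> simple_roots D"
    "Tprod as * prod_list (map Tinv bs) = 1" "prod_list (map Tinv bs) * Tprod as = 1" by auto
  have a: "a \<in> simple_roots D" using Cons.prems by simp
  have "Tprod (a # as) * prod_list (map Tinv (bs @ [a])) =
      T (reflection D a) * (Tprod as * prod_list (map Tinv bs)) * Tinv a"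
    by (simp add: mult.assoc)
  moreover have "prod_list (map Tinv (bs @ [a])) * Tprod (a # as) =
      prod_list (map Tinv bs) * (Tinv a * T (reflection D a)) * Tprod as"
    by (simp add: mult.assoc)
  ultimately show ?case using bs a by (intro exI[of _ "bs @ [a]"]) (simp add: Tinv)
qed

lemma Tprod_ring_inv:
  assumes "set as \<subseteq> simple_roots D"
  shows "Tprod as * ring_inv (Tprod as) = 1" "ring_inv (Tprod as) * Tprod as = 1"
  using Tprod_inverse[OF assms] ring_inv_eq by metis+

lemma T_ring_inv:
  assumes "w \<in> weyl D"
  shows "T w * ring_inv (T w) = 1" "ring_inv (T w) * T w = 1"
  using T_eq_Tprod[OF assms] Tprod_ring_inv by metis+

text \<open>Each letter of a reduced word of \<open>u\<close>, at the moment it is peeled off, pairs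
  with \<open>y\<close> to 0; so it fixes \<open>y\<close> and its generator commutes with
  \<open>\<theta> (- y)\<close>. This settles the end of the next induction, where no letter lowers
  the vector any more.\<close>

lemma T_commute_\<theta>:
  assumes "u \<in> weyl D" "\<And>\<beta>. pos \<beta> \<Longrightarrow> \<not> pos (inv u \<beta>) \<Longrightarrow> pairing D y (coroot D \<beta>) = 0"
  shows "inv u y = y \<and> T u * \<theta> (- y) = \<theta> (- y) * T u"
  using assms
proof (induction "weyl_length D u" arbitrary: u rule: less_induct)
  case less
  show ?case
  proof (cases "u = id")
    case True
    then show ?thesis unfolding True T_id by simp
  next
    case False
    then obtain \<alpha> where \<alpha>: "\<alpha> \<in> simple_roots D" "\<not> pos (inv u \<alpha>)"
      using weyl_descent less.prems(1) by blast
    let ?s = "reflection D \<alpha>" and ?v = "reflection D \<alpha> \<circ> u"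
    note u = less.prems(1)
    have 0: "pairing D y (coroot D \<alpha>) = 0" using less.prems(2) \<alpha> pos_simple by blast
    have sy: "?s y = y" using reflection_fixed[OF 0] .
    have "inv ?v y = y \<and> T ?v * \<theta> (- y) = \<theta> (- y) * T ?v"
    proof (rule less.hyps)
      fix \<beta> assume \<beta>: "pos \<beta>" "\<not> pos (inv ?v \<beta>)"
      have "pairing D (?s y) (coroot D \<beta>) = pairing D y (coroot D (?s \<beta>))"
        using \<alpha>(1) \<beta>(1) by (intro pairing_reflection_both simple_root pos_root)
      also have "\<dots> = 0"
        by (rule less.prems(2)[OF descent_inversion[OF u \<alpha> \<beta>]])
      finally show "pairing D y (coroot D \<beta>) = 0" by (simp only: sy)
    qed (use descent_length[OF u \<alpha>] descent_weyl[OF u \<alpha>] in auto)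
    moreover have "inv ?v y = inv u y" using descent_inv[OF u \<alpha>, of y] by (simp only: sy)
    moreover have "T ?s * \<theta> (- y) = \<theta> (- y) * T ?s"
      using \<alpha>(1) 0 by (intro cross_commute) (simp_all add: pairing_simps)
    ultimately show ?thesis
      unfolding T_descent[OF u \<alpha>] by (metis mult.assoc)
  qed
qed

text \<open>
  The induction peels off a reduced word of \<open>u\<close>, first the letters which lower \<open>y\<close>: a letter with
  pairing \<open>1\<close> turns \<open>T\<^sub>s\<^sup>-\<^sup>1\<close> into \<open>T\<^sub>s\<close>, one with pairing \<open>0\<close> does not, and only if the latter come last
  do they cancel.  By the second sign condition \<open>y\<close> is antidominant once no lowering letter is left.
\<close>

lemma conjugate_\<theta>_positive:
  assumes "u \<in> weyl D"
    and "\<And>\<beta>. pos \<beta> \<Longrightarrow> \<not> pos (inv u \<beta>) \<Longrightarrow> pairing D y (coroot D \<beta>) \<in> {0, 1}"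
    and "\<And>\<beta>. pos \<beta> \<Longrightarrow> pos (inv u \<beta>) \<Longrightarrow> pairing D y (coroot D \<beta>) \<le> 0"
  shows "\<exists>c>0. \<exists>as. set as \<subseteq> simple_roots D \<and>
    T u * \<theta> (- inv u y) * ring_inv (T u) * \<theta> y = scale (of_real c) (Tprod as * Tprod (rev as))"
  using assms
proof (induction "weyl_length D u" arbitrary: u y rule: less_induct)
  case less
  note u = less.prems(1)
  show ?case
  proof (cases "\<exists>\<alpha>\<in>simple_roots D. \<not> pos (inv u \<alpha>) \<and> pairing D y (coroot D \<alpha>) = 1")
    case True
    then obtain \<alpha> where \<alpha>: "\<alpha> \<in> simple_roots D" "\<not> pos (inv u \<alpha>)" "pairing D y (coroot D \<alpha>) = 1"
      by blast
    let ?s = "reflection D \<alpha>" and ?v = "reflection D \<alpha> \<circ> u"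
    note v = descent_weyl[OF u \<alpha>(1,2)]
    have eq: "pairing D (?s y) (coroot D \<beta>) = pairing D y (coroot D (?s \<beta>))" if "pos \<beta>" for \<beta>
      using \<alpha>(1) that by (intro pairing_reflection_both simple_root pos_root)
    have "\<exists>c>0. \<exists>as. set as \<subseteq> simple_roots D \<and>
      T ?v * \<theta> (- inv ?v (?s y)) * ring_inv (T ?v) * \<theta> (?s y) =
        scale (of_real c) (Tprod as * Tprod (rev as))"
    proof (rule less.hyps[OF _ v])
      show "weyl_length D ?v < weyl_length D u" using descent_length[OF u \<alpha>(1,2)] by simp
    next
      fix \<beta> assume \<beta>: "pos \<beta>" "\<not> pos (inv ?v \<beta>)"
      show "pairing D (?s y) (coroot D \<beta>) \<in> {0, 1}"
        unfolding eq[OF \<beta>(1)] by (rule less.prems(2)[OF descent_inversion[OF u \<alpha>(1,2) \<beta>]])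
    next
      fix \<beta> assume \<beta>: "pos \<beta>" "pos (inv ?v \<beta>)"
      show "pairing D (?s y) (coroot D \<beta>) \<le> 0"
      \<comment> \<open>\<open>\<alpha>\<close> has left the set of inversions, so the second sign
        condition now applies to it: its pairing has changed from 1 to -1. All other roots inherit
        the condition from \<open>u\<close>.\<close>
      proof (cases "\<beta> = \<alpha>")
        case True
        have "pairing D (?s y) (coroot D \<alpha>) = - 1"
          using \<alpha>(3) pairing_root_coroot[OF simple_root[OF \<alpha>(1)]]
          by (simp add: reflection_def pairing_simps pairing_zscale)
        with True show ?thesis by simp
      next
        case False
        have "pos (inv u (?s \<beta>))" using \<beta>(2) descent_inv[OF u \<alpha>(1,2), of \<beta>] by simp
        from less.prems(3)[OF reflection_pos[OF \<alpha>(1) \<beta>(1) False] this] show ?thesis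
          unfolding eq[OF \<beta>(1)] .
      qed
    qed
    then obtain c as where c: "c > 0" "set as \<subseteq> simple_roots D"
      "T ?v * \<theta> (- inv ?v (?s y)) * ring_inv (T ?v) * \<theta> (?s y) =
        scale (of_real c) (Tprod as * Tprod (rev as))" by blast
    have inv_v: "inv ?v (?s y) = inv u y"
      using descent_inv[OF u \<alpha>(1,2), of "?s y"] reflection_involution[OF simple_root[OF \<alpha>(1)]]
      by simp
    have "T ?s * T ?v * (ring_inv (T ?v) * Tinv \<alpha>) = T ?s * (T ?v * ring_inv (T ?v)) * Tinv \<alpha>"
      "ring_inv (T ?v) * Tinv \<alpha> * (T ?s * T ?v) = ring_inv (T ?v) * (Tinv \<alpha> * T ?s) * T ?v"
      by (simp_all only: mult.assoc)
    then have ri: "ring_inv (T u) = ring_inv (T ?v) * Tinv \<alpha>"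
      unfolding T_descent[OF u \<alpha>(1,2)]
      by (intro ring_inv_eq) (simp_all add: Tinv[OF \<alpha>(1)] T_ring_inv[OF v])
    have "T u * \<theta> (- inv u y) * ring_inv (T u) * \<theta> y =
        T ?s * (T ?v * \<theta> (- inv ?v (?s y)) * ring_inv (T ?v)) * (Tinv \<alpha> * \<theta> y)"
      unfolding ri inv_v unfolding T_descent[OF u \<alpha>(1,2)] by (simp only: mult.assoc)
    \<comment> \<open>The inverse on the right of the conjugation turns into \<open>T ?s\<close>,
      the mirror image of the factor on the left. In this way the word and its reverse grow
      together.\<close>
    also have "\<dots> = scale (of_real (q powr - lam \<alpha>))
        (T ?s * (T ?v * \<theta> (- inv ?v (?s y)) * ring_inv (T ?v) * \<theta> (?s y)) * T ?s)"
      unfolding cross_minuscule[OF \<alpha>(1,3)] by (simp only: mult_scale mult.assoc)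
    also have "\<dots> = scale (of_real (q powr - lam \<alpha> * c)) (Tprod (\<alpha> # as) * Tprod (rev (\<alpha> # as)))"
      unfolding c(3) by (simp add: mult_scale mult.assoc)
    finally show ?thesis
      using c(1,2) \<alpha>(1) q_gt_1
      by (intro exI[of _ "q powr - lam \<alpha> * c"] conjI exI[of _ "\<alpha> # as"]) auto
  next
    case False
    have "pairing D y (coroot D \<alpha>) \<le> 0" if "\<alpha> \<in> simple_roots D" for \<alpha>
    proof (cases "pos (inv u \<alpha>)")
      case True
      then show ?thesis by (rule less.prems(3)[OF pos_simple[OF that]])
    next
      case neg: False
      have "pairing D y (coroot D \<alpha>) \<noteq> 1" using False that neg by blast
      then show ?thesis using less.prems(2)[OF pos_simple[OF that] neg] by simp
    qed
    then have "0 \<le> pairing D (- y) (coroot D \<beta>)" if "pos \<beta>" for \<beta>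
      by (intro dominant_pairing_nonneg[OF _ that]) (simp add: pairing_simps)
    \<comment> \<open>On inversions the pairing is 0 or 1 by the first sign condition, and at most 0
      because \<open>y\<close> is antidominant.\<close>
    then have "pairing D y (coroot D \<beta>) = 0" if "pos \<beta>" "\<not> pos (inv u \<beta>)" for \<beta>
      using less.prems(2)[OF that] that(1) by (fastforce simp: pairing_simps)
    note comm = T_commute_\<theta>[OF u this]
    have "T u * \<theta> (- inv u y) * ring_inv (T u) * \<theta> y
        = \<theta> (- y) * (T u * ring_inv (T u)) * \<theta> y"
      using comm by (simp add: mult.assoc)
    also have "\<dots> = 1" by (simp add: T_ring_inv[OF u] \<theta>_mult \<theta>_0)
    finally show ?thesis by (intro exI[of _ 1] conjI exI[of _ "[]"]) auto
  qed
qed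

end

context affine_hecke_star
begin

section \<open>Consequences of the star axioms\<close>

lemma star_0: "star 0 = 0"
  using star_add[of 0 0] by simp

lemma star_1: "star 1 = 1"
proof -
  obtain a where "star a = 1" using star_bij by (metis bij_pointE)
  then show ?thesis using star_mult[of 1 a] by simp
qed

lemma star_unit:
  assumes "a * b = 1" "b * a = 1"
  shows "star a * star b = 1" "star b * star a = 1"
  using assms star_1 by (metis star_mult)+

lemma star_T_simple: "\<alpha> \<in> simple_roots D \<Longrightarrow> star (T (reflection D \<alpha>)) = T (reflection D \<alpha>)"
  using star_T weyl_reflection_mem simple_root inv_reflection by simp

lemma star_Tprod: "set as \<subseteq> simple_roots D \<Longrightarrow> star (Tprod as) = Tprod (rev as)"
  by (induction as) (simp_all add: star_1 star_mult star_T_simple)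

text \<open>Involutivity has to be derived. On \<open>\<theta> x\<close> the two conjugations
  cancel, because \<open>star\<close> fixes \<open>T\<close> of the longest element and the longest
  element is its own inverse.\<close>

lemma star_star: "star (star h) = h"
proof (induction h rule: hecke_induct)
  case zero
  show ?case by (simp add: star_0)
next
  case (add c x w h)
  let ?l = "longest_element D"
  note l = longest_element_weyl
  have "star (T ?l) = T ?l" by (simp add: star_T l inv_longest_element)
  then have ri: "star (ring_inv (T ?l)) = ring_inv (T ?l)"
    using star_unit[OF T_ring_inv[OF l]] by (metis ring_inv_eq)
  have "?l (?l x) = x" using weyl_inv_cancel(1)[OF l, of x] by (simp add: inv_longest_element)
  then have "star (star (\<theta> x)) = ring_inv (T ?l) * (T ?l * \<theta> x * ring_inv (T ?l)) * T ?l"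
    by (simp add: star_\<theta> star_mult ri \<open>star (T ?l) = T ?l\<close> weyl_minus[OF l] mult.assoc)
  also have "\<dots> = (ring_inv (T ?l) * T ?l) * \<theta> x * (ring_inv (T ?l) * T ?l)"
    by (simp only: mult.assoc)
  finally have "star (star (\<theta> x)) = \<theta> x" by (simp add: T_ring_inv[OF l])
  moreover have "star (star (T w)) = T w"
    using add by (simp add: star_T weyl_inv inv_inv_eq weyl_bij)
  ultimately show ?case using add by (simp add: star_add star_scale star_mult)
qed

text \<open>All positive roots are inversions of the longest element, so the second sign condition
  of \<open>conjugate_\<theta>_positive\<close> is void; dominance and \<open>minuscule\<close> give
  the first.\<close>

lemma star_\<theta>_positive:
  assumes "minuscule x" "\<And>\<alpha>. \<alpha> \<in> simple_roots D \<Longrightarrow> 0 \<le> pairing D x (coroot D \<alpha>)"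
  shows "\<exists>c>0. \<exists>as. set as \<subseteq> simple_roots D \<and>
    star (\<theta> x) * \<theta> x = scale (of_real c) (Tprod as * Tprod (rev as))"
proof -
  have "pairing D x (coroot D \<beta>) \<in> {0, 1}" if "pos \<beta>" for \<beta>
    using dominant_pairing_nonneg[OF assms(2) that] assms(1) pos_root[OF that]
    unfolding minuscule_def by fastforce
  from conjugate_\<theta>_positive[OF longest_element_weyl this] longest_element_neg show ?thesis
    unfolding star_\<theta> inv_longest_element by blast
qed

end

section \<open>Grading by a quotient of the weight lattice\<close>

text \<open>\<open>L\<close> stands for any subgroup of \<open>X\<close> that contains the roots.
  Reflections and cross relations shift exponents by multiples of roots, so the quotient by
  \<open>L\<close> grades the algebra. For an isogeny, \<open>L\<close> is
  \<open>range f\<close>.\<close>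

locale graded_affine_hecke = affine_hecke_star +
  fixes L
  assumes subspace_L: "zmod.subspace L" and roots_L: "roots D \<subseteq> L"
begin

text \<open>Degrees are named by representatives instead of cosets; \<open>graded_cong\<close>
  identifies the names.\<close>

definition graded where
  "graded x = span ((\<lambda>(y, w). \<theta> y * T w) ` ({y. y - x \<in> L} \<times> weyl D))"

lemma L_simps:
  "0 \<in> L" "x \<in> L \<Longrightarrow> y \<in> L \<Longrightarrow> x + y \<in> L" "x \<in> L \<Longrightarrow> y \<in> L \<Longrightarrow> x - y \<in> L"
  "x \<in> L \<Longrightarrow> - x \<in> L" "x \<in> L \<Longrightarrow> zscale k x \<in> L"
  using subspace_L
  by (auto intro: zmod.subspace_0 zmod.subspace_add zmod.subspace_diff zmod.subspace_neg
      zmod.subspace_scale)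

lemma weyl_diff_L: "w \<in> weyl D \<Longrightarrow> w x - x \<in> L"
  using weyl_diff_span zmod.span_minimal[OF roots_L subspace_L] by blast

lemma graded_cong:
  assumes "x - x' \<in> L"
  shows "graded x = graded x'"
proof -
  have "y - x \<in> L \<longleftrightarrow> y - x' \<in> L" for y
    using L_simps(2)[OF _ assms, of "y - x"] L_simps(3)[OF _ assms, of "y - x'"] by auto
  then show ?thesis by (simp add: graded_def)
qed

lemma graded_base: "y - x \<in> L \<Longrightarrow> w \<in> weyl D \<Longrightarrow> \<theta> y * T w \<in> graded x"
  unfolding graded_def by (intro span_base) auto

lemma graded_induct [consumes 1, case_names zero add]:
  assumes "h \<in> graded x" "P 0"
    "\<And>c y w h. y - x \<in> L \<Longrightarrow> w \<in> weyl D \<Longrightarrow> h \<in> graded x \<Longrightarrow> P h \<Longrightarrow> P (scale c (\<theta> y * T w) + h)"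
  shows "P h"
proof -
  have "h \<in> graded x \<and> P h"
    using assms(1)[unfolded graded_def]
  proof (induction rule: span_induct_alt)
    case base
    show ?case using assms(2) by (simp add: graded_def span_zero)
  next
    case (step c b h)
    then show ?case using assms(3) graded_base
      by (auto simp: graded_def intro!: span_add span_scale)
  qed
  then show ?thesis by blast
qed

lemma graded_simps:
  "0 \<in> graded x" "a \<in> graded x \<Longrightarrow> b \<in> graded x \<Longrightarrow> a + b \<in> graded x"
  "a \<in> graded x \<Longrightarrow> scale c a \<in> graded x"
  unfolding graded_def by (auto intro: span_zero span_add span_scale)

lemma graded_mult_left:
  assumes "h \<in> graded x" "\<And>y w. y - x \<in> L \<Longrightarrow> w \<in> weyl D \<Longrightarrow> a * (\<theta> y * T w) \<in> graded z"
  shows "a * h \<in> graded z"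
  using assms(1)
  by (induction rule: graded_induct)
    (simp_all add: graded_simps distrib_left mult_scale assms(2))

lemma one_graded: "1 \<in> graded 0"
  using graded_base[of 0 0 id] by (simp only: \<theta>_0 T_id weyl.id L_simps diff_0_right) simp

lemma \<theta>_mult_graded: "h \<in> graded x \<Longrightarrow> \<theta> z * h \<in> graded (z + x)"
  by (erule graded_mult_left)
    (auto simp: \<theta>_mult add_diff_add L_simps(1) simp flip: mult.assoc intro!: graded_base)

text \<open>A telescoping geometric sum, whose exponents all lie in the coset of \<open>x\<close>.
  For negative \<open>k\<close> terms are subtracted instead of added, hence the induction in both
  directions.\<close>

lemma \<theta>_quotient:
  assumes "\<gamma> \<in> L"
  shows "\<exists>g\<in>span (\<theta> ` {y. y - x \<in> L}). g * (1 - \<theta> (- \<gamma>)) = \<theta> x - \<theta> (x - zscale k \<gamma>)"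
proof (induction k rule: int_induct[where k = 0])
  case base
  show ?case by (intro bexI[of _ 0]) (simp_all add: span_zero)
next
  case (step1 i)
  then obtain g where g: "g \<in> span (\<theta> ` {y. y - x \<in> L})"
    "g * (1 - \<theta> (- \<gamma>)) = \<theta> x - \<theta> (x - zscale i \<gamma>)" by blast
  have "\<theta> (x - zscale i \<gamma>) \<in> span (\<theta> ` {y. y - x \<in> L})"
    using assms by (intro span_base) (auto simp: L_simps)
  moreover have "\<theta> (x - zscale i \<gamma>) * (1 - \<theta> (- \<gamma>)) = \<theta> (x - zscale i \<gamma>) - \<theta> (x - zscale (i + 1) \<gamma>)"
    by (simp add: right_diff_distrib \<theta>_mult zscale_succ diff_diff_eq)
  ultimately show ?case
    using g by (intro bexI[of _ "g + \<theta> (x - zscale i \<gamma>)"] span_add) (simp_all add: distrib_right)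
next
  case (step2 i)
  then obtain g where g: "g \<in> span (\<theta> ` {y. y - x \<in> L})"
    "g * (1 - \<theta> (- \<gamma>)) = \<theta> x - \<theta> (x - zscale i \<gamma>)" by blast
  have "\<theta> (x - zscale (i - 1) \<gamma>) \<in> span (\<theta> ` {y. y - x \<in> L})"
    using assms by (intro span_base) (auto simp: L_simps)
  moreover have "\<theta> (x - zscale (i - 1) \<gamma>) * (1 - \<theta> (- \<gamma>)) =
      \<theta> (x - zscale (i - 1) \<gamma>) - \<theta> (x - zscale i \<gamma>)"
    by (simp add: right_diff_distrib \<theta>_mult zscale_pred)
  ultimately show ?case
    using g by (intro bexI[of _ "g - \<theta> (x - zscale (i - 1) \<gamma>)"] span_diff)
      (simp_all add: left_diff_distrib)
qed

text \<open>A priori the quotient in the cross relation lies in the span of all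
  \<open>\<theta>\<close>. Uniqueness identifies it with the telescoping sum of
  \<open>\<theta>_quotient\<close>, which stays in the degree of \<open>x\<close>.\<close>

lemma cross_graded:
  assumes \<alpha>: "\<alpha> \<in> simple_roots D"
  shows "\<exists>r\<in>span (\<theta> ` {y. y - x \<in> L}).
    T (reflection D \<alpha>) * \<theta> x = \<theta> (reflection D \<alpha> x) * T (reflection D \<alpha>) + r"
proof -
  let ?s = "reflection D \<alpha>" and ?S = "span (\<theta> ` {y. y - x \<in> L})"
  note root = simple_root[OF \<alpha>]
  have sub: "?S \<subseteq> span (range \<theta>)" by (rule span_mono) auto
  show ?thesis
  proof (cases "coroot_even D \<alpha>")
    case False
    obtain f where f: "f \<in> span (range \<theta>)" "f * (1 - \<theta> (- \<alpha>)) = \<theta> x - \<theta> (?s x)"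
      "T ?s * \<theta> x = \<theta> (?s x) * T ?s + scale (of_real (q powr lam \<alpha> - 1)) f"
      using cross_relation[OF \<alpha> False refl, of x] by auto
    obtain g where g: "g \<in> ?S" "g * (1 - \<theta> (- \<alpha>)) = \<theta> x - \<theta> (?s x)"
      using \<theta>_quotient[of \<alpha> x "pairing D x (coroot D \<alpha>)"] roots_L root
      by (auto simp: reflection_def)
    have "f = g"
      using f g sub zscale_uminus_root[OF root] by (intro \<theta>_quotient_unique[of f g "- \<alpha>"]) auto
    then show ?thesis using f(3) g(1) span_scale by blast
  next
    case True
    obtain f c d where f: "f \<in> span (range \<theta>)" "f * (1 - \<theta> (- (\<alpha> + \<alpha>))) = \<theta> x - \<theta> (?s x)"
      "T ?s * \<theta> x = \<theta> (?s x) * T ?s + (scale c 1 + scale d (\<theta> (- \<alpha>))) * f"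
      using cross_relation_even[OF \<alpha> True refl, of x] by blast
    \<comment> \<open>An even coroot makes the reflection shift \<open>x\<close> by a multiple of
      \<open>\<alpha> + \<alpha>\<close>, which is the step size in the denominator of this cross
      relation.\<close>
    obtain k where "pairing D x (coroot D \<alpha>) = 2 * k"
      using pairing_coroot_even[OF True, of x] by blast
    then have "?s x = x - zscale k (\<alpha> + \<alpha>)"
      by (simp add: reflection_def zmod.scale_right_distrib flip: zmod.scale_left_distrib)
    moreover have "\<alpha> + \<alpha> \<in> L" using roots_L root L_simps by blast
    ultimately obtain g where g: "g \<in> ?S" "g * (1 - \<theta> (- (\<alpha> + \<alpha>))) = \<theta> x - \<theta> (?s x)"
      using \<theta>_quotient[of "\<alpha> + \<alpha>" x k] by auto
    have "f = g"
      using f g sub zscale_uminus_double_root[OF root]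
      by (intro \<theta>_quotient_unique[of f g "- (\<alpha> + \<alpha>)"]) auto
    moreover have "\<theta> (- \<alpha>) * g \<in> ?S"
    proof (rule span_mult_left[OF g(1)])
      fix s assume "s \<in> \<theta> ` {y. y - x \<in> L}"
      then obtain y where y: "s = \<theta> y" "y - x \<in> L" by auto
      have "(y - x) - \<alpha> \<in> L" using y(2) roots_L root L_simps(3) by blast
      then show "\<theta> (- \<alpha>) * s \<in> ?S"
        unfolding y(1) \<theta>_mult by (intro span_base imageI) (simp add: algebra_simps)
    qed
    ultimately have "(scale c 1 + scale d (\<theta> (- \<alpha>))) * f \<in> ?S"
      using g(1) by (simp add: distrib_right mult_scale span_add span_scale)
    with f(3) show ?thesis by blast
  qed
qed

lemma T_simple_mult_T:
  assumes "\<alpha> \<in> simple_roots D" "w \<in> weyl D"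
  shows "\<exists>c d. T (reflection D \<alpha>) * T w = scale c (T (reflection D \<alpha> \<circ> w)) + scale d (T w)"
proof (cases "pos (inv w \<alpha>)")
  case True
  let ?s = "reflection D \<alpha>" and ?v = "reflection D \<alpha> \<circ> w"
  have v: "?v \<in> weyl D" using assms weyl.reflection simple_root by blast
  have "inv ?v \<alpha> = - inv w \<alpha>"
    using assms by (simp add: inv_reflection_comp simple_root reflection_self weyl_minus weyl_inv)
  then have "\<not> pos (inv ?v \<alpha>)" using True not_pos_neg by simp
  from T_descent[OF v assms(1) this] have "T ?v = T ?s * T w"
    using reflection_involution[OF simple_root[OF assms(1)]] by (simp add: o_def)
  then show ?thesis by (intro exI[of _ 1] exI[of _ 0]) simp
next
  case False
  let ?s = "reflection D \<alpha>" and ?v = "reflection D \<alpha> \<circ> w"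
  have "T ?s * T w = T ?s * T ?s * T ?v"
    using T_descent[OF assms(2,1) False] by (simp add: mult.assoc)
  also have "\<dots> = scale (of_real (q powr lam \<alpha> - 1)) (T ?s * T ?v) + scale (of_real (q powr lam \<alpha>)) (T ?v)"
    by (simp add: T_square[OF assms(1)] distrib_right mult_scale)
  also have "T ?s * T ?v = T w" using T_descent[OF assms(2,1) False] by simp
  finally show ?thesis by (metis add.commute)
qed

lemma T_simple_mult_graded:
  assumes "\<alpha> \<in> simple_roots D" "h \<in> graded x"
  shows "T (reflection D \<alpha>) * h \<in> graded x"
  using assms(2)
proof (rule graded_mult_left)
  let ?s = "reflection D \<alpha>"
  fix y w assume y: "y - x \<in> L" and w: "w \<in> weyl D"
  obtain r where r: "r \<in> span (\<theta> ` {z. z - y \<in> L})"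
    "T ?s * \<theta> y = \<theta> (?s y) * T ?s + r" using cross_graded[OF assms(1)] by blast
  obtain c d where cd: "T ?s * T w = scale c (T (?s \<circ> w)) + scale d (T w)"
    using T_simple_mult_T[OF assms(1) w] by blast
  have sw: "?s \<circ> w \<in> weyl D" using assms(1) w weyl.reflection simple_root by blast
  have "?s y - x \<in> L"
    using L_simps(2)[OF weyl_diff_L[OF weyl_reflection_mem[OF simple_root[OF assms(1)]], of y] y] by simp
  then have "\<theta> (?s y) * (T ?s * T w) \<in> graded x"
    unfolding cd using sw w by (simp add: distrib_left mult_scale graded_simps graded_base)
  moreover have "r * T w \<in> graded x"
    unfolding graded_def
  proof (rule span_mult_right[OF r(1)])
    fix s assume "s \<in> \<theta> ` {z. z - y \<in> L}"
    then obtain z where z: "s = \<theta> z" "z - y \<in> L" by auto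
    have "z - x \<in> L" using L_simps(2)[OF z(2) y] by simp
    with graded_base[OF this w] z(1)
    show "s * T w \<in> span ((\<lambda>(y, w). \<theta> y * T w) ` ({y. y - x \<in> L} \<times> weyl D))"
      by (simp add: graded_def)
  qed
  moreover have "T ?s * (\<theta> y * T w) = \<theta> (?s y) * (T ?s * T w) + r * T w"
    unfolding mult.assoc[symmetric] r(2) by (simp only: distrib_right mult.assoc)
  ultimately show "T ?s * (\<theta> y * T w) \<in> graded x" by (simp add: graded_simps)
qed

lemma Tprod_mult_graded:
  "set as \<subseteq> simple_roots D \<Longrightarrow> h \<in> graded x \<Longrightarrow> Tprod as * h \<in> graded x"
  by (induction as) (simp_all add: T_simple_mult_graded mult.assoc)

lemma Tinv_mult_graded: "\<alpha> \<in> simple_roots D \<Longrightarrow> h \<in> graded x \<Longrightarrow> Tinv \<alpha> * h \<in> graded x"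
  by (simp add: Tinv_def distrib_right mult_scale graded_simps T_simple_mult_graded)

lemma ring_inv_Tprod_mult_graded:
  assumes "set as \<subseteq> simple_roots D" "h \<in> graded x"
  shows "ring_inv (Tprod as) * h \<in> graded x"
proof -
  obtain bs where bs: "set bs \<subseteq> simple_roots D"
    "Tprod as * prod_list (map Tinv bs) = 1" "prod_list (map Tinv bs) * Tprod as = 1"
    using Tprod_inverse[OF assms(1)] by blast
  have "prod_list (map Tinv bs) * h \<in> graded x"
    using bs(1) assms(2) by (induction bs) (simp_all add: Tinv_mult_graded mult.assoc)
  with ring_inv_eq[OF bs(2,3)] show ?thesis by simp
qed

lemma T_mult_graded: "w \<in> weyl D \<Longrightarrow> h \<in> graded x \<Longrightarrow> T w * h \<in> graded x"
  using T_eq_Tprod Tprod_mult_graded by metis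

lemma mult_graded:
  assumes "a \<in> graded x" "b \<in> graded y"
  shows "a * b \<in> graded (x + y)"
  using assms(1)
proof (induction rule: graded_induct)
  case zero
  show ?case by (simp add: graded_simps)
next
  case (add c z w a)
  have "\<theta> z * (T w * b) \<in> graded (z + y)"
    using add assms(2) by (intro \<theta>_mult_graded T_mult_graded)
  moreover have "graded (z + y) = graded (x + y)" using add by (intro graded_cong) simp
  ultimately show ?case using add by (simp add: distrib_right mult_scale mult.assoc graded_simps)
qed

text \<open>\<open>star (\<theta> y)\<close> has the exponent \<open>- longest_element D y\<close>,
  congruent to \<open>- y\<close> modulo \<open>L\<close>, and its conjugating factors have degree
  zero.\<close>

lemma star_graded:
  assumes "h \<in> graded x"
  shows "star h \<in> graded (- x)"
  using assms
proof (induction rule: graded_induct)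
  case zero
  show ?case by (simp add: graded_simps star_0)
next
  case (add c y w h)
  let ?l = "longest_element D"
  note l = longest_element_weyl
  obtain as where as: "set as \<subseteq> simple_roots D" "T ?l = Tprod as" using T_eq_Tprod[OF l] by blast
  have "ring_inv (T ?l) \<in> graded 0"
    using ring_inv_Tprod_mult_graded[OF as(1) one_graded] as(2) by simp
  then have "T ?l * (\<theta> (- ?l y) * ring_inv (T ?l)) \<in> graded (- ?l y)"
    using T_mult_graded[OF l \<theta>_mult_graded[of _ 0]] by simp
  then have "T (inv w) * star (\<theta> y) \<in> graded (- ?l y)"
    using add by (simp add: star_\<theta> T_mult_graded weyl_inv mult.assoc)
  moreover have "- ?l y - - x = - ((?l y - y) + (y - x))" by simp
  then have "graded (- ?l y) = graded (- x)"
    using L_simps(4)[OF L_simps(2)[OF weyl_diff_L[OF l, of y] add(1)]] by (intro graded_cong) simp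
  ultimately show ?case
    using add by (simp add: star_add star_scale star_mult star_T graded_simps)
qed

lemma graded_unitary:
  "\<exists>u\<in>graded x. star u * u = 1 \<and> u * star u = 1"
proof -
  obtain z where z: "z - x \<in> zmod.span (roots D)" "minuscule z"
    "\<And>\<alpha>. \<alpha> \<in> simple_roots D \<Longrightarrow> 0 \<le> pairing D z (coroot D \<alpha>)"
    using minuscule_representative by blast
  obtain c as where c: "c > 0" "set as \<subseteq> simple_roots D"
    "star (\<theta> z) * \<theta> z = scale (of_real c) (Tprod as * Tprod (rev as))"
    using star_\<theta>_positive[OF z(2,3)] by blast
  define A b where "A = Tprod as" and "b = ring_inv (Tprod (rev as))"
  have A: "A * ring_inv A = 1" "ring_inv A * A = 1"
    using Tprod_ring_inv[OF c(2)] by (simp_all add: A_def)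
  have b: "star A * b = 1" "b * star A = 1"
    using Tprod_ring_inv[of "rev as"] c(2) by (simp_all add: A_def b_def star_Tprod)
  have star_b: "star b * A = 1" "A * star b = 1" using star_unit[OF b] by (simp_all add: star_star)
  have scale_c: "cnj (of_real (1 / sqrt c)) * (of_real (1 / sqrt c) * of_real c) = (1 :: complex)"
    using c(1) by (simp flip: of_real_mult)
  define u where "u = scale (of_real (1 / sqrt c)) (\<theta> z * b)"
  have "star u * u = scale (cnj (of_real (1 / sqrt c)) * of_real (1 / sqrt c))
      (star b * (star (\<theta> z) * \<theta> z) * b)"
    by (simp add: u_def star_scale star_mult mult_scale mult.assoc)
  also have "\<dots> = scale (cnj (of_real (1 / sqrt c)) * (of_real (1 / sqrt c) * of_real c))
      ((star b * A) * (star A * b))"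
    by (simp only: c(3) mult_scale scale_scale mult.assoc A_def star_Tprod[OF c(2)])
  finally have 1: "star u * u = 1" unfolding scale_c star_b b by simp
  \<comment> \<open>\<open>star u * u = 1\<close> only gives a left inverse. An explicit right
    inverse of \<open>u\<close> forces \<open>u * star u = 1\<close> too.\<close>
  define r where "r = scale (of_real (sqrt c)) (star A * \<theta> (- z))"
  have "u * r = scale (of_real (1 / sqrt c) * of_real (sqrt c)) (\<theta> z * (b * star A) * \<theta> (- z))"
    by (simp add: u_def r_def mult_scale mult.assoc)
  also have "\<dots> = 1"
    using c(1) by (simp add: b \<theta>_mult \<theta>_0 flip: of_real_mult)
  finally have "u * star u = 1" using 1 by (metis mult.assoc mult_1_left mult_1_right)
  \<comment> \<open>\<open>b\<close> is the inverse of a product of generators, hence of degree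
    zero; the factor 1 brings the term into the form in which such inverses were shown to preserve
    degrees.\<close>
  moreover have "\<theta> z * (b * 1) \<in> graded (z + 0)"
    unfolding b_def using c(2) by (intro \<theta>_mult_graded ring_inv_Tprod_mult_graded one_graded) simp
  moreover have "graded z = graded x"
    using z(1) zmod.span_minimal[OF roots_L subspace_L] by (intro graded_cong) blast
  ultimately show ?thesis using 1 by (intro bexI[of _ u]) (simp_all add: u_def graded_simps)
qed

end

section \<open>Isogenies\<close>

context root_datum_isogeny
begin

lemma isogeny_simps: "f (x + y) = f x + f y" "f 0 = 0" "f (- x) = - f x" "f (x - y) = f x - f y"
  using isogeny_additive by (simp_all add: additive.add additive.zero additive.minus additive.diff)

text \<open>Read through the transpose, \<open>isogeny_coroot\<close> says that the pairing of
  \<open>f x\<close> with the coroot of \<open>f \<alpha>\<close> is that of \<open>x\<close> with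
  the coroot of \<open>\<alpha>\<close>.\<close>

lemma reflection_isogeny:
  assumes "\<alpha> \<in> roots D1"
  shows "reflection D2 (f \<alpha>) \<circ> f = f \<circ> reflection D1 \<alpha>"
  using pairing_dual_map[OF D1.perfect D2.perfect isogeny_additive, of _ "coroot D2 (f \<alpha>)"]
    isogeny_coroot[OF assms] additive_zscale[OF isogeny_additive]
  by (auto simp: reflection_def isogeny_simps)

lemma weyl_image: "w \<in> weyl D1 \<Longrightarrow> \<exists>w'\<in>weyl D2. w' \<circ> f = f \<circ> w"
proof (induction rule: weyl.induct)
  case id
  show ?case using weyl.id by (intro bexI[of _ id]) simp
next
  case (reflection \<alpha> w)
  then obtain w' where w': "w' \<in> weyl D2" "w' \<circ> f = f \<circ> w" by blast
  have "reflection D2 (f \<alpha>) \<circ> w' \<circ> f = f \<circ> (reflection D1 \<alpha> \<circ> w)"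
    unfolding comp_assoc w'(2) using reflection_isogeny[OF reflection(1)]
    by (simp only: comp_assoc[symmetric])
  moreover have "reflection D2 (f \<alpha>) \<circ> w' \<in> weyl D2"
    using reflection(1) isogeny_roots w'(1) by (intro weyl.reflection) auto
  ultimately show ?case by blast
qed

lemma weyl_preimage: "w' \<in> weyl D2 \<Longrightarrow> \<exists>w\<in>weyl D1. w' \<circ> f = f \<circ> w"
proof (induction rule: weyl.induct)
  case id
  show ?case using weyl.id by (intro bexI[of _ id]) simp
next
  case (reflection \<beta> w')
  then obtain w where w: "w \<in> weyl D1" "w' \<circ> f = f \<circ> w" by blast
  obtain \<alpha> where \<alpha>: "\<alpha> \<in> roots D1" "\<beta> = f \<alpha>" using reflection(1) isogeny_roots by blast
  have "reflection D2 \<beta> \<circ> w' \<circ> f = f \<circ> (reflection D1 \<alpha> \<circ> w)"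
    unfolding comp_assoc w(2) using reflection_isogeny[OF \<alpha>(1)]
    by (simp only: comp_assoc[symmetric] \<alpha>(2))
  moreover have "reflection D1 \<alpha> \<circ> w \<in> weyl D1" using \<alpha>(1) w(1) by (rule weyl.reflection)
  ultimately show ?case by blast
qed

lemma inv_intertwines:
  assumes "w \<in> weyl D1" "w' \<in> weyl D2" "w' \<circ> f = f \<circ> w"
  shows "inv w' \<circ> f = f \<circ> inv w"
proof -
  have "inv w' \<circ> f = inv w' \<circ> (f \<circ> w) \<circ> inv w"
    using D1.weyl_inv_cancel(3)[OF assms(1)] by (simp only: comp_assoc comp_id)
  also have "\<dots> = f \<circ> inv w"
    by (simp only: assms(3)[symmetric] D2.weyl_inv_cancel(6)[OF assms(2)])
  finally show ?thesis .
qed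

lemma pos_image:
  assumes "D1.pos \<beta>"
  shows "D2.pos (f \<beta>)"
proof -
  obtain k where k: "\<forall>\<gamma>. 0 \<le> k \<gamma>" "\<beta> = D1.comb k" "\<beta> \<in> roots D1"
    using assms unfolding D1.pos_def by blast
  have "f \<beta> = (\<Sum>\<alpha>\<in>simple_roots D1. zscale (k \<alpha>) (f \<alpha>))"
    unfolding k(2) D1.comb_def additive.sum[OF isogeny_additive]
    by (simp only: additive_zscale[OF isogeny_additive])
  \<comment> \<open>\<open>D2.comb\<close> expects coefficients indexed by the second lattice;
    \<open>inv f\<close> transports them, as all simple roots of \<open>D2\<close> lie in the range
    of \<open>f\<close>.\<close>
  also have "\<dots> = (\<Sum>\<alpha>\<in>simple_roots D1. zscale (k (inv f (f \<alpha>))) (f \<alpha>))"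
    by (simp add: inv_f_f[OF isogeny_inj])
  also have "\<dots> = D2.comb (\<lambda>\<gamma>. k (inv f \<gamma>))"
    unfolding D2.comb_def isogeny_simple[symmetric]
    by (simp add: sum.reindex[OF inj_on_subset[OF isogeny_inj subset_UNIV]])
  finally have "f \<beta> = D2.comb (\<lambda>\<gamma>. k (inv f \<gamma>))" .
  moreover have "f \<beta> \<in> roots D2" using k(3) isogeny_roots by blast
  moreover have "\<forall>\<gamma>. 0 \<le> k (inv f \<gamma>)" using k(1) by blast
  ultimately show ?thesis
    unfolding D2.pos_def by (intro conjI exI[of _ "\<lambda>\<gamma>. k (inv f \<gamma>)"])
qed

text \<open>The two longest elements are chosen independently. As \<open>f\<close> preserves
  positivity, the inverse of the partner of the first one makes all simple roots of
  \<open>D2\<close> negative, and uniqueness identifies this partner with the second.\<close>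

lemma longest_element_isogeny:
  "longest_element D2 \<circ> f = f \<circ> longest_element D1"
proof -
  note l = D1.longest_element_weyl
  obtain w' where w': "w' \<in> weyl D2" "w' \<circ> f = f \<circ> longest_element D1"
    using weyl_image[OF l] by blast
  have "w' = longest_element D2"
  proof (rule D2.longest_element_unique[OF w'(1)])
    fix \<beta> assume "\<beta> \<in> simple_roots D2"
    then obtain \<alpha> where \<alpha>: "\<alpha> \<in> simple_roots D1" "\<beta> = f \<alpha>" using isogeny_simple by blast
    let ?\<gamma> = "inv (longest_element D1) \<alpha>"
    have \<gamma>: "?\<gamma> \<in> roots D1"
      using D1.weyl_roots[OF D1.weyl_inv[OF l]] D1.simple_root[OF \<alpha>(1)] by blast
    have "inv w' \<beta> = f ?\<gamma>"
      using inv_intertwines[OF l w'] \<alpha>(2) by (metis comp_apply)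
    moreover have "D1.pos (- ?\<gamma>)"
      using D1.longest_element_neg[OF D1.pos_simple[OF \<alpha>(1)]] D1.neg_iff[OF \<gamma>] by blast
    then have "D2.pos (- f ?\<gamma>)" using pos_image by (metis isogeny_simps(3))
    ultimately show "\<not> D2.pos (inv w' \<beta>)" using D2.not_pos_neg by force
  qed
  with w' show ?thesis by blast
qed

lemma subspace_range: "zmod.subspace (range f)"
  unfolding zmod.subspace_def
  by (auto simp: additive_zscale[OF isogeny_additive, symmetric] intro: range_eqI isogeny_simps[symmetric])

lemma equiv_cokernel: "equiv UNIV {(x, y). x - y \<in> range f}"
proof (rule equivI)
  show "sym {(x, y). x - y \<in> range f}"
  proof (rule symI, clarify)
    fix x y a assume "x - y = f a"
    then have "y - x = f (- a)" by (metis isogeny_simps(3) minus_diff_eq)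
    then show "y - x \<in> range f" by blast
  qed
  show "trans {(x, y). x - y \<in> range f}"
  proof (rule transI, clarify)
    fix x y z a b assume *: "x - y = f a" "y - z = f b"
    then have "x - z = f (a + b)" by (simp add: isogeny_simps flip: *)
    then show "x - z \<in> range f" by blast
  qed
qed (auto simp: refl_on_def intro: range_eqI[of _ f 0] simp: isogeny_simps)

end

locale affine_hecke_star_isogeny =
  affine_hecke_isogeny D1 D2 q lam1 lams1 lam2 lams2 scale1 scale2 \<theta>1 T1 \<theta>2 T2 f \<phi> +
  S1: affine_hecke_star D1 q lam1 lams1 scale1 \<theta>1 T1 star1 +
  S2: affine_hecke_star D2 q lam2 lams2 scale2 \<theta>2 T2 star2
  for D1 :: "('x1::ab_group_add, 'y1::ab_group_add) root_datum"
    and D2 :: "('x2::ab_group_add, 'y2::ab_group_add) root_datum"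
    and q :: real and lam1 lams1 :: "'x1 \<Rightarrow> real" and lam2 lams2 :: "'x2 \<Rightarrow> real"
    and scale1 :: "complex \<Rightarrow> 'h1::ring_1 \<Rightarrow> 'h1"
    and scale2 :: "complex \<Rightarrow> 'h2::ring_1 \<Rightarrow> 'h2"
    and \<theta>1 :: "'x1 \<Rightarrow> 'h1" and T1 :: "('x1 \<Rightarrow> 'x1) \<Rightarrow> 'h1" and star1 :: "'h1 \<Rightarrow> 'h1"
    and \<theta>2 :: "'x2 \<Rightarrow> 'h2" and T2 :: "('x2 \<Rightarrow> 'x2) \<Rightarrow> 'h2" and star2 :: "'h2 \<Rightarrow> 'h2"
    and f :: "'x1 \<Rightarrow> 'x2" and \<phi> :: "'h1 \<Rightarrow> 'h2"
begin

sublocale G: graded_affine_hecke D2 q lam2 lams2 scale2 \<theta>2 T2 star2 "range f"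
  by unfold_locales (use subspace_range isogeny_roots in auto)

section \<open>The image of \<open>\<phi>\<close>: star and degree\<close>

lemma hom_0: "\<phi> 0 = 0"
  using hom_add[of 0 0] by simp

lemma hom_\<theta>: "\<phi> (\<theta>1 x) = \<theta>2 (f x)"
  using \<phi>_basis[OF weyl.id weyl.id, of x] by (simp add: H1.T_id[unfolded id_def] H2.T_id[unfolded id_def] H1.T_id H2.T_id)

lemma hom_T: "w \<in> weyl D1 \<Longrightarrow> w' \<in> weyl D2 \<Longrightarrow> w' \<circ> f = f \<circ> w \<Longrightarrow> \<phi> (T1 w) = T2 w'"
  using \<phi>_basis[of w w' 0] by (simp add: H1.\<theta>_0 H2.\<theta>_0 isogeny_simps)

text \<open>Compatibility with the stars is not assumed. It holds because both stars are given on
  \<open>T\<close> and \<open>\<theta>\<close> by the same formulas in Weyl group elements, which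
  \<open>f\<close> intertwines, the longest elements included.\<close>

lemma hom_star: "\<phi> (star1 a) = star2 (\<phi> a)"
proof (induction a rule: H1.hecke_induct)
  case zero
  show ?case by (simp add: S1.star_0 S2.star_0 hom_0)
next
  case (add c x w a)
  let ?l = "longest_element D1" and ?l' = "longest_element D2"
  note l = H1.longest_element_weyl H2.longest_element_weyl
  obtain w' where w': "w' \<in> weyl D2" "w' \<circ> f = f \<circ> w" using weyl_image add(1) by blast
  have "\<phi> (star1 (T1 w)) = star2 (\<phi> (T1 w))"
    using hom_T[OF add(1) w'] hom_T[OF H1.weyl_inv[OF add(1)] H2.weyl_inv[OF w'(1)]
        inv_intertwines[OF add(1) w']]
    by (simp add: S1.star_T S2.star_T add w')
  moreover have "\<phi> (star1 (\<theta>1 x)) = star2 (\<phi> (\<theta>1 x))"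
  proof -
    have T: "\<phi> (T1 ?l) = T2 ?l'" using hom_T l longest_element_isogeny by blast
    have "T2 ?l' * \<phi> (ring_inv (T1 ?l)) = 1" "\<phi> (ring_inv (T1 ?l)) * T2 ?l' = 1"
      unfolding T[symmetric] hom_mult[symmetric] by (simp_all add: H1.T_ring_inv l hom_one)
    then have "\<phi> (ring_inv (T1 ?l)) = ring_inv (T2 ?l')" using ring_inv_eq by metis
    moreover have "f (- ?l x) = - ?l' (f x)"
      using fun_cong[OF longest_element_isogeny, of x] by (simp add: isogeny_simps)
    ultimately show ?thesis by (simp add: S1.star_\<theta> S2.star_\<theta> hom_mult hom_\<theta> T)
  qed
  ultimately show ?case
    using add(2) by (simp add: S1.star_add S1.star_scale S1.star_mult S2.star_add S2.star_scale
        S2.star_mult hom_add hom_scale hom_mult)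
qed

lemma hom_graded: "\<phi> a \<in> G.graded 0"
proof (induction a rule: H1.hecke_induct)
  case zero
  show ?case by (simp add: hom_0 G.graded_simps)
next
  case (add c x w a)
  obtain w' where w': "w' \<in> weyl D2" "w' \<circ> f = f \<circ> w" using weyl_image add(1) by blast
  have "\<theta>2 (f x) * T2 w' \<in> G.graded 0" using w' by (intro G.graded_base) auto
  then show ?case
    using add \<phi>_basis[OF add(1) w'] by (simp add: hom_add hom_scale G.graded_simps)
qed

text \<open>Together with \<open>hom_graded\<close>: the image of \<open>\<phi>\<close> is exactly
  the part of degree zero. This uses that every element of the second Weyl group has a partner in
  the first.\<close>

lemma graded_hom:
  assumes "h \<in> G.graded 0"
  shows "\<exists>a. h = \<phi> a"
  using assms
proof (induction rule: G.graded_induct)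
  case zero
  show ?case using hom_0 by metis
next
  case (add c y w' h)
  obtain x where x: "y = f x" using add(1) by auto
  obtain w where w: "w \<in> weyl D1" "w' \<circ> f = f \<circ> w" using weyl_preimage add(2) by blast
  obtain a where a: "h = \<phi> a" using add by blast
  have "scale2 c (\<theta>2 y * T2 w') + h = \<phi> (scale1 c (\<theta>1 x * T1 w) + a)"
    using \<phi>_basis[OF w(1) add(2) w(2)] x a by (simp add: hom_add hom_scale)
  then show ?case by blast
qed

text \<open>\<open>\<phi>\<close> maps basis elements injectively to basis elements. Inverting it on
  those, sending the remaining basis elements to 0 and extending linearly gives the projection to
  degree zero, read in the first algebra.\<close>

lemma expectation_exists:
  "\<exists>E. additive E \<and> (\<forall>a. E (\<phi> a) = a) \<and> (\<forall>x h. x \<notin> range f \<longrightarrow> h \<in> G.graded x \<longrightarrow> E h = 0)"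
proof -
  interpret P: vector_space_pair scale2 scale1 by unfold_locales
  let ?b1 = "\<lambda>(x, w). \<theta>1 x * T1 w" and ?b2 = "\<lambda>(x, w). \<theta>2 x * T2 w"
  let ?B1 = "?b1 ` (UNIV \<times> weyl D1)" and ?B2 = "?b2 ` (UNIV \<times> weyl D2)"
  have b2_inj: "x = y \<and> v = w" if "\<theta>2 x * T2 v = \<theta>2 y * T2 w" "v \<in> weyl D2" "w \<in> weyl D2" for x y v w
    using inj_onD[OF H2.basis_inj, of "(x, v)" "(y, w)"] that by simp
  have hom_inj: "inj_on \<phi> ?B1"
  proof (rule inj_onI, clarify)
    fix x w y v assume *: "w \<in> weyl D1" "v \<in> weyl D1" "\<phi> (\<theta>1 x * T1 w) = \<phi> (\<theta>1 y * T1 v)"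
    obtain w' where w': "w' \<in> weyl D2" "w' \<circ> f = f \<circ> w" using weyl_image *(1) by blast
    obtain v' where v': "v' \<in> weyl D2" "v' \<circ> f = f \<circ> v" using weyl_image *(2) by blast
    have eq: "f x = f y \<and> w' = v'"
      using b2_inj[of "f x" w' "f y" v'] *(3) w'(1) v'(1) \<phi>_basis[OF *(1) w'] \<phi>_basis[OF *(2) v'] by simp
    then have "x = y" using isogeny_inj by (simp add: inj_eq)
    moreover have "f \<circ> w = f \<circ> v" using eq w' v' by simp
    then have "w = v" using isogeny_inj by (simp add: fun_eq_iff inj_eq)
    ultimately show "\<theta>1 x * T1 w = \<theta>1 y * T1 v" by simp
  qed
  obtain E where E: "Vector_Spaces.linear scale2 scale1 E"
    "\<forall>b\<in>?B2. E b = (if b \<in> \<phi> ` ?B1 then inv_into ?B1 \<phi> b else 0)"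
    using P.linear_independent_extend[OF H2.basis_independent,
        of "\<lambda>b. if b \<in> \<phi> ` ?B1 then inv_into ?B1 \<phi> b else 0"] by blast
  note E_simps = P.linear_add[OF E(1)] P.linear_scale[OF E(1)] P.linear_0[OF E(1)]
  have "E (\<phi> a) = a" for a
  proof (induction a rule: H1.hecke_induct)
    case zero
    show ?case by (simp add: hom_0 E_simps)
  next
    case (add c x w a)
    have b: "\<theta>1 x * T1 w \<in> ?B1" using add(1) by auto
    obtain w' where w': "w' \<in> weyl D2" "w' \<circ> f = f \<circ> w" using weyl_image add(1) by blast
    have "\<phi> (\<theta>1 x * T1 w) \<in> ?B2" using \<phi>_basis[OF add(1) w'] w'(1) by auto
    from bspec[OF E(2) this] have "E (\<phi> (\<theta>1 x * T1 w)) = \<theta>1 x * T1 w"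
      by (simp only: imageI[OF b] inv_into_f_f[OF hom_inj b] if_True)
    then show ?case using add(2) by (simp add: hom_add hom_scale E_simps)
  qed
  moreover have "E h = 0" if x: "x \<notin> range f" and h: "h \<in> G.graded x" for x h
    using h
  proof (induction rule: G.graded_induct)
    case zero
    show ?case by (rule E_simps)
  next
    case (add c y w h)
    have y: "y \<notin> range f" using G.L_simps(3)[OF _ add(1), of y] x by auto
    have "\<theta>2 y * T2 w \<notin> \<phi> ` ?B1"
    proof
      assume "\<theta>2 y * T2 w \<in> \<phi> ` ?B1"
      then obtain z v where v: "v \<in> weyl D1" "\<theta>2 y * T2 w = \<phi> (\<theta>1 z * T1 v)" by auto
      obtain v' where v': "v' \<in> weyl D2" "v' \<circ> f = f \<circ> v" using weyl_image v(1) by blast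
      have "y = f z" using b2_inj[of y w "f z" v'] v(2) \<phi>_basis[OF v(1) v'] v'(1) add(2) by simp
      with y show False by blast
    qed
    moreover have "\<theta>2 y * T2 w \<in> ?B2" using add(2) by auto
    ultimately have "E (\<theta>2 y * T2 w) = 0" using bspec[OF E(2)] by (simp only: if_False)
    then show ?case using add(4) by (simp add: E_simps)
  qed
  ultimately show ?thesis by (intro exI[of _ E]) (auto simp: additive_def E_simps)
qed

definition expectation where
  "expectation = (SOME E. additive E \<and> (\<forall>a. E (\<phi> a) = a) \<and>
     (\<forall>x h. x \<notin> range f \<longrightarrow> h \<in> G.graded x \<longrightarrow> E h = 0))"

lemma expectation:
  shows expectation_add: "expectation (x + y) = expectation x + expectation y"
    and expectation_hom: "expectation (\<phi> a) = a"
    and expectation_graded: "z \<notin> range f \<Longrightarrow> h \<in> G.graded z \<Longrightarrow> expectation h = 0"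
    and expectation_0: "expectation 0 = 0"
  using someI_ex[OF expectation_exists] unfolding expectation_def[symmetric]
  by (auto simp: additive.add additive.zero)

section \<open>Homogeneous elements and the orthonormal family\<close>

lemma homogeneous_induct [case_names homogeneous add]:
  assumes "\<And>x g. g \<in> G.graded x \<Longrightarrow> P g" "\<And>g h. P g \<Longrightarrow> P h \<Longrightarrow> P (g + h)"
  shows "P h"
proof (induction h rule: H2.hecke_induct)
  case zero
  show ?case by (rule assms(1)[OF G.graded_simps(1)])
next
  case (add c x w h)
  have "scale2 c (\<theta>2 x * T2 w) \<in> G.graded x"
    using add(1) G.L_simps(1) by (intro G.graded_simps(3) G.graded_base) auto
  then show ?case using assms add(2) by blast
qed

lemma homogeneous_cases:
  assumes "h \<in> G.graded x"
  obtains a where "h = \<phi> a" "x \<in> range f" | "x \<notin> range f" "expectation h = 0"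
proof (cases "x \<in> range f")
  case True
  then have "h \<in> G.graded 0" using G.graded_cong[of x 0] assms by simp
  with graded_hom True that(1) show ?thesis by blast
next
  case False
  with expectation_graded[OF False assms] that(2) show ?thesis by blast
qed

text \<open>By additivity \<open>h\<close> may be taken homogeneous. Multiplying by the degree-zero
  element \<open>\<phi> a\<close> keeps its degree, so both sides vanish unless \<open>h\<close>
  lies in the image of \<open>\<phi>\<close>.\<close>

lemma expectation_mult: "expectation (h * \<phi> a) = expectation h * a"
proof (induction h rule: homogeneous_induct)
  case (homogeneous x h)
  then show ?case
  proof (cases rule: homogeneous_cases)
    case (1 b)
    then show ?thesis by (simp add: expectation_hom flip: hom_mult)
  next
    case 2
    have "h * \<phi> a \<in> G.graded x" using G.mult_graded[OF homogeneous hom_graded, of a] by simp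
    with 2 show ?thesis by (simp add: expectation_graded)
  qed
next
  case (add g h)
  then show ?case by (simp add: distrib_right expectation_add)
qed

lemma expectation_star: "expectation (star2 h) = star1 (expectation h)"
proof (induction h rule: homogeneous_induct)
  case (homogeneous x h)
  then show ?case
  proof (cases rule: homogeneous_cases)
    case (1 b)
    then show ?thesis by (simp add: expectation_hom flip: hom_star)
  next
    case 2
    then have "- x \<notin> range f" using G.L_simps(4)[of "- x"] by auto
    then show ?thesis
      using 2 expectation_graded[OF _ G.star_graded[OF homogeneous]] by (simp add: S1.star_0)
  qed
next
  case (add g h)
  then show ?case by (simp add: S1.star_add S2.star_add expectation_add)
qed

lemma coset_unitary:
  "\<exists>u. \<forall>c\<in>cokernel f. \<exists>x\<in>c. u c \<in> G.graded x \<and> star2 (u c) * u c = 1 \<and> u c * star2 (u c) = 1"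
proof (rule bchoice, rule ballI)
  fix c assume "c \<in> cokernel f"
  then obtain x where "x \<in> c" using equiv_cokernel in_quotient_imp_non_empty unfolding cokernel_def by blast
  with G.graded_unitary[of x]
  show "\<exists>u. \<exists>x\<in>c. u \<in> G.graded x \<and> star2 u * u = 1 \<and> u * star2 u = 1" by blast
qed

text \<open>For different cosets \<open>star2 (u c) * u d\<close> has nonzero degree and is killed.
  The two unitarity identities serve separately: \<open>star2 (u c) * u c = 1\<close> gives norm 1,
  and \<open>u c * star2 (u c) = 1\<close> gives the expansion, where only the coset of a
  homogeneous \<open>h\<close> contributes and no part of \<open>star2 (u c) * h\<close> is lost
  under \<open>expectation\<close>.\<close>

lemma orthonormal_family:
  obtains u where
    "\<And>c d. c \<in> cokernel f \<Longrightarrow> d \<in> cokernel f \<Longrightarrow>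
       expectation (star2 (u c) * u d) = (if c = d then 1 else 0)"
    "\<And>h. (\<Sum>c\<in>cokernel f. u c * \<phi> (expectation (star2 (u c) * h))) = h"
proof -
  obtain u where "\<forall>c\<in>cokernel f. \<exists>x\<in>c. u c \<in> G.graded x \<and> star2 (u c) * u c = 1 \<and> u c * star2 (u c) = 1"
    using coset_unitary by blast
  from bchoice[OF this[unfolded Bex_def]] obtain r where
    u: "\<And>c. c \<in> cokernel f \<Longrightarrow> r c \<in> c" "\<And>c. c \<in> cokernel f \<Longrightarrow> u c \<in> G.graded (r c)"
      "\<And>c. c \<in> cokernel f \<Longrightarrow> star2 (u c) * u c = 1" "\<And>c. c \<in> cokernel f \<Longrightarrow> u c * star2 (u c) = 1"
    by blast
  have coset: "c = d \<longleftrightarrow> x - y \<in> range f"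
    if "c \<in> cokernel f" "d \<in> cokernel f" "x \<in> c" "y \<in> d" for c d x y
    using quotient_eq_iff[OF equiv_cokernel, of c d x y] that by (simp add: cokernel_def)
  have 1: "expectation (star2 (u c) * h) = 0"
    if "c \<in> cokernel f" "d \<in> cokernel f" "x \<in> d" "c \<noteq> d" "h \<in> G.graded x" for c d x h
  proof (rule expectation_graded)
    show "star2 (u c) * h \<in> G.graded (- r c + x)"
      using that u(2) by (intro G.mult_graded G.star_graded)
    show "- r c + x \<notin> range f" using coset[of d c x "r c"] that u(1) by auto
  qed
  have 2: "expectation (star2 (u c) * u d) = (if c = d then 1 else 0)"
    if "c \<in> cokernel f" "d \<in> cokernel f" for c d
  proof (cases "c = d")
    case True
    then show ?thesis using u(3)[OF that(1)] expectation_hom[of 1] by (simp add: hom_one)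
  next
    case False
    then show ?thesis using 1[OF that u(1)[OF that(2)] False u(2)[OF that(2)]] by simp
  qed
  have 3: "(\<Sum>c\<in>cokernel f. u c * \<phi> (expectation (star2 (u c) * h))) = h" for h
  proof (induction h rule: homogeneous_induct)
    case (homogeneous x h)
    obtain d where d: "d \<in> cokernel f" "x \<in> d"
      using equiv_class_self[OF equiv_cokernel, of x] quotientI[of x UNIV] unfolding cokernel_def by blast
    have "u c * \<phi> (expectation (star2 (u c) * h)) = (if c = d then h else 0)"
      if c: "c \<in> cokernel f" for c
    proof (cases "c = d")
      case True
      have "- r d + x \<in> range f"
        using coset[OF d(1) d(1) d(2) u(1)[OF d(1)]] by simp
      moreover have "star2 (u d) * h \<in> G.graded (- r d + x)"
        using d homogeneous u(2) by (intro G.mult_graded G.star_graded)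
      ultimately obtain a where a: "star2 (u d) * h = \<phi> a" using homogeneous_cases by blast
      have "u d * \<phi> a = h"
        unfolding a[symmetric] using u(4)[OF d(1)] by (simp flip: mult.assoc)
      then show ?thesis using True by (simp add: a expectation_hom)
    next
      case False
      then show ?thesis using 1[OF c d False homogeneous] by (simp add: hom_0)
    qed
    then show ?case using d(1) finite_cokernel by simp
  next
    case (add g h)
    then show ?case by (simp add: distrib_left expectation_add hom_add sum.distrib)
  qed
  show ?thesis using that 2 3 by blast
qed

end

section \<open>Forms on induced modules\<close>

lemma tensor_eval_superset:
  assumes "finite S" "Poly_Mapping.keys F \<subseteq> S"
  shows "tensor_eval g F = (\<Sum>p\<in>S. zscale (Poly_Mapping.lookup F p) (g (fst p) (snd p)))"
  unfolding tensor_eval_def using assms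
  by (intro sum.mono_neutral_left) (auto simp: not_in_keys_iff_lookup_eq_zero)

lemma tensor_eval_additive: "additive (tensor_eval g)"
proof (rule additive.intro)
  fix F G :: "('a \<times> 'b) \<Rightarrow>\<^sub>0 int"
  let ?S = "Poly_Mapping.keys F \<union> Poly_Mapping.keys G"
  have "finite ?S" by simp
  moreover have "Poly_Mapping.keys (F + G) \<subseteq> ?S" by (rule Poly_Mapping.keys_add)
  ultimately show "tensor_eval g (F + G) = tensor_eval g F + tensor_eval g G"
    by (simp add: tensor_eval_superset[of ?S] lookup_add zmod.scale_left_distrib sum.distrib)
qed

lemma tensor_eval_frag_of: "tensor_eval g (frag_of (b, v)) = g b v"
  by (simp add: tensor_eval_def zscale_one)

context induced_module
begin

section \<open>Rules of the tensor product and its universal property\<close>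

lemma tensor_relation: "F \<in> tensor_relators \<phi> actV \<Longrightarrow> tensor_eval \<tau> F = 0"
  using tensor_kernel zmod.span_base by blast

lemma tensor_add_left: "\<tau> (b + b') v = \<tau> b v + \<tau> b' v"
proof -
  have "frag_of (b + b', v) - frag_of (b, v) - frag_of (b', v) \<in> tensor_relators \<phi> actV"
    unfolding tensor_relators_def by (rule UnI1, rule UnI1) blast
  from tensor_relation[OF this] have "\<tau> (b + b') v - \<tau> b v - \<tau> b' v = 0"
    by (simp only: additive.diff[OF tensor_eval_additive] tensor_eval_frag_of)
  then show ?thesis by (simp add: algebra_simps)
qed

lemma tensor_add_right: "\<tau> b (v + v') = \<tau> b v + \<tau> b v'"
proof -
  have "frag_of (b, v + v') - frag_of (b, v) - frag_of (b, v') \<in> tensor_relators \<phi> actV"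
    unfolding tensor_relators_def by (rule UnI1, rule UnI2) blast
  from tensor_relation[OF this] have "\<tau> b (v + v') - \<tau> b v - \<tau> b v' = 0"
    by (simp only: additive.diff[OF tensor_eval_additive] tensor_eval_frag_of)
  then show ?thesis by (simp add: algebra_simps)
qed

lemma tensor_balanced: "\<tau> (b * \<phi> a) v = \<tau> b (actV a v)"
proof -
  have "frag_of (b * \<phi> a, v) - frag_of (b, actV a v) \<in> tensor_relators \<phi> actV"
    unfolding tensor_relators_def by (rule UnI2) blast
  from tensor_relation[OF this] show ?thesis
    by (simp add: additive.diff[OF tensor_eval_additive] tensor_eval_frag_of)
qed

lemma tensor_additive: "additive (\<lambda>b. \<tau> b v)" "additive (\<tau> b)"
  by (simp_all add: additive_def tensor_add_left tensor_add_right)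

text \<open>The relators speak of sums and of the algebra action only. A complex scalar passes
  through the tensor sign as the algebra element \<open>scaleA c 1\<close>.\<close>

lemma tensor_scale: "scaleM c (\<tau> b v) = \<tau> b (scaleV c v)"
proof -
  have "scaleM c (\<tau> b v) = actM (scaleB c 1) (\<tau> b v)"
    by (simp add: M.act_scale_left M.act_one)
  also have "\<dots> = \<tau> (b * \<phi> (scaleA c 1)) v"
    using hom_one hom_scale[of c 1]
    by (simp add: tensor_act flip: B.scale_mult_left B.scale_mult_right)
  also have "\<dots> = \<tau> b (scaleV c v)"
    by (simp only: tensor_balanced V.act_scale_left V.act_one)
  finally show ?thesis .
qed

text \<open>Integer coefficients can be absorbed into the second tensor factor, so plain sums of
  tensors exhaust the module.\<close>

lemma tensor_induct [case_names tensor add]: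
  assumes "\<And>b v. P (\<tau> b v)" "\<And>m n. P m \<Longrightarrow> P n \<Longrightarrow> P (m + n)"
  shows "P m"
proof -
  obtain F where F: "m = tensor_eval \<tau> F" using tensor_surj by (metis surjD)
  have "P (\<Sum>p\<in>S. zscale (Poly_Mapping.lookup F p) (\<tau> (fst p) (snd p)))" if "finite S" for S
    using that
  proof induction
    case empty
    show ?case using assms(1)[of 0 0] additive.zero[OF tensor_additive(2)] by simp
  next
    case (insert p S)
    then show ?case using assms additive_zscale[OF tensor_additive(2)] by (metis sum.insert)
  qed
  then show ?thesis by (simp add: F tensor_eval_def)
qed

text \<open>A balanced biadditive \<open>g\<close> kills the relators, hence the whole kernel of
  \<open>tensor_eval \<tau>\<close>. So evaluating \<open>g\<close> on any chosen preimage of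
  \<open>m\<close> is well defined.\<close>

lemma induced_map:
  fixes g :: "'b \<Rightarrow> 'v \<Rightarrow> 'z::ab_group_add"
  assumes "\<And>b b' v. g (b + b') v = g b v + g b' v" "\<And>b v v'. g b (v + v') = g b v + g b v'"
    and "\<And>a b v. g (b * \<phi> a) v = g b (actV a v)"
  shows "\<exists>G. additive G \<and> (\<forall>b v. G (\<tau> b v) = g b v)"
proof -
  note add = tensor_eval_additive
  have "zmod.subspace {F. tensor_eval g F = 0}"
    by (auto simp: zmod.subspace_def additive.zero[OF add] additive.add[OF add] additive_zscale[OF add])
  moreover have "tensor_relators \<phi> actV \<subseteq> {F. tensor_eval g F = 0}"
    by (auto simp: tensor_relators_def additive.diff[OF add] tensor_eval_frag_of assms)
  ultimately have ker: "tensor_eval g F = 0" if "tensor_eval \<tau> F = 0" for F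
    using that tensor_kernel zmod.span_minimal by blast
  have eq: "tensor_eval g F = tensor_eval g F'" if "tensor_eval \<tau> F = tensor_eval \<tau> F'" for F F'
    using ker[of "F - F'"] that by (simp add: additive.diff[OF add])
  obtain r where r: "\<And>m. tensor_eval \<tau> (r m) = m" using tensor_surj by (metis surjD)
  have "additive (\<lambda>m. tensor_eval g (r m))"
  proof (rule additive.intro)
    fix m n
    have "tensor_eval g (r (m + n)) = tensor_eval g (r m + r n)"
      by (rule eq) (simp add: r additive.add[OF add])
    then show "tensor_eval g (r (m + n)) = tensor_eval g (r m) + tensor_eval g (r n)"
      by (simp add: additive.add[OF add])
  qed
  moreover have "tensor_eval g (r (\<tau> b v)) = g b v" for b v
    using eq[of "r (\<tau> b v)" "frag_of (b, v)"] by (simp add: r tensor_eval_frag_of)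
  ultimately show ?thesis by blast
qed

end

lemma hermitian_form_simps:
  assumes "hermitian_form scale B"
  shows "B (u + v) w = B u w + B v w" "B u (v + w) = B u v + B u w" "B 0 w = 0" "B u 0 = 0"
    "B (scale c v) w = c * B v w" "B w v = cnj (B v w)"
proof -
  have *: "B (u + v) w = B u w + B v w" "B w v = cnj (B v w)" for u v w
    using assms unfolding hermitian_form_def by blast+
  show add: "B (u + v) w = B u w + B v w" by (rule *)
  show "B u (v + w) = B u v + B u w"
    using *(2)[of u "v + w"] *(2)[of u v] *(2)[of u w] *(1)[of v w u] by simp
  show "B 0 w = 0" using *(1)[of 0 0 w] by simp
  then show "B u 0 = 0" using *(1)[of 0 0 u] *(2)[of u 0] by simp
  show "B (scale c v) w = c * B v w" using assms unfolding hermitian_form_def by blast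
  show "B w v = cnj (B v w)" by (rule *)
qed

text \<open>
  \<open>E\<close> plays the role of a conditional expectation \<open>B \<rightarrow> A\<close>, and \<open>u\<close> is an orthonormal basis of
  the right \<open>A\<close>-module \<open>B\<close> for the \<open>A\<close>-valued inner product \<open>E(x\<^sup>* y)\<close>.
\<close>

locale orthonormal_induction = induced_module scaleA scaleB \<phi> scaleV actV scaleM actM \<tau>
  for scaleA :: "complex \<Rightarrow> 'a::ring_1 \<Rightarrow> 'a"
    and scaleB :: "complex \<Rightarrow> 'b::ring_1 \<Rightarrow> 'b"
    and \<phi> :: "'a \<Rightarrow> 'b"
    and scaleV :: "complex \<Rightarrow> 'v::ab_group_add \<Rightarrow> 'v" and actV :: "'a \<Rightarrow> 'v \<Rightarrow> 'v"
    and scaleM :: "complex \<Rightarrow> 'm::ab_group_add \<Rightarrow> 'm" and actM :: "'b \<Rightarrow> 'm \<Rightarrow> 'm"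
    and \<tau> :: "'b \<Rightarrow> 'v \<Rightarrow> 'm" +
  fixes starA :: "'a \<Rightarrow> 'a" and starB :: "'b \<Rightarrow> 'b" and E :: "'b \<Rightarrow> 'a"
    and C :: "'c set" and u :: "'c \<Rightarrow> 'b"
  assumes starB_mult: "starB (x * y) = starB y * starB x"
    and starB_starB: "starB (starB x) = x"
    and E_add: "E (x + y) = E x + E y"
    and E_mult: "E (x * \<phi> a) = E x * a"
    and E_star: "E (starB x) = starA (E x)"
    and finite_C: "finite C"
    and orthonormal: "c \<in> C \<Longrightarrow> d \<in> C \<Longrightarrow> E (starB (u c) * u d) = (if c = d then 1 else 0)"
    and expansion: "(\<Sum>c\<in>C. u c * \<phi> (E (starB (u c) * x))) = x"
begin

section \<open>Coordinates and the form on the induced module\<close>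

lemma actV_0: "actV 0 v = 0"
  using V.act_add_left[of 0 0 v] by simp

lemma actV_sum: "actV (\<Sum>i\<in>I. g i) v = (\<Sum>i\<in>I. actV (g i) v)"
  using additive.sum[of "\<lambda>a. actV a v"] by (simp add: additive_def V.act_add_left)

lemma E_sum: "E (\<Sum>i\<in>I. g i) = (\<Sum>i\<in>I. E (g i))"
  by (rule additive.sum) (simp add: additive_def E_add)

text \<open>The component in \<open>V\<close> along \<open>u c\<close> in the decomposition of the
  induced module into the summands \<open>u c\<close> tensor \<open>V\<close>. Its existence is the
  universal property, with balancedness supplied by \<open>E_mult\<close>.\<close>

definition coord :: "'c \<Rightarrow> 'm \<Rightarrow> 'v" where
  "coord c = (SOME G. additive G \<and> (\<forall>h v. G (\<tau> h v) = actV (E (starB (u c) * h)) v))"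

lemma coord_additive: "additive (coord c)"
  and coord_tensor: "coord c (\<tau> h v) = actV (E (starB (u c) * h)) v"
proof -
  have "\<exists>G. additive G \<and> (\<forall>h v. G (\<tau> h v) = actV (E (starB (u c) * h)) v)"
    by (rule induced_map)
      (simp_all add: distrib_left E_add V.act_add_left V.act_add_right E_mult V.act_mult
        flip: mult.assoc)
  from someI_ex[OF this] show "additive (coord c)" "coord c (\<tau> h v) = actV (E (starB (u c) * h)) v"
    unfolding coord_def by blast+
qed

lemma coord_unit:
  "c \<in> C \<Longrightarrow> d \<in> C \<Longrightarrow> coord c (\<tau> (u d) v) = (if c = d then v else 0)"
  by (simp add: coord_tensor orthonormal V.act_one actV_0)

lemma coord_scale: "coord c (scaleM a m) = scaleV a (coord c m)"
  by (induction m rule: tensor_induct)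
    (simp_all add: tensor_scale coord_tensor V.act_scale_right M.V.scale_right_distrib
      V.V.scale_right_distrib additive.add[OF coord_additive])

lemma coord_expansion: "(\<Sum>c\<in>C. \<tau> (u c) (coord c m)) = m"
proof (induction m rule: tensor_induct)
  case (tensor h v)
  have "(\<Sum>c\<in>C. \<tau> (u c) (coord c (\<tau> h v))) = (\<Sum>c\<in>C. \<tau> (u c * \<phi> (E (starB (u c) * h))) v)"
    by (simp add: coord_tensor tensor_balanced)
  also have "\<dots> = \<tau> h v"
    using additive.sum[OF tensor_additive(1), of "\<lambda>c. u c * \<phi> (E (starB (u c) * h))" C v]
    by (simp add: expansion)
  finally show ?case .
next
  case (add m n)
  then show ?case by (simp add: additive.add[OF coord_additive] tensor_add_right sum.distrib)
qed

definition form :: "('v \<Rightarrow> 'v \<Rightarrow> complex) \<Rightarrow> 'm \<Rightarrow> 'm \<Rightarrow> complex" where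
  "form B m n = (\<Sum>c\<in>C. B (coord c m) (coord c n))"

lemma hermitian_form_form:
  assumes "hermitian_form scaleV B"
  shows "hermitian_form scaleM (form B)"
proof -
  note * = hermitian_form_simps[OF assms]
  have sym: "form B w v = cnj (form B v w)" for v w
    unfolding form_def cnj_sum by (intro sum.cong refl *(6))
  show ?thesis
    unfolding hermitian_form_def
  proof (intro conjI allI)
    show "form B w v = cnj (form B v w)" for v w by (rule sym)
  qed (simp_all add: form_def *(1-5) additive.add[OF coord_additive] coord_scale sum.distrib
      sum_distrib_left)
qed

text \<open>A Parseval identity. The right-hand side is free of the basis \<open>u\<close>, and in
  it moving an algebra element across the form is mere associativity; this is how invariance is
  obtained.\<close>

lemma form_tensor:
  assumes B: "hermitian_form scaleV B" "star_invariant starA actV B"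
  shows "form B (\<tau> k v) (\<tau> k' w) = B v (actV (E (starB k * k')) w)"
proof -
  have star: "starA (E (starB (u c) * k)) = E (starB k * u c)" for c
    by (simp add: starB_mult starB_starB flip: E_star)
  have "form B (\<tau> k v) (\<tau> k' w) =
      (\<Sum>c\<in>C. B (actV (E (starB (u c) * k)) v) (actV (E (starB (u c) * k')) w))"
    by (simp add: form_def coord_tensor)
  also have "\<dots> = (\<Sum>c\<in>C. B v (actV (starA (E (starB (u c) * k))) (actV (E (starB (u c) * k')) w)))"
    using B(2) unfolding star_invariant_def by simp
  \<comment> \<open>Right linearity merges the two values of \<open>E\<close> into one, under which
    the summands of the \<open>expansion\<close> of \<open>k'\<close> appear.\<close>
  also have "\<dots> = (\<Sum>c\<in>C. B v (actV (E (starB k * (u c * \<phi> (E (starB (u c) * k'))))) w))"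
    by (simp add: star E_mult V.act_mult flip: mult.assoc)
  also have "\<dots> = B v (\<Sum>c\<in>C. actV (E (starB k * (u c * \<phi> (E (starB (u c) * k'))))) w)"
    by (rule additive.sum[symmetric]) (simp add: additive_def hermitian_form_simps(1-5)[OF B(1)])
  also have "\<dots> = B v (actV (E (starB k * k')) w)"
    by (simp add: expansion flip: actV_sum E_sum sum_distrib_left)
  finally show ?thesis .
qed

lemma star_invariant_form:
  assumes B: "hermitian_form scaleV B" "star_invariant starA actV B"
  shows "star_invariant starB actM (form B)"
  unfolding star_invariant_def
proof (intro allI)
  fix h m n
  note form_add = hermitian_form_simps(1,2)[OF hermitian_form_form[OF B(1)]]
  show "form B (actM h m) n = form B m (actM (starB h) n)"
  proof (induction m rule: tensor_induct)
    case (tensor k v)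
    show ?case
    proof (induction n rule: tensor_induct)
      case (tensor k' w)
      show ?case by (simp add: tensor_act form_tensor[OF B] starB_mult mult.assoc)
    next
      case (add m n)
      then show ?case by (simp add: form_add M.act_add_right)
    qed
  next
    case (add m m')
    then show ?case by (simp add: form_add M.act_add_right)
  qed
qed

text \<open>A nonzero \<open>m\<close> has a nonzero coordinate by \<open>coord_expansion\<close>.
  Definiteness is passed on through coordinates because \<open>unitary_module\<close> is not phrased
  by signatures.\<close>

lemma form_positive:
  assumes "hermitian_form scaleV B" "\<And>v. v \<noteq> 0 \<Longrightarrow> 0 < Re (B v v)" "m \<noteq> 0"
  shows "0 < Re (form B m m)"
proof -
  have "\<exists>c\<in>C. coord c m \<noteq> 0"
  proof (rule ccontr)
    assume "\<not> ?thesis"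
    then have "(\<Sum>c\<in>C. \<tau> (u c) (coord c m)) = 0"
      by (simp add: additive.zero[OF tensor_additive(2)])
    with assms(3) show False by (simp add: coord_expansion)
  qed
  then obtain c where c: "c \<in> C" "coord c m \<noteq> 0" by blast
  have nonneg: "0 \<le> Re (B v v)" for v
    using assms(2)[of v] hermitian_form_simps(3)[OF assms(1)] by (cases "v = 0") auto
  have "0 < (\<Sum>c\<in>C. Re (B (coord c m) (coord c m)))"
    by (rule sum_pos2[where f = "\<lambda>c. Re (B (coord c m) (coord c m))",
          OF finite_C c(1) assms(2)[OF c(2)] nonneg])
  then show ?thesis by (simp add: form_def)
qed

text \<open>Coordinates separate the summands: \<open>coord d\<close> turns a linear relation among
  the tensors into one within \<open>S\<close>, and by \<open>coord_expansion\<close> every element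
  is a sum over the summands.\<close>

lemma induced_basis:
  assumes "finite_dimensional_vector_space scaleV S"
  shows "inj_on (\<lambda>(c, e). \<tau> (u c) e) (C \<times> S)"
    and "finite_dimensional_vector_space scaleM ((\<lambda>(c, e). \<tau> (u c) e) ` (C \<times> S))"
proof -
  interpret S: finite_dimensional_vector_space scaleV S by fact
  let ?t = "\<lambda>(c, e). \<tau> (u c) e"
  have nz: "e \<noteq> 0" if "e \<in> S" for e
    using that S.independent_Basis V.V.dependent_zero by blast
  show inj: "inj_on ?t (C \<times> S)"
  proof (rule inj_onI, clarify)
    fix c e d e' assume *: "c \<in> C" "e \<in> S" "d \<in> C" "e' \<in> S" "\<tau> (u c) e = \<tau> (u d) e'"
    have "e = coord c (\<tau> (u c) e)" using *(1) by (simp add: coord_unit)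
    also have "\<dots> = (if c = d then e' else 0)"
      unfolding *(5) using *(1,3) by (simp add: coord_unit)
    finally have "e = (if c = d then e' else 0)" .
    then show "c = d \<and> e = e'" using nz[OF *(2)] by (auto split: if_splits)
  qed
  have fin: "finite (?t ` (C \<times> S))" using finite_C S.finite_Basis by simp
  have "g x = 0" if sum: "(\<Sum>x\<in>?t ` (C \<times> S). scaleM (g x) x) = 0" and x: "x \<in> ?t ` (C \<times> S)" for g x
  proof -
    obtain d e where de: "d \<in> C" "e \<in> S" "x = \<tau> (u d) e" using x by auto
    have "0 = coord d (\<Sum>x\<in>?t ` (C \<times> S). scaleM (g x) x)"
      by (simp add: sum additive.zero[OF coord_additive])
    also have "\<dots> = (\<Sum>p\<in>C \<times> S. coord d (scaleM (g (?t p)) (?t p)))"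
      by (simp add: additive.sum[OF coord_additive] sum.reindex[OF inj])
    also have "\<dots> = (\<Sum>c\<in>C. \<Sum>e\<in>S. coord d (scaleM (g (\<tau> (u c) e)) (\<tau> (u c) e)))"
      by (simp add: sum.cartesian_product case_prod_unfold)
    also have "\<dots> = (\<Sum>c\<in>C. if c = d then \<Sum>e\<in>S. scaleV (g (\<tau> (u c) e)) e else 0)"
      using de(1) by (intro sum.cong) (auto simp: coord_scale coord_unit)
    also have "\<dots> = (\<Sum>e\<in>S. scaleV (g (\<tau> (u d) e)) e)"
      using de(1) finite_C by simp
    finally have "(\<Sum>e\<in>S. scaleV (g (\<tau> (u d) e)) e) = 0" by simp
    from V.V.independentD[OF S.independent_Basis S.finite_Basis subset_refl this de(2)] de(3)
    show ?thesis by simp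
  qed
  then have indep: "M.V.independent (?t ` (C \<times> S))"
    using fin by (intro M.V.independent_if_scalars_zero)
  have "\<tau> (u c) v \<in> M.V.span (?t ` (C \<times> S))" if "c \<in> C" for c v
  proof -
    have "v \<in> V.V.span S" by (simp add: S.span_Basis)
    then show ?thesis
    proof (induction rule: V.V.span_induct_alt)
      case base
      show ?case by (simp add: additive.zero[OF tensor_additive(2)] M.V.span_zero)
    next
      case (step a e v)
      then have "\<tau> (u c) e \<in> ?t ` (C \<times> S)" using that by auto
      with step show ?case
        by (simp add: tensor_add_right M.V.span_add M.V.span_scale M.V.span_base flip: tensor_scale)
    qed
  qed
  then have "m \<in> M.V.span (?t ` (C \<times> S))" for m
    by (subst coord_expansion[of m, symmetric]) (rule M.V.span_sum)
  then have span: "M.V.span (?t ` (C \<times> S)) = UNIV" by blast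
  show "finite_dimensional_vector_space scaleM (?t ` (C \<times> S))"
    by (intro finite_dimensional_vector_space.intro finite_dimensional_vector_space_axioms.intro
        M.V.vector_space_axioms fin indep span)
qed

text \<open>Tensoring an orthogonal basis of \<open>V\<close> with every \<open>u c\<close> gives an
  orthogonal basis of the induced module, in which each diagonal value of \<open>B\<close> occurs
  once for each \<open>c\<close>.\<close>

lemma has_signature_form:
  assumes B: "hermitian_form scaleV B" and "has_signature scaleV B a b"
  shows "has_signature scaleM (form B) (card C * a) (card C * b)"
proof -
  let ?t = "\<lambda>(c, e). \<tau> (u c) e"
  obtain S where S: "finite_dimensional_vector_space scaleV S"
    "\<And>v w. v \<in> S \<Longrightarrow> w \<in> S \<Longrightarrow> v \<noteq> w \<Longrightarrow> B v w = 0"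
    "card {v \<in> S. 0 < Re (B v v)} = a" "card {v \<in> S. Re (B v v) < 0} = b"
    using assms(2) unfolding has_signature_def by blast
  note inj = induced_basis(1)[OF S(1)]
  have form_basis: "form B (\<tau> (u c) e) (\<tau> (u d) e') = (if c = d then B e e' else 0)"
    if "c \<in> C" "d \<in> C" for c d e e'
  proof -
    have "form B (\<tau> (u c) e) (\<tau> (u d) e') = (\<Sum>k\<in>C. if k = c then (if c = d then B e e' else 0) else 0)"
      unfolding form_def using that
      by (intro sum.cong) (auto simp: coord_unit hermitian_form_simps(3,4)[OF B])
    also have "\<dots> = (if c = d then B e e' else 0)"
      using that finite_C by simp
    finally show ?thesis .
  qed
  have card: "card {m \<in> ?t ` (C \<times> S). P (form B m m)} = card C * card {v \<in> S. P (B v v)}" for P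
  proof -
    have "{m \<in> ?t ` (C \<times> S). P (form B m m)} = ?t ` (C \<times> {v \<in> S. P (B v v)})"
      using form_basis by auto
    moreover have "inj_on ?t (C \<times> {v \<in> S. P (B v v)})"
      by (rule inj_on_subset[OF inj]) auto
    ultimately show ?thesis by (simp add: card_image card_cartesian_product)
  qed
  show ?thesis
    unfolding has_signature_def
  proof (intro exI[of _ "?t ` (C \<times> S)"] conjI)
    show "\<forall>m\<in>?t ` (C \<times> S). \<forall>n\<in>?t ` (C \<times> S). m \<noteq> n \<longrightarrow> form B m n = 0"
      using form_basis by (auto intro!: S(2))
    show "card {m \<in> ?t ` (C \<times> S). 0 < Re (form B m m)} = card C * a"
      using card[of "\<lambda>z. 0 < Re z"] S(3) by simp
    show "card {m \<in> ?t ` (C \<times> S). Re (form B m m) < 0} = card C * b"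
      using card[of "\<lambda>z. Re z < 0"] S(4) by simp
  qed (rule induced_basis(2)[OF S(1)])
qed

end

theorem theorem5p6:
  fixes D1 :: "('x1::ab_group_add, 'y1::ab_group_add) root_datum"
    and D2 :: "('x2::ab_group_add, 'y2::ab_group_add) root_datum"
    and q :: real and lam1 lams1 :: "'x1 \<Rightarrow> real" and lam2 lams2 :: "'x2 \<Rightarrow> real"
    and scale1 :: "complex \<Rightarrow> 'h1::ring_1 \<Rightarrow> 'h1"
    and scale2 :: "complex \<Rightarrow> 'h2::ring_1 \<Rightarrow> 'h2"
    and \<theta>1 :: "'x1 \<Rightarrow> 'h1" and T1 :: "('x1 \<Rightarrow> 'x1) \<Rightarrow> 'h1" and star1 :: "'h1 \<Rightarrow> 'h1"
    and \<theta>2 :: "'x2 \<Rightarrow> 'h2" and T2 :: "('x2 \<Rightarrow> 'x2) \<Rightarrow> 'h2" and star2 :: "'h2 \<Rightarrow> 'h2"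
    and f :: "'x1 \<Rightarrow> 'x2" and \<phi> :: "'h1 \<Rightarrow> 'h2" and n :: nat
    and scaleV :: "complex \<Rightarrow> 'v::ab_group_add \<Rightarrow> 'v" and actV :: "'h1 \<Rightarrow> 'v \<Rightarrow> 'v"
    and scaleM :: "complex \<Rightarrow> 'm::ab_group_add \<Rightarrow> 'm" and actM :: "'h2 \<Rightarrow> 'm \<Rightarrow> 'm"
    and \<tau> :: "'h2 \<Rightarrow> 'v \<Rightarrow> 'm"
  assumes "affine_hecke_isogeny D1 D2 q lam1 lams1 lam2 lams2 scale1 scale2 \<theta>1 T1 \<theta>2 T2 f \<phi>"
    and "affine_hecke_star D1 q lam1 lams1 scale1 \<theta>1 T1 star1"
    and "affine_hecke_star D2 q lam2 lams2 scale2 \<theta>2 T2 star2"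
    and "card (cokernel f) = n"
    and "complex_algebra_module scale1 scaleV actV"
    and "\<exists>E. finite_dimensional_vector_space scaleV E"
    and "induced_module scale1 scale2 \<phi> scaleV actV scaleM actM \<tau>"
  shows "(\<forall>B a b.
            hermitian_form scaleV B \<and> star_invariant star1 actV B \<and> has_signature scaleV B a b \<longrightarrow>
            (\<exists>B'. hermitian_form scaleM B' \<and> star_invariant star2 actM B' \<and>
                  has_signature scaleM B' (n * a) (n * b)))
       \<and> (unitary_module star1 scaleV actV \<longrightarrow> unitary_module star2 scaleM actM)"
proof -
  interpret I: affine_hecke_star_isogeny D1 D2 q lam1 lams1 lam2 lams2 scale1 scale2
    \<theta>1 T1 star1 \<theta>2 T2 star2 f \<phi>
    by (intro affine_hecke_star_isogeny.intro assms)
  obtain u where u: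
    "\<And>c d. c \<in> cokernel f \<Longrightarrow> d \<in> cokernel f \<Longrightarrow>
       I.expectation (star2 (u c) * u d) = (if c = d then 1 else 0)"
    "\<And>h. (\<Sum>c\<in>cokernel f. u c * \<phi> (I.expectation (star2 (u c) * h))) = h"
    using I.orthonormal_family by blast
  interpret O: orthonormal_induction scale1 scale2 \<phi> scaleV actV scaleM actM \<tau> star1 star2
    I.expectation "cokernel f" u
  proof (intro orthonormal_induction.intro orthonormal_induction_axioms.intro)
    show "induced_module scale1 scale2 \<phi> scaleV actV scaleM actM \<tau>" by fact
  qed (simp_all add: I.S2.star_mult I.S2.star_star I.expectation_add I.expectation_mult
      I.expectation_star I.finite_cokernel u)
  show ?thesis
  proof (intro conjI allI impI)
    fix B a b
    assume "hermitian_form scaleV B \<and> star_invariant star1 actV B \<and> has_signature scaleV B a b"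
    then show "\<exists>B'. hermitian_form scaleM B' \<and> star_invariant star2 actM B' \<and>
        has_signature scaleM B' (n * a) (n * b)"
      using O.hermitian_form_form O.star_invariant_form O.has_signature_form assms(4) by blast
  next
    assume "unitary_module star1 scaleV actV"
    then show "unitary_module star2 scaleM actM"
      unfolding unitary_module_def
      using O.hermitian_form_form O.star_invariant_form O.form_positive by meson
  qed
qed

end
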